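(* There is an algorithm that, given a deMorgan formula $F$ of size $s$ over $n$ Boolean input variables, constructs two rooted binary trees $T_1$ and $T_2$ such that $|T_1| = \mathcal{O}(2^{n/2}\cdot s)$, $|T_2| = \mathcal{O}(2^{n/2}\cdot s^2)$, the construction takes $\mathcal{O}(|T_2|)$ time, and $T_1$ is contained in $T_2$ if and only if there exists $x\in\{0,1\}^n$ with $F(x)=1$.
   Context: A deMorgan formula over $n$ Boolean input variables is a rooted binary tree whose leaves (input gates) are each labeled by an input variable or its negation, and whose internal nodes are each labeled by a logical operator in $\{\land,\lor\}$. For $x\in\{0,1\}^n$, $F(x)$ is the value output at the root when the input bits are propagated from the leaves to the root. The size $s$ of the formula is its number of leaves. For rooted trees, $|T|$ denotes the number of vertices of $T$. A rooted tree $T_1$ is contained in a rooted tree $T_2$ if $T_1$ is isomorphic (as a rooted tree, preserving parent–child relations) to a subtree of $T_2$, i.e., there is an injective map from the vertices of $T_1$ to those of $T_2$ sending each parent–child pair of $T_1$ to a parent–child pair of $T_2$. Subtree Isomorphism is the problem of deciding, given $T_1,T_2$, whether $T_1$ is contained in $T_2$. *)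

theory Defs
  imports Complex_Main
begin

datatype formula = Lit nat bool | And formula formula | Or formula formula

fun eval :: "formula \<Rightarrow> (nat \<Rightarrow> bool) \<Rightarrow> bool" where
  "eval (Lit i b) x = (if b then x i else \<not> x i)"
| "eval (And f g) x = (eval f x \<and> eval g x)"
| "eval (Or f g) x = (eval f x \<or> eval g x)"

fun fsize :: "formula \<Rightarrow> nat" where
  "fsize (Lit i b) = 1"
| "fsize (And f g) = fsize f + fsize g"
| "fsize (Or f g) = fsize f + fsize g"

fun over_vars :: "nat \<Rightarrow> formula \<Rightarrow> bool" where
  "over_vars n (Lit i b) = (i < n)"
| "over_vars n (And f g) = (over_vars n f \<and> over_vars n g)"
| "over_vars n (Or f g) = (over_vars n f \<and> over_vars n g)"

text \<open>Satisfiable over {0,1}^n: some assignment of the n variables makes F true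
  (assignments are functions; only values at indices < n matter).\<close>
definition satisfiable :: "nat \<Rightarrow> formula \<Rightarrow> bool" where
  "satisfiable n F \<longleftrightarrow> (\<exists>x::nat \<Rightarrow> bool. (\<forall>i\<ge>n. x i = False) \<and> eval F x)"

fun enc :: "formula \<Rightarrow> nat list" where
  "enc (Lit i b) = [0, i, (if b then 1 else 0)]"
| "enc (And f g) = [1] @ enc f @ enc g"
| "enc (Or f g) = [2] @ enc f @ enc g"

text \<open>A rooted tree with m vertices 0..m-1, root 0, given by a parent map p
  with p v < v for every non-root vertex v (every finite rooted tree has such a labelling).\<close>
definition rooted_tree :: "nat \<Rightarrow> (nat \<Rightarrow> nat) \<Rightarrow> bool" where
  "rooted_tree m p \<longleftrightarrow> m \<ge> 1 \<and> (\<forall>v. 1 \<le> v \<and> v < m \<longrightarrow> p v < v)"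

definition binary_tree :: "nat \<Rightarrow> (nat \<Rightarrow> nat) \<Rightarrow> bool" where
  "binary_tree m p \<longleftrightarrow> rooted_tree m p \<and>
     (\<forall>u<m. card {v. 1 \<le> v \<and> v < m \<and> p v = u} \<le> 2)"

definition contained :: "nat \<Rightarrow> (nat \<Rightarrow> nat) \<Rightarrow> nat \<Rightarrow> (nat \<Rightarrow> nat) \<Rightarrow> bool" where
  "contained m1 p1 m2 p2 \<longleftrightarrow>
     (\<exists>f. inj_on f {..<m1} \<and> f ` {..<m1} \<subseteq> {..<m2} \<and>
          (\<forall>v. 1 \<le> v \<and> v < m1 \<longrightarrow> 1 \<le> f v \<and> p2 (f v) = f (p1 v)))"

datatype instr = Const nat nat | Add nat nat nat | Sub nat nat nat
  | Load nat nat | Store nat nat | Jz nat nat | Halt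

type_synonym state = "nat \<times> (nat \<Rightarrow> nat)"

definition halted :: "instr list \<Rightarrow> state \<Rightarrow> bool" where
  "halted P s \<longleftrightarrow> fst s \<ge> length P \<or> P ! fst s = Halt"

fun exec :: "instr \<Rightarrow> state \<Rightarrow> state" where
  "exec (Const r c) (pc, m) = (Suc pc, m(r := c))"
| "exec (Add r a b) (pc, m) = (Suc pc, m(r := m a + m b))"
| "exec (Sub r a b) (pc, m) = (Suc pc, m(r := m a - m b))"
| "exec (Load r a) (pc, m) = (Suc pc, m(r := m (m a)))"
| "exec (Store a b) (pc, m) = (Suc pc, m(m a := m b))"
| "exec (Jz a l) (pc, m) = ((if m a = 0 then l else Suc pc), m)"
| "exec Halt (pc, m) = (pc, m)"

definition step :: "instr list \<Rightarrow> state \<Rightarrow> state" where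
  "step P s = (if halted P s then s else exec (P ! fst s) s)"

definition runs_within :: "instr list \<Rightarrow> (nat \<Rightarrow> nat) \<Rightarrow> nat \<Rightarrow> (nat \<Rightarrow> nat) \<Rightarrow> bool" where
  "runs_within P m t m' \<longleftrightarrow> halted P ((step P ^^ t) (0, m)) \<and> snd ((step P ^^ t) (0, m)) = m'"

definition input :: "nat \<Rightarrow> formula \<Rightarrow> nat \<Rightarrow> nat" where
  "input n F a = (if a = 0 then n else if a = 1 then length (enc F)
                  else if a - 2 < length (enc F) then enc F ! (a - 2) else 0)"

definition out_m1 :: "(nat \<Rightarrow> nat) \<Rightarrow> nat" where "out_m1 m = m 0"
definition out_m2 :: "(nat \<Rightarrow> nat) \<Rightarrow> nat" where "out_m2 m = m 1"
definition out_p1 :: "(nat \<Rightarrow> nat) \<Rightarrow> nat \<Rightarrow> nat" where "out_p1 m v = m (2 + v)"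
definition out_p2 :: "(nat \<Rightarrow> nat) \<Rightarrow> nat \<Rightarrow> nat" where "out_p2 m v = m (2 + m 0 + v)"

end

theory Submission
  imports Defs
begin

text \<open>
  A node of a formula becomes a gadget in which the two subformulas hang at asymmetric places, so that an embedding
  cannot exchange them. The variables that occur in the formula are split into two halves (variables that do not occur
  are skipped, so that a half is never larger than the formula). The gadget of the pattern depends on an
  assignment of the first half, that of the host on an assignment of the second half; at a literal they are a root with
  one or two children, and the literal is true exactly if the pattern is not wider than the host. At a disjunction
  the host offers two copies of the gadget, in each of which one of the two subformulas is replaced by a universal
  gadget that accepts every pattern; this makes the host quadratic.

  The pattern tree is the complete binary tree whose leaves carry, below a path, the gadgets of all assignments of the
  first half. The host is the same complete tree, but all leaves except one carry universal gadgets, and the remaining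
  one carries a complete binary tree over the gadgets of all assignments of the second half. An embedding must send
  one leaf of the pattern to the exceptional leaf of the host and its path to one assignment of the second half, and
  by symmetry it can choose both freely. Both trees have the same height, so roots are mapped to roots.
\<close>

section \<open>Embeddings of rooted binary trees\<close>

text \<open>The overview leaves out the machine. The construction must be an explicit program over
  unit-cost addition and subtraction. Its input initially fills the low cells, and its output must
  finally stand there. The program is written in two layers. Loop-free programs over registers and
  arrays have a static bound on their time. Around them there are exactly four loops, none nested,
  so the running time reduces to counting iterations. The central loop pops tasks from a stack and
  writes parent numbers in preorder. The number of tasks is linear in the number of vertices
  written, and the pattern has at most twice as many vertices as the host. On the side of trees the
  obstacle is that \<open>contained\<close> speaks of arbitrary parent-preserving injections. These
  are replaced by the recursive relation \<open>emb\<close>, which sends roots to roots, and this is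
  where the equal heights are used. The square survives the factor 2^(n/2) because the many
  universal gadgets are linear; quadratic host gadgets occur only below the exceptional
  leaf.\<close>

datatype tree = Lf | N1 tree | N2 tree tree

fun nodes :: "tree \<Rightarrow> nat" where
  "nodes Lf = 1"
| "nodes (N1 a) = Suc (nodes a)"
| "nodes (N2 a b) = Suc (nodes a + nodes b)"

fun height :: "tree \<Rightarrow> nat" where
  "height Lf = 0"
| "height (N1 a) = Suc (height a)"
| "height (N2 a b) = Suc (max (height a) (height b))"

text \<open>Both assignments of the children are allowed, so the order that the datatype imposes on
  siblings is immaterial.\<close>

fun emb :: "tree \<Rightarrow> tree \<Rightarrow> bool" where
  "emb Lf t = True"
| "emb (N1 a) Lf = False"
| "emb (N1 a) (N1 c) = emb a c"
| "emb (N1 a) (N2 c d) = (emb a c \<or> emb a d)"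
| "emb (N2 a b) (N2 c d) = (emb a c \<and> emb b d \<or> emb a d \<and> emb b c)"
| "emb (N2 a b) Lf = False"
| "emb (N2 a b) (N1 c) = False"

text \<open>The parents of the nodes in preorder, where the root has number \<open>c\<close> and parent \<open>q\<close>.\<close>

fun lay :: "nat \<Rightarrow> nat \<Rightarrow> tree \<Rightarrow> nat list" where
  "lay q c Lf = [q]"
| "lay q c (N1 a) = q # lay c (Suc c) a"
| "lay q c (N2 a b) = q # lay c (Suc c) a @ lay c (Suc c + nodes a) b"

text \<open>A condition on a parent map instead of a list: it splits over the subtrees and says
  nothing about \<open>p\<close> outside the interval of the tree.\<close>

fun laid :: "(nat \<Rightarrow> nat) \<Rightarrow> nat \<Rightarrow> nat \<Rightarrow> tree \<Rightarrow> bool" where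
  "laid p q c Lf = (p c = q)"
| "laid p q c (N1 a) = (p c = q \<and> laid p c (Suc c) a)"
| "laid p q c (N2 a b) = (p c = q \<and> laid p c (Suc c) a \<and> laid p c (Suc c + nodes a) b)"

section \<open>Preorder layouts are binary trees\<close>

lemma nodes_pos [simp]: "0 < nodes t"
  by (cases t) auto

lemma length_lay [simp]: "length (lay q c t) = nodes t"
  by (induction t arbitrary: q c) auto

lemma laid_lay:
  assumes "\<And>i. i < nodes t \<Longrightarrow> p (c + i) = lay q c t ! i"
  shows "laid p q c t"
  using assms
proof (induction t arbitrary: q c)
  case Lf
  then show ?case using Lf[of 0] by simp
next
  case (N1 a)
  have "laid p c (Suc c) a"
    by (rule N1.IH) (use N1.prems[of "Suc _"] in auto)
  then show ?case using N1.prems[of 0] by simp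
next
  case (N2 a b)
  have "laid p c (Suc c) a"
    by (rule N2.IH) (use N2.prems[of "Suc _"] in \<open>auto simp: nth_append\<close>)
  moreover have "laid p c (Suc c + nodes a) b"
    by (rule N2.IH) (use N2.prems[of "Suc (nodes a + _)"] in \<open>auto simp: nth_append add.assoc\<close>)
  ultimately show ?case using N2.prems[of 0] by simp
qed

lemma laid_root: "laid p q c t \<Longrightarrow> p c = q"
  by (cases t) auto

lemma laid_parent:
  assumes "laid p q c t" "c < v" "v < c + nodes t"
  shows "c \<le> p v \<and> p v < v"
  using assms
proof (induction t arbitrary: q c)
  case Lf
  then show ?case by simp
next
  case (N1 a)
  show ?case
  proof (cases "v = Suc c")
    case True then show ?thesis using N1.prems laid_root[of p c "Suc c" a] by auto
  next
    case False then show ?thesis using N1.prems N1.IH[of c "Suc c"] by auto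
  qed
next
  case (N2 a b)
  consider "v = Suc c" | "v = Suc c + nodes a" | "Suc c < v" "v < Suc c + nodes a" | "Suc c + nodes a < v"
    using N2.prems(2) by linarith
  then show ?case
  proof cases
    case 1 then show ?thesis using N2.prems laid_root[of p c "Suc c" a] by auto
  next
    case 2 then show ?thesis using N2.prems laid_root[of p c "Suc c + nodes a" b] by auto
  next
    case 3 then show ?thesis using N2.prems N2.IH(1)[of c "Suc c"] by auto
  next
    case 4 then show ?thesis using N2.prems N2.IH(2)[of c "Suc c + nodes a"] by auto
  qed
qed

text \<open>A vertex other than the root lies in at most one of the intervals of the subtrees, and
  by \<open>laid_parent\<close> only that interval can contain children of it.\<close>

lemma laid_children:
  assumes "laid p q c t"
  shows "\<exists>a b. \<forall>v. c < v \<and> v < c + nodes t \<and> p v = u \<longrightarrow> v = a \<or> v = b"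
  using assms
proof (induction t arbitrary: q c)
  case Lf
  then show ?case by auto
next
  case (N1 a)
  have l: "laid p c (Suc c) a" using N1.prems by simp
  show ?case
  proof (cases "u = c")
    case True
    have "v = Suc c" if "c < v" "v < c + nodes (N1 a)" "p v = u" for v
      using that laid_parent[OF l, of v] True by (cases "v = Suc c") auto
    then show ?thesis by blast
  next
    case False
    obtain x y where xy: "\<forall>v. Suc c < v \<and> v < Suc c + nodes a \<and> p v = u \<longrightarrow> v = x \<or> v = y"
      using N1.IH[OF l] by blast
    have "v = x \<or> v = y" if "c < v" "v < c + nodes (N1 a)" "p v = u" for v
      using that False laid_root[OF l] xy by (cases "v = Suc c") auto
    then show ?thesis by blast
  qed
next
  case (N2 a b)
  let ?d = "Suc c + nodes a"
  have l: "laid p c (Suc c) a" and r: "laid p c ?d b" using N2.prems by auto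
  have cases: "v = Suc c \<or> v = ?d \<or> (Suc c < v \<and> v < ?d) \<or> (?d < v \<and> v < ?d + nodes b)"
    if "c < v" "v < c + nodes (N2 a b)" for v
    using that by auto
  consider "u = c" | "u \<noteq> c" "u < ?d" | "u \<noteq> c" "?d \<le> u" by linarith
  then show ?case
  proof cases
    case 1
    have "v = Suc c \<or> v = ?d" if "c < v" "v < c + nodes (N2 a b)" "p v = u" for v
      using cases[OF that(1,2)] laid_parent[OF l, of v] laid_parent[OF r, of v] that 1 by auto
    then show ?thesis by blast
  next
    case 2
    obtain x y where xy: "\<forall>v. Suc c < v \<and> v < Suc c + nodes a \<and> p v = u \<longrightarrow> v = x \<or> v = y"
      using N2.IH(1)[OF l] by blast
    have "v = x \<or> v = y" if "c < v" "v < c + nodes (N2 a b)" "p v = u" for v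
      using cases[OF that(1,2)] laid_parent[OF r, of v] laid_root[OF l] laid_root[OF r] that 2 xy by auto
    then show ?thesis by blast
  next
    case 3
    obtain x y where xy: "\<forall>v. ?d < v \<and> v < ?d + nodes b \<and> p v = u \<longrightarrow> v = x \<or> v = y"
      using N2.IH(2)[OF r] by blast
    have "v = x \<or> v = y" if "c < v" "v < c + nodes (N2 a b)" "p v = u" for v
      using cases[OF that(1,2)] laid_parent[OF l, of v] laid_root[OF l] laid_root[OF r] that 3 xy by auto
    then show ?thesis by blast
  qed
qed

lemma laid_binary_tree:
  assumes "laid p q 0 t"
  shows "binary_tree (nodes t) p"
  unfolding binary_tree_def rooted_tree_def
proof (intro conjI allI impI)
  show "1 \<le> nodes t" using nodes_pos[of t] by linarith
next
  fix v assume "1 \<le> v \<and> v < nodes t"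
  then show "p v < v" using laid_parent[OF assms, of v] by auto
next
  fix u
  obtain a b where ab: "\<forall>v. 0 < v \<and> v < 0 + nodes t \<and> p v = u \<longrightarrow> v = a \<or> v = b"
    using laid_children[OF assms] by blast
  have "{v. 1 \<le> v \<and> v < nodes t \<and> p v = u} \<subseteq> {a, b}" using ab by (auto simp: Suc_le_eq)
  then have "card {v. 1 \<le> v \<and> v < nodes t \<and> p v = u} \<le> card {a, b}"
    by (intro card_mono) auto
  also have "\<dots> \<le> 2" by (simp add: card_insert_if)
  finally show "card {v. 1 \<le> v \<and> v < nodes t \<and> p v = u} \<le> 2" .
qed

text \<open>Subtrees occupy intervals of node numbers; this is the embedding condition of \<^const>\<open>contained\<close> for two such intervals.\<close>

definition emap :: "(nat \<Rightarrow> nat) \<Rightarrow> nat \<Rightarrow> tree \<Rightarrow> (nat \<Rightarrow> nat) \<Rightarrow> nat \<Rightarrow> tree \<Rightarrow> (nat \<Rightarrow> nat) \<Rightarrow> bool" where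
  "emap p1 c1 t1 p2 c2 t2 f \<longleftrightarrow> inj_on f {c1..<c1 + nodes t1} \<and>
     f ` {c1..<c1 + nodes t1} \<subseteq> {c2..<c2 + nodes t2} \<and>
     (\<forall>v. c1 < v \<and> v < c1 + nodes t1 \<longrightarrow> p2 (f v) = f (p1 v))"

lemma emapD:
  assumes "emap p1 c1 t1 p2 c2 t2 f"
  shows "inj_on f {c1..<c1 + nodes t1}"
    "\<And>v. c1 \<le> v \<Longrightarrow> v < c1 + nodes t1 \<Longrightarrow> c2 \<le> f v \<and> f v < c2 + nodes t2"
    "\<And>v. c1 < v \<Longrightarrow> v < c1 + nodes t1 \<Longrightarrow> p2 (f v) = f (p1 v)"
  using assms unfolding emap_def by (auto simp: image_subset_iff)

lemma emapI:
  assumes "inj_on f {c1..<c1 + nodes t1}"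
    "\<And>v. c1 \<le> v \<Longrightarrow> v < c1 + nodes t1 \<Longrightarrow> c2 \<le> f v \<and> f v < c2 + nodes t2"
    "\<And>v. c1 < v \<Longrightarrow> v < c1 + nodes t1 \<Longrightarrow> p2 (f v) = f (p1 v)"
  shows "emap p1 c1 t1 p2 c2 t2 f"
  using assms unfolding emap_def by (auto simp: image_subset_iff)

section \<open>Recursive embeddings and vertex maps\<close>

lemma emap_N1:
  assumes l1: "laid p1 c1 (Suc c1) a" and e: "emap p1 (Suc c1) a p2 d s f" "f (Suc c1) = d"
    and d: "c2 < d" "d + nodes s \<le> c2 + nodes t" "p2 d = c2"
  shows "emap p1 c1 (N1 a) p2 c2 t (f(c1 := c2))"
proof -
  note D = emapD[OF e(1)]
  have eq: "{c1..<c1 + nodes (N1 a)} = insert c1 {Suc c1..<Suc c1 + nodes a}" by auto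
  have "c2 \<notin> f ` {Suc c1..<Suc c1 + nodes a}" using D(2) d(1) by fastforce
  moreover have "inj_on (f(c1 := c2)) {Suc c1..<Suc c1 + nodes a}"
    using D(1) by (auto simp: inj_on_def)
  ultimately have "inj_on (f(c1 := c2)) {c1..<c1 + nodes (N1 a)}"
    unfolding eq by auto
  moreover have "(f(c1 := c2)) ` {c1..<c1 + nodes (N1 a)} \<subseteq> {c2..<c2 + nodes t}"
    unfolding eq using D(2) d nodes_pos[of t] nodes_pos[of s] by fastforce
  moreover have "p2 ((f(c1 := c2)) v) = (f(c1 := c2)) (p1 v)"
    if "c1 < v" "v < c1 + nodes (N1 a)" for v
  proof (cases "v = Suc c1")
    case True then show ?thesis using laid_root[OF l1] e d by auto
  next
    case False then show ?thesis using that D(3)[of v] laid_parent[OF l1, of v] by auto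
  qed
  ultimately show ?thesis unfolding emap_def by blast
qed

text \<open>The children may go to either side of the host, so \<open>d1\<close> and
  \<open>d2\<close> come in no fixed order; disjoint intervals make the combined map
  injective.\<close>

lemma emap_N2:
  assumes l: "laid p1 q1 c1 (N2 a b)"
    and e1: "emap p1 (Suc c1) a p2 d1 s1 f1" "f1 (Suc c1) = d1"
    and e2: "emap p1 (Suc c1 + nodes a) b p2 d2 s2 f2" "f2 (Suc c1 + nodes a) = d2"
    and d1: "c2 < d1" "d1 + nodes s1 \<le> c2 + nodes t" "p2 d1 = c2"
    and d2: "c2 < d2" "d2 + nodes s2 \<le> c2 + nodes t" "p2 d2 = c2"
    and disj: "d1 + nodes s1 \<le> d2 \<or> d2 + nodes s2 \<le> d1"
  shows "emap p1 c1 (N2 a b) p2 c2 t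
    (\<lambda>v. if v = c1 then c2 else if v < Suc c1 + nodes a then f1 v else f2 v)"
proof -
  let ?m = "Suc c1 + nodes a"
  let ?f = "\<lambda>v. if v = c1 then c2 else if v < ?m then f1 v else f2 v"
  note D1 = emapD[OF e1(1)] and D2 = emapD[OF e2(1)]
  have l1: "laid p1 c1 (Suc c1) a" and l2: "laid p1 c1 ?m b" using l by auto
  have cl: "v = c1 \<or> (Suc c1 \<le> v \<and> v < ?m) \<or> (?m \<le> v \<and> v < ?m + nodes b)"
    if "c1 \<le> v" "v < c1 + nodes (N2 a b)" for v using that by auto
  have "inj_on ?f {c1..<c1 + nodes (N2 a b)}"
  proof (rule inj_onI)
    fix x y assume x: "x \<in> {c1..<c1 + nodes (N2 a b)}" and y: "y \<in> {c1..<c1 + nodes (N2 a b)}"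
      and eq: "?f x = ?f y"
    have xc: "x = c1 \<or> (Suc c1 \<le> x \<and> x < ?m) \<or> (?m \<le> x \<and> x < ?m + nodes b)"
      and yc: "y = c1 \<or> (Suc c1 \<le> y \<and> y < ?m) \<or> (?m \<le> y \<and> y < ?m + nodes b)"
      using cl x y by auto
    have A: "d1 \<le> f1 v \<and> f1 v < d1 + nodes s1" if "Suc c1 \<le> v" "v < ?m" for v
      using D1(2)[of v] that by auto
    have B: "d2 \<le> f2 v \<and> f2 v < d2 + nodes s2" if "?m \<le> v" "v < ?m + nodes b" for v
      using D2(2)[of v] that by auto
    have I1: "v = w" if "Suc c1 \<le> v" "v < ?m" "Suc c1 \<le> w" "w < ?m" "f1 v = f1 w" for v w
      using inj_onD[OF D1(1), of v w] that by auto
    have I2: "v = w" if "?m \<le> v" "v < ?m + nodes b" "?m \<le> w" "w < ?m + nodes b" "f2 v = f2 w" for v w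
      using inj_onD[OF D2(1), of v w] that by auto
    show "x = y"
      using xc
    proof (elim disjE)
      assume "x = c1" then show ?thesis using yc A[of y] B[of y] eq d1 d2 by auto
    next
      assume h: "Suc c1 \<le> x \<and> x < ?m"
      then have fx: "?f x = f1 x" by auto
      show ?thesis using yc
        by (elim disjE) (use h fx eq A[of x] B[of y] d1 disj I1[of x y] in auto)
    next
      assume h: "?m \<le> x \<and> x < ?m + nodes b"
      then have fx: "?f x = f2 x" by auto
      show ?thesis using yc
        by (elim disjE) (use h fx eq A[of y] B[of x] d2 disj I2[of x y] in auto)
    qed
  qed
  moreover have "c2 \<le> ?f v \<and> ?f v < c2 + nodes t" if "c1 \<le> v" "v < c1 + nodes (N2 a b)" for v
    using cl[OF that] D1(2)[of v] D2(2)[of v] d1 d2 by auto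
  moreover have "p2 (?f v) = ?f (p1 v)" if v: "c1 < v" "v < c1 + nodes (N2 a b)" for v
  proof -
    consider "v = Suc c1" | "v = ?m" | "Suc c1 < v" "v < ?m" | "?m < v" "v < ?m + nodes b"
      using v unfolding nodes.simps by linarith
    then show ?thesis
    proof cases
      case 1 then show ?thesis using laid_root[OF l1] e1 d1 by auto
    next
      case 2 then show ?thesis using laid_root[OF l2] e2 d2 by auto
    next
      case 3 then show ?thesis using laid_parent[OF l1, of v] D1(3)[of v] by auto
    next
      case 4 then show ?thesis using laid_parent[OF l2, of v] D2(3)[of v] by auto
    qed
  qed
  ultimately show ?thesis by (rule emapI)
qed

lemma emb_emap:
  assumes "emb t1 t2" "laid p1 q1 c1 t1" "laid p2 q2 c2 t2"
  shows "\<exists>f. f c1 = c2 \<and> emap p1 c1 t1 p2 c2 t2 f"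
  using assms
proof (induction t1 t2 arbitrary: q1 c1 q2 c2 rule: emb.induct)
  case (1 t)
  have "emap p1 c1 Lf p2 c2 t (\<lambda>_. c2)" using nodes_pos[of t] unfolding emap_def by auto
  then show ?case by (intro exI[of _ "\<lambda>_. c2"]) simp
next
  case (3 a c)
  obtain f where f: "f (Suc c1) = Suc c2" "emap p1 (Suc c1) a p2 (Suc c2) c f"
    using 3 by fastforce
  have "emap p1 c1 (N1 a) p2 c2 (N1 c) (f(c1 := c2))"
    by (rule emap_N1[OF _ f(2,1)]) (use 3 laid_root in auto)
  then show ?case by (intro exI[of _ "f(c1 := c2)"] conjI fun_upd_same)
next
  case (4 a c d)
  have l: "laid p1 c1 (Suc c1) a" "laid p2 c2 (Suc c2) c" "laid p2 c2 (Suc c2 + nodes c) d"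
    using 4 by auto
  from 4(3) consider "emb a c" | "emb a d" by auto
  then show ?case
  proof cases
    case 1
    obtain f where f: "f (Suc c1) = Suc c2" "emap p1 (Suc c1) a p2 (Suc c2) c f"
      using 4(1)[OF 1 l(1) l(2)] by blast
    have "emap p1 c1 (N1 a) p2 c2 (N2 c d) (f(c1 := c2))"
      by (rule emap_N1[OF l(1) f(2,1)]) (use l laid_root in auto)
    then show ?thesis by (intro exI[of _ "f(c1 := c2)"] conjI fun_upd_same)
  next
    case 2
    obtain f where f: "f (Suc c1) = Suc c2 + nodes c" "emap p1 (Suc c1) a p2 (Suc c2 + nodes c) d f"
      using 4(2)[OF 2 l(1) l(3)] by blast
    have "emap p1 c1 (N1 a) p2 c2 (N2 c d) (f(c1 := c2))"
      by (rule emap_N1[OF l(1) f(2,1)]) (use l laid_root in auto)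
    then show ?thesis by (intro exI[of _ "f(c1 := c2)"] conjI fun_upd_same)
  qed
next
  case (5 a b c d)
  have l: "laid p1 c1 (Suc c1) a" "laid p1 c1 (Suc c1 + nodes a) b"
     "laid p2 c2 (Suc c2) c" "laid p2 c2 (Suc c2 + nodes c) d"
    using 5 by auto
  note r = laid_root[OF l(3)] laid_root[OF l(4)]
  from 5(5) consider "emb a c" "emb b d" | "emb a d" "emb b c" by auto
  then show ?case
  proof cases
    case 1
    obtain f where f: "f (Suc c1) = Suc c2" "emap p1 (Suc c1) a p2 (Suc c2) c f"
      using 5(1)[OF 1(1) l(1) l(3)] by blast
    obtain g where g: "g (Suc c1 + nodes a) = Suc c2 + nodes c"
        "emap p1 (Suc c1 + nodes a) b p2 (Suc c2 + nodes c) d g"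
      using 5(2)[OF 1(2) l(2) l(4)] by blast
    have "emap p1 c1 (N2 a b) p2 c2 (N2 c d)
       (\<lambda>v. if v = c1 then c2 else if v < Suc c1 + nodes a then f v else g v)"
      by (rule emap_N2[OF 5(6) f(2,1) g(2,1)]) (use r in auto)
    then show ?thesis
      by (intro exI[of _ "\<lambda>v. if v = c1 then c2 else if v < Suc c1 + nodes a then f v else g v"]) simp
  next
    case 2
    obtain f where f: "f (Suc c1) = Suc c2 + nodes c" "emap p1 (Suc c1) a p2 (Suc c2 + nodes c) d f"
      using 5(3)[OF 2(1) l(1) l(4)] by blast
    obtain g where g: "g (Suc c1 + nodes a) = Suc c2"
        "emap p1 (Suc c1 + nodes a) b p2 (Suc c2) c g"
      using 5(4)[OF 2(2) l(2) l(3)] by blast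
    have "emap p1 c1 (N2 a b) p2 c2 (N2 c d)
       (\<lambda>v. if v = c1 then c2 else if v < Suc c1 + nodes a then f v else g v)"
      by (rule emap_N2[OF 5(6) f(2,1) g(2,1)]) (use r in auto)
    then show ?thesis
      by (intro exI[of _ "\<lambda>v. if v = c1 then c2 else if v < Suc c1 + nodes a then f v else g v"]) simp
  qed
qed auto

lemma laid_closed:
  assumes "laid p q c t" "c \<in> B" "\<And>v. c < v \<Longrightarrow> v < c + nodes t \<Longrightarrow> p v \<in> B \<Longrightarrow> v \<in> B"
    "c \<le> v" "v < c + nodes t"
  shows "v \<in> B"
  using assms(4,5)
proof (induction v rule: less_induct)
  case (less v)
  show ?case
  proof (cases "v = c")
    case False
    then have "c < v" using less.prems by simp
    with laid_parent[OF assms(1), of v] less.prems have "c \<le> p v" "p v < v" by auto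
    with less.IH[of "p v"] less.prems have "p v \<in> B" by auto
    with assms(3) \<open>c < v\<close> less.prems show ?thesis by blast
  qed (use assms in simp)
qed

text \<open>No edge leads from a subtree down to a vertex outside it. Once the root has landed in
  the interval of \<open>s\<close>, the parent equations keep all other vertices there.\<close>

lemma emap_descend:
  assumes l1: "laid p1 q1 c1 t1" and ls: "laid p2 c2 d s"
    and inj: "inj_on f {c1..<c1 + nodes t1}"
    and im: "\<And>v. c1 < v \<Longrightarrow> v < c1 + nodes t1 \<Longrightarrow> d \<le> p2 (f v) \<Longrightarrow> p2 (f v) < d + nodes s \<Longrightarrow>
        d \<le> f v \<and> f v < d + nodes s"
    and par: "\<And>v. c1 < v \<Longrightarrow> v < c1 + nodes t1 \<Longrightarrow> p2 (f v) = f (p1 v)"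
    and root: "d \<le> f c1" "f c1 < d + nodes s"
  shows "emap p1 c1 t1 p2 d s f"
proof -
  have "v \<in> {v. d \<le> f v \<and> f v < d + nodes s}" if "c1 \<le> v" "v < c1 + nodes t1" for v
    by (rule laid_closed[OF l1 _ _ that]) (use root im par in auto)
  then show ?thesis using inj par unfolding emap_def by (auto simp: image_subset_iff)
qed

text \<open>Injectivity keeps the other vertices away from \<open>c2\<close>. Children of the root
  therefore go to children of \<open>c2\<close> and, by \<open>emap_descend\<close>, take their
  subtrees along.\<close>

lemma emap_emb:
  assumes "emap p1 c1 t1 p2 c2 t2 f" "f c1 = c2" "laid p1 q1 c1 t1" "laid p2 q2 c2 t2"
  shows "emb t1 t2"
  using assms
proof (induction t1 arbitrary: c1 q1 c2 q2 t2)
  case Lf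
  then show ?case by simp
next
  case (N1 a)
  note D = emapD[OF N1.prems(1)]
  have l1: "laid p1 c1 (Suc c1) a" using N1.prems by simp
  note P = laid_parent[OF N1.prems(4)]
  have i: "inj_on f {Suc c1..<Suc c1 + nodes a}"
    using D(1) by (rule inj_on_subset) auto
  have ne: "f v \<noteq> c2" if "c1 < v" "v < c1 + nodes (N1 a)" for v
    using inj_onD[OF D(1), of v c1] that N1.prems(2) by auto
  have par: "p2 (f v) = f (p1 v)" if "Suc c1 < v" "v < Suc c1 + nodes a" for v
    using D(3)[of v] that by auto
  have r: "p2 (f (Suc c1)) = c2" "c2 < f (Suc c1)" "f (Suc c1) < c2 + nodes t2"
    using D(2,3)[of "Suc c1"] ne[of "Suc c1"] N1.prems(2) laid_root[OF l1] by auto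
  have bl: "c2 < f v \<and> f v < c2 + nodes t2" if "c1 < v" "v < c1 + nodes (N1 a)" for v
    using D(2)[of v] ne[of v] that by auto
  have step: "emb a s" if ls: "laid p2 c2 (f (Suc c1)) s"
     and cl: "\<And>u. c2 < u \<Longrightarrow> u < c2 + nodes t2 \<Longrightarrow> f (Suc c1) \<le> p2 u \<Longrightarrow> p2 u < f (Suc c1) + nodes s \<Longrightarrow>
        f (Suc c1) \<le> u \<and> u < f (Suc c1) + nodes s" for s
  proof (rule N1.IH[OF _ _ l1 ls])
    show "emap p1 (Suc c1) a p2 (f (Suc c1)) s f"
      by (rule emap_descend[OF l1 ls i _ par]) (use cl bl in auto)
  qed simp
  show ?case
  proof (cases t2)
    case Lf
    then show ?thesis using r by simp
  next
    case (N1 b)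
    then have l2: "laid p2 c2 (Suc c2) b" using N1.prems by simp
    have e: "f (Suc c1) = Suc c2"
      using laid_parent[OF l2, of "f (Suc c1)"] r N1 by fastforce
    show ?thesis using step[of b] l2 e N1 by auto
  next
    case (N2 b d)
    let ?m = "Suc c2 + nodes b"
    from N2 have l2: "laid p2 c2 (Suc c2) b" and l3: "laid p2 c2 ?m d" using N1.prems by auto
    note R = laid_root[OF l2] laid_root[OF l3]
    have cl: "u = Suc c2 \<or> u = ?m \<or> (Suc c2 < u \<and> u < ?m \<and> Suc c2 \<le> p2 u \<and> p2 u < u)
        \<or> (?m < u \<and> u < ?m + nodes d \<and> ?m \<le> p2 u \<and> p2 u < u)"
      if "c2 < u" "u < c2 + nodes t2" for u
      using that N2 laid_parent[OF l2, of u] laid_parent[OF l3, of u] by fastforce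
    from cl[of "f (Suc c1)"] r consider "f (Suc c1) = Suc c2" | "f (Suc c1) = ?m" by auto
    then show ?thesis
    proof cases
      case 1
      have "emb a b" using step[of b] l2 1 cl R by fastforce
      then show ?thesis using N2 by simp
    next
      case 2
      have "emb a d" using step[of d] l3 2 cl R by fastforce
      then show ?thesis using N2 by simp
    qed
  qed
next
  case (N2 a1 a2)
  let ?n = "Suc c1 + nodes a1"
  note D = emapD[OF N2.prems(1)]
  have l1: "laid p1 c1 (Suc c1) a1" "laid p1 c1 ?n a2" using N2.prems by auto
  have i: "inj_on f {Suc c1..<Suc c1 + nodes a1}" "inj_on f {?n..<?n + nodes a2}"
    using D(1) by (rule inj_on_subset; auto)+
  have ne: "f v \<noteq> c2" if "c1 < v" "v < c1 + nodes (N2 a1 a2)" for v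
    using inj_onD[OF D(1), of v c1] that N2.prems(2) by auto
  have par: "p2 (f v) = f (p1 v)" if "c1 < v" "v < c1 + nodes (N2 a1 a2)" for v
    using D(3)[of v] that by auto
  have bl: "c2 < f v \<and> f v < c2 + nodes t2" if "c1 < v" "v < c1 + nodes (N2 a1 a2)" for v
    using D(2)[of v] ne[of v] that by auto
  have r: "p2 (f (Suc c1)) = c2" "p2 (f ?n) = c2"
    using par[of "Suc c1"] par[of "?n"] N2.prems(2) laid_root[OF l1(1)] laid_root[OF l1(2)] by auto
  have dif: "f (Suc c1) \<noteq> f ?n"
    using inj_onD[OF D(1), of "Suc c1" ?n] nodes_pos[of a1] by auto
  have step1: "emb a1 s" if ls: "laid p2 c2 (f (Suc c1)) s"
     and cl: "\<And>u. c2 < u \<Longrightarrow> u < c2 + nodes t2 \<Longrightarrow> f (Suc c1) \<le> p2 u \<Longrightarrow> p2 u < f (Suc c1) + nodes s \<Longrightarrow>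
        f (Suc c1) \<le> u \<and> u < f (Suc c1) + nodes s" for s
  proof (rule N2.IH(1)[OF _ _ l1(1) ls])
    show "emap p1 (Suc c1) a1 p2 (f (Suc c1)) s f"
      by (rule emap_descend[OF l1(1) ls i(1)]) (use cl bl par in auto)
  qed simp
  have step2: "emb a2 s" if ls: "laid p2 c2 (f ?n) s"
     and cl: "\<And>u. c2 < u \<Longrightarrow> u < c2 + nodes t2 \<Longrightarrow> f ?n \<le> p2 u \<Longrightarrow> p2 u < f ?n + nodes s \<Longrightarrow>
        f ?n \<le> u \<and> u < f ?n + nodes s" for s
  proof (rule N2.IH(2)[OF _ _ l1(2) ls])
    show "emap p1 ?n a2 p2 (f ?n) s f"
      by (rule emap_descend[OF l1(2) ls i(2)]) (use cl bl par in auto)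
  qed simp
  have b1: "c2 < f (Suc c1)" "f (Suc c1) < c2 + nodes t2" and b2: "c2 < f ?n" "f ?n < c2 + nodes t2"
    using bl[of "Suc c1"] bl[of ?n] by auto
  show ?case
  proof (cases t2)
    case Lf
    then show ?thesis using b1 by simp
  next
    case (N1 b)
    then have l2: "laid p2 c2 (Suc c2) b" using N2.prems by simp
    have "f (Suc c1) = Suc c2" "f ?n = Suc c2"
      using laid_parent[OF l2, of "f (Suc c1)"] laid_parent[OF l2, of "f ?n"] b1 b2 r N1 by fastforce+
    then show ?thesis using dif by simp
  next
    case (N2 b d)
    let ?m = "Suc c2 + nodes b"
    from N2 have l2: "laid p2 c2 (Suc c2) b" and l3: "laid p2 c2 ?m d" using N2.prems by auto
    note R = laid_root[OF l2] laid_root[OF l3]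
    have cl: "u = Suc c2 \<or> u = ?m \<or> (Suc c2 < u \<and> u < ?m \<and> Suc c2 \<le> p2 u \<and> p2 u < u)
        \<or> (?m < u \<and> u < ?m + nodes d \<and> ?m \<le> p2 u \<and> p2 u < u)"
      if "c2 < u" "u < c2 + nodes t2" for u
      using that N2 laid_parent[OF l2, of u] laid_parent[OF l3, of u] by fastforce
    have "f (Suc c1) = Suc c2 \<or> f (Suc c1) = ?m" "f ?n = Suc c2 \<or> f ?n = ?m"
      using cl[OF b1] cl[OF b2] r by auto
    with dif consider "f (Suc c1) = Suc c2" "f ?n = ?m" | "f (Suc c1) = ?m" "f ?n = Suc c2" by argo
    then show ?thesis
    proof cases
      case 1
      have "emb a1 b" using step1[of b] l2 1 cl R by fastforce
      moreover have "emb a2 d" using step2[of d] l3 1 cl R by fastforce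
      ultimately show ?thesis using N2 by simp
    next
      case 2
      have "emb a1 d" using step1[of d] l3 2 cl R by fastforce
      moreover have "emb a2 b" using step2[of b] l2 2 cl R by fastforce
      ultimately show ?thesis using N2 by simp
    qed
  qed
qed

lemma emb_height: "emb s t \<Longrightarrow> height s \<le> height t"
  by (induction s t rule: emb.induct) auto

text \<open>If the root lands below the host root, the whole image lies in a proper subtree, which
  has smaller height. The last hypothesis passes on to that subtree: the parent of
  \<open>f v\<close> lies inside it, the parent of its root does not.\<close>

lemma emap_emb_or_height:
  assumes "emap p1 c1 t1 p2 c2 t2 f" "laid p1 q1 c1 t1" "laid p2 q2 c2 t2"
    "\<And>v. c1 < v \<Longrightarrow> v < c1 + nodes t1 \<Longrightarrow> f v \<noteq> c2"
  shows "emb t1 t2 \<or> height t1 < height t2"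
  using assms
proof (induction t2 arbitrary: c2 q2)
  case Lf
  have "f c1 = c2" using emapD(2)[OF Lf.prems(1), of c1] by auto
  then show ?case using emap_emb Lf.prems by blast
next
  case (N1 b)
  note D = emapD[OF N1.prems(1)]
  have l: "laid p2 c2 (Suc c2) b" using N1.prems by simp
  show ?case
  proof (cases "f c1 = c2")
    case True
    then show ?thesis using emap_emb N1.prems by blast
  next
    case False
    have e: "emap p1 c1 t1 p2 (Suc c2) b f"
    proof (rule emap_descend[OF N1.prems(2) l D(1) _ D(3)])
      show "Suc c2 \<le> f v \<and> f v < Suc c2 + nodes b" if "c1 < v" "v < c1 + nodes t1" for v
        using D(2)[of v] N1.prems(4)[of v] that by auto
    qed (use D(2)[of c1] False in auto)
    have "f v \<noteq> Suc c2" if v: "c1 < v" "v < c1 + nodes t1" for v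
      using D(3)[OF v] laid_parent[OF N1.prems(2) v] emapD(2)[OF e, of "p1 v"] laid_root[OF l] v by auto
    from N1.IH[OF e N1.prems(2) l this] show ?thesis using emb_height by fastforce
  qed
next
  case (N2 b d)
  let ?m = "Suc c2 + nodes b"
  note D = emapD[OF N2.prems(1)]
  have l: "laid p2 c2 (Suc c2) b" and r: "laid p2 c2 ?m d" using N2.prems by auto
  have cl: "u = Suc c2 \<or> u = ?m \<or> (Suc c2 < u \<and> u < ?m \<and> Suc c2 \<le> p2 u \<and> p2 u < u)
      \<or> (?m < u \<and> u < ?m + nodes d \<and> ?m \<le> p2 u \<and> p2 u < u)"
    if "c2 < u" "u < c2 + nodes (N2 b d)" for u
    using that laid_parent[OF l, of u] laid_parent[OF r, of u] by fastforce
  have bl: "c2 < f v \<and> f v < c2 + nodes (N2 b d)" if "c1 < v" "v < c1 + nodes t1" for v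
    using D(2)[of v] N2.prems(4)[of v] that by auto
  consider "f c1 = c2" | "Suc c2 \<le> f c1" "f c1 < ?m" | "?m \<le> f c1" "f c1 < ?m + nodes d"
    using D(2)[of c1] nodes_pos[of t1] by fastforce
  then show ?case
  proof cases
    case 1
    then show ?thesis using emap_emb N2.prems by blast
  next
    case 2
    have e: "emap p1 c1 t1 p2 (Suc c2) b f"
    proof (rule emap_descend[OF N2.prems(2) l D(1) _ D(3) 2])
      show "Suc c2 \<le> f v \<and> f v < Suc c2 + nodes b"
        if v: "c1 < v" "v < c1 + nodes t1" and "Suc c2 \<le> p2 (f v)" "p2 (f v) < Suc c2 + nodes b" for v
        using cl[of "f v"] bl[OF v] that laid_root[OF l] laid_root[OF r] by auto
    qed auto
    have "f v \<noteq> Suc c2" if v: "c1 < v" "v < c1 + nodes t1" for v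
      using D(3)[OF v] laid_parent[OF N2.prems(2) v] emapD(2)[OF e, of "p1 v"] laid_root[OF l] v by auto
    from N2.IH(1)[OF e N2.prems(2) l this] show ?thesis using emb_height by fastforce
  next
    case 3
    have e: "emap p1 c1 t1 p2 ?m d f"
    proof (rule emap_descend[OF N2.prems(2) r D(1) _ D(3) 3])
      show "?m \<le> f v \<and> f v < ?m + nodes d"
        if v: "c1 < v" "v < c1 + nodes t1" and "?m \<le> p2 (f v)" "p2 (f v) < ?m + nodes d" for v
        using cl[of "f v"] bl[OF v] that laid_root[OF l] laid_root[OF r] by auto
    qed auto
    have "f v \<noteq> ?m" if v: "c1 < v" "v < c1 + nodes t1" for v
      using D(3)[OF v] laid_parent[OF N2.prems(2) v] emapD(2)[OF e, of "p1 v"] laid_root[OF r] v by auto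
    from N2.IH(2)[OF e N2.prems(2) r this] show ?thesis using emb_height by fastforce
  qed
qed

lemma contained_iff_emb:
  assumes "laid p1 q1 0 t1" "laid p2 q2 0 t2" "height t1 = height t2"
  shows "contained (nodes t1) p1 (nodes t2) p2 \<longleftrightarrow> emb t1 t2"
proof
  assume e: "emb t1 t2"
  obtain f where f: "f 0 = 0" "emap p1 0 t1 p2 0 t2 f" using emb_emap[OF e assms(1,2)] by blast
  note D = emapD[OF f(2)]
  have "inj_on f {..<nodes t1}" using D(1) by (simp add: lessThan_atLeast0)
  moreover have "f ` {..<nodes t1} \<subseteq> {..<nodes t2}" using D(2) by auto
  moreover have "1 \<le> f v \<and> p2 (f v) = f (p1 v)" if "1 \<le> v \<and> v < nodes t1" for v
  proof
    have "f v \<noteq> 0" using inj_onD[OF D(1), of v 0] that f(1) by auto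
    then show "1 \<le> f v" by simp
    show "p2 (f v) = f (p1 v)" using D(3)[of v] that by simp
  qed
  ultimately show "contained (nodes t1) p1 (nodes t2) p2"
    unfolding contained_def by blast
next
  assume "contained (nodes t1) p1 (nodes t2) p2"
  then obtain f where f: "inj_on f {..<nodes t1}" "f ` {..<nodes t1} \<subseteq> {..<nodes t2}"
    and par: "\<forall>v. 1 \<le> v \<and> v < nodes t1 \<longrightarrow> 1 \<le> f v \<and> p2 (f v) = f (p1 v)"
    unfolding contained_def by blast
  have e: "emap p1 0 t1 p2 0 t2 f"
  proof (rule emapI)
    show "inj_on f {0..<0 + nodes t1}" using f(1) by (simp add: lessThan_atLeast0)
    show "0 \<le> f v \<and> f v < 0 + nodes t2" if "v < 0 + nodes t1" for v
      using f(2) that by auto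
    show "p2 (f v) = f (p1 v)" if "0 < v" "v < 0 + nodes t1" for v
      using par that by simp
  qed
  have "f v \<noteq> 0" if "0 < v" "v < 0 + nodes t1" for v
  proof -
    have "1 \<le> f v" using par that by simp
    then show ?thesis by simp
  qed
  from emap_emb_or_height[OF e assms(1,2) this] assms(3) show "emb t1 t2" by simp
qed

section \<open>The reduction\<close>

text \<open>The left child branches and the right one does not, so the left one cannot go to the
  right. The spare \<open>Lf\<close> cannot trade places with \<open>s\<close> either, unless
  \<open>s\<close> is itself a leaf.\<close>

fun paired :: "tree \<Rightarrow> tree \<Rightarrow> tree" where
  "paired s t = N2 (N2 Lf s) (N1 t)"

fun plain :: "(nat \<Rightarrow> bool \<Rightarrow> bool) \<Rightarrow> formula \<Rightarrow> tree" where
  "plain w (Lit i b) = (if w i b then N2 Lf Lf else N1 Lf)"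
| "plain w (And f g) = N1 (paired (plain w f) (plain w g))"
| "plain w (Or f g) = N1 (paired (plain w f) (plain w g))"

abbreviation universal :: "formula \<Rightarrow> tree" where
  "universal \<equiv> plain (\<lambda>_ _. True)"

text \<open>The only child of the pattern root \<open>N1\<close> may go to either child of
  \<open>N2\<close>; this choice is the disjunction.\<close>

fun host :: "(nat \<Rightarrow> bool \<Rightarrow> bool) \<Rightarrow> formula \<Rightarrow> tree" where
  "host w (Lit i b) = (if w i b then N2 Lf Lf else N1 Lf)"
| "host w (And f g) = N1 (paired (host w f) (host w g))"
| "host w (Or f g) = N2 (paired (host w f) (universal g)) (paired (universal f) (host w g))"

lemma plain_neq_Lf [simp]: "plain w F \<noteq> Lf" "host w F \<noteq> Lf"
  by (cases F; simp)+

lemma emb_Lf [simp]: "emb t Lf \<longleftrightarrow> t = Lf"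
  by (cases t) auto

lemma emb_paired:
  assumes "s \<noteq> Lf" "t \<noteq> Lf"
  shows "emb (paired s t) (paired s' t') \<longleftrightarrow> emb s s' \<and> emb t t'"
  using assms by auto

lemma emb_universal: "emb (plain w F) (universal F)"
  by (induction F) auto

fun vars :: "formula \<Rightarrow> nat set" where
  "vars (Lit i b) = {i}"
| "vars (And f g) = vars f \<union> vars g"
| "vars (Or f g) = vars f \<union> vars g"

text \<open>A literal fails to embed only if it is wide in the pattern and narrow in the host, hence
  the implication in the assumption.\<close>

lemma emb_host:
  assumes "\<And>i b. i \<in> vars F \<Longrightarrow> (w i b \<longrightarrow> w' i b) \<longleftrightarrow> x i = b"
  shows "emb (plain w F) (host w' F) \<longleftrightarrow> eval F x"
  using assms
proof (induction F)
  case (Lit i b)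
  show ?case using Lit[of i b] by (cases b) auto
next
  case (And f g)
  then show ?case using emb_paired by (simp del: paired.simps)
next
  case (Or f g)
  then show ?case using emb_paired emb_universal by (simp del: paired.simps)
qed

lemma height_plain: "height (plain w F) = height (universal F)"
  by (induction F) auto

lemma height_host: "height (host w F) = height (universal F)"
  by (induction F) auto

section \<open>Decision trees and the tables at their leaves\<close>

fun path :: "nat \<Rightarrow> tree \<Rightarrow> tree" where
  "path 0 t = t"
| "path (Suc j) t = N1 (path j t)"

fun full :: "tree \<Rightarrow> nat \<Rightarrow> tree" where
  "full t 0 = t"
| "full t (Suc d) = N2 (full t d) (full t d)"

fun spine :: "tree \<Rightarrow> tree \<Rightarrow> nat \<Rightarrow> tree" where
  "spine u t 0 = t"
| "spine u t (Suc d) = N2 (full u d) (spine u t d)"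

text \<open>A table holds at index \<open>2 * i + b\<close> whether variable \<open>i\<close> has been set to \<open>b\<close>; indices of variables that are not set hold 0.\<close>

definition setbit :: "nat \<Rightarrow> nat \<Rightarrow> (nat \<Rightarrow> nat) \<Rightarrow> nat \<Rightarrow> nat" where
  "setbit i b v = v(2 * i + b := 1, 2 * i + (1 - b) := 0)"

text \<open>The program keeps one table that it overwrites while it traverses the decision tree, so the second subtree starts
  with the table that the first one has left behind.\<close>

fun final :: "(nat \<Rightarrow> nat) \<Rightarrow> nat \<Rightarrow> (nat \<Rightarrow> nat) \<Rightarrow> nat \<Rightarrow> nat" where
  "final l 0 v = v"
| "final l (Suc d) v = final l d (setbit (l d) 1 (final l d (setbit (l d) 0 v)))"

fun decision :: "((nat \<Rightarrow> nat) \<Rightarrow> tree) \<Rightarrow> (nat \<Rightarrow> nat) \<Rightarrow> nat \<Rightarrow> (nat \<Rightarrow> nat) \<Rightarrow> tree" where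
  "decision h l 0 v = h v"
| "decision h l (Suc d) v = N2 (decision h l d (setbit (l d) 0 v))
     (decision h l d (setbit (l d) 1 (final l d (setbit (l d) 0 v))))"

fun leaves :: "(nat \<Rightarrow> nat) \<Rightarrow> nat \<Rightarrow> (nat \<Rightarrow> nat) \<Rightarrow> (nat \<Rightarrow> nat) set" where
  "leaves l 0 v = {v}"
| "leaves l (Suc d) v = leaves l d (setbit (l d) 0 v) \<union>
     leaves l d (setbit (l d) 1 (final l d (setbit (l d) 0 v)))"

definition override :: "nat set \<Rightarrow> (nat \<Rightarrow> bool) \<Rightarrow> (nat \<Rightarrow> nat) \<Rightarrow> nat \<Rightarrow> nat" where
  "override S x v k = (if k div 2 \<in> S then of_bool (x (k div 2) = odd k) else v k)"

lemma setbit_eq: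
  "setbit i 0 v k = (if k div 2 = i then of_bool (even k) else v k)"
  "setbit i (Suc 0) v k = (if k div 2 = i then of_bool (odd k) else v k)"
  unfolding setbit_def by (auto elim!: evenE oddE)

text \<open>If \<open>i\<close> is in \<open>S\<close>, the override wins over the bit just set;
  otherwise the bit becomes part of the assignment.\<close>

lemma override_setbit:
  "override S x (setbit i 0 v) = override (insert i S) (if i \<in> S then x else x(i := False)) v"
  "override S x (setbit i (Suc 0) v) = override (insert i S) (if i \<in> S then x else x(i := True)) v"
  by (auto simp: override_def setbit_eq fun_eq_iff)

text \<open>What the first subtree leaves behind concerns only variables that are set again before a
  leaf of the second subtree is reached.\<close>

lemma override_setbit_override:
  "override S x (setbit i (Suc 0) (override (insert i S) y v)) = override S x (setbit i (Suc 0) v)"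
  by (auto simp: override_def setbit_eq fun_eq_iff)

lemma range_override_insert:
  "range (\<lambda>x. override S x (setbit i 0 v)) \<union> range (\<lambda>x. override S x (setbit i (Suc 0) v))
   = range (\<lambda>x. override (insert i S) x v)" (is "?L = ?R")
proof
  show "?L \<subseteq> ?R" by (auto simp: override_setbit)
  show "?R \<subseteq> ?L"
  proof
    fix u assume "u \<in> ?R"
    then obtain x where u: "u = override (insert i S) x v" by blast
    have "u = override S x (setbit i (if x i then Suc 0 else 0) v)"
      unfolding u by (auto simp: override_def setbit_eq fun_eq_iff)
    then show "u \<in> ?L" by (cases "x i") auto
  qed
qed

text \<open>The claim about \<open>final\<close> is carried along because the second subtree starts
  from that table.\<close>

lemma leaves_eq:
  "leaves l d v = range (\<lambda>x. override (l ` {..<d}) x v) \<and> (\<exists>x. final l d v = override (l ` {..<d}) x v)"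
proof (induction d arbitrary: v)
  case 0
  show ?case by (auto simp: override_def fun_eq_iff)
next
  case (Suc d)
  let ?S = "l ` {..<d}"
  obtain y where y: "final l d (setbit (l d) 0 v) = override ?S y (setbit (l d) 0 v)"
    using Suc.IH by blast
  have ins: "l ` {..<Suc d} = insert (l d) ?S" by (auto simp: lessThan_Suc)
  have eq: "override ?S x (setbit (l d) (Suc 0) (final l d (setbit (l d) 0 v)))
      = override ?S x (setbit (l d) (Suc 0) v)" for x
    unfolding y override_setbit(1) override_setbit_override ..
  obtain z where "final l (Suc d) v = override ?S z (setbit (l d) (Suc 0) (final l d (setbit (l d) 0 v)))"
    using Suc.IH[of "setbit (l d) (Suc 0) (final l d (setbit (l d) 0 v))"] by auto
  then have "final l (Suc d) v = override ?S z (setbit (l d) (Suc 0) v)" unfolding eq .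
  then have "\<exists>x. final l (Suc d) v = override (insert (l d) ?S) x v" unfolding override_setbit by blast
  moreover have "leaves l (Suc d) v = range (\<lambda>x. override ?S x (setbit (l d) 0 v)) \<union>
      range (\<lambda>x. override ?S x (setbit (l d) (Suc 0) (final l d (setbit (l d) 0 v))))"
    using Suc.IH by simp
  ultimately show ?case unfolding ins eq range_override_insert by blast
qed

lemma emb_full:
  assumes "\<And>v. emb (h v) u"
  shows "emb (decision h l d v) (full u d)"
  using assms by (induction d arbitrary: v) auto

text \<open>At each level one child of the pattern must go down the spine, while \<open>full\<close>
  absorbs the other. The choices made on the way address one leaf, so the embedding expresses an
  existential quantifier.\<close>

lemma emb_spine:
  assumes "\<And>v. emb (h v) u"
  shows "emb (decision h l d v) (spine u t d) \<longleftrightarrow> (\<exists>v'\<in>leaves l d v. emb (h v') t)"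
proof (induction d arbitrary: v)
  case (Suc d)
  then show ?case using emb_full[of h u, OF assms] by auto
qed simp

text \<open>Here the path chooses one child at each level, which quantifies over the assignments of
  the second half.\<close>

lemma emb_path_decision: "emb (path d s) (decision h l d v) \<longleftrightarrow> (\<exists>v'\<in>leaves l d v. emb s (h v'))"
  by (induction d arbitrary: v) auto

lemma emb_path_path: "emb (path d s) (path d t) \<longleftrightarrow> emb s t"
  by (induction d) auto

text \<open>Unset variables have entry 0. A literal of the other half is thus always wide in the
  sense of \<open>wideA\<close> and never in the sense of \<open>wideB\<close>, so the implication
  from \<open>wideA\<close> to \<open>wideB\<close> is decided by the half that owns the
  variable.\<close>

definition wideA :: "(nat \<Rightarrow> nat) \<Rightarrow> nat \<Rightarrow> bool \<Rightarrow> bool" where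
  "wideA v i b \<longleftrightarrow> v (2 * i + of_bool b) = 0"

definition wideB :: "(nat \<Rightarrow> nat) \<Rightarrow> nat \<Rightarrow> bool \<Rightarrow> bool" where
  "wideB v i b \<longleftrightarrow> v (2 * i + of_bool b) \<noteq> 0"

lemma emb_split_assignment:
  assumes "vars F \<subseteq> S \<union> T" "S \<inter> T = {}"
  shows "emb (plain (wideA (override S x (\<lambda>_. 0))) F) (host (wideB (override T y (\<lambda>_. 0))) F)
    \<longleftrightarrow> eval F (\<lambda>i. if i \<in> S then x i else y i)"
proof (rule emb_host)
  fix i b assume "i \<in> vars F"
  then have "i \<in> S \<and> i \<notin> T \<or> i \<in> T \<and> i \<notin> S" using assms by auto
  then show "(wideA (override S x (\<lambda>_. 0)) i b \<longrightarrow> wideB (override T y (\<lambda>_. 0)) i b)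
      \<longleftrightarrow> (if i \<in> S then x i else y i) = b"
    unfolding wideA_def wideB_def override_def by (cases b) auto
qed

section \<open>Splitting the variables and correctness of the reduction\<close>

fun scan :: "formula \<Rightarrow> nat list \<Rightarrow> nat list" where
  "scan (Lit i b) xs = (if i \<in> set xs then xs else xs @ [i])"
| "scan (And f g) xs = scan g (scan f xs)"
| "scan (Or f g) xs = scan g (scan f xs)"

lemma set_scan: "set (scan F xs) = vars F \<union> set xs"
  by (induction F arbitrary: xs) auto

lemma distinct_scan: "distinct xs \<Longrightarrow> distinct (scan F xs)"
  by (induction F arbitrary: xs) auto

lemma length_scan: "length (scan F xs) \<le> length xs + fsize F"
proof (induction F arbitrary: xs)
  case (And f g)
  show ?case using And(1)[of xs] And(2)[of "scan f xs"] by simp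
next
  case (Or f g)
  show ?case using Or(1)[of xs] Or(2)[of "scan f xs"] by simp
qed simp

abbreviation varlist :: "formula \<Rightarrow> nat list" where
  "varlist F \<equiv> scan F []"

text \<open>Even positions of \<open>varlist\<close> form the first half and odd positions the
  second, so both halves can be counted during one scan. The first half gets the surplus variable
  and is never empty.\<close>

definition numA :: "formula \<Rightarrow> nat" where
  "numA F = Suc (length (varlist F)) div 2"

definition numB :: "formula \<Rightarrow> nat" where
  "numB F = length (varlist F) div 2"

definition pattern_tree :: "formula \<Rightarrow> tree" where
  "pattern_tree F = decision (\<lambda>v. path (numB F) (plain (wideA v) F)) (\<lambda>d. varlist F ! (2 * d)) (numA F) (\<lambda>_. 0)"

definition host_tree :: "formula \<Rightarrow> tree" where
  "host_tree F = spine (path (numB F) (universal F))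
     (decision (\<lambda>v. host (wideB v) F) (\<lambda>d. varlist F ! (2 * d + 1)) (numB F) (\<lambda>_. 0)) (numA F)"

lemma varlist_split:
  fixes F
  defines "S \<equiv> (\<lambda>d. varlist F ! (2 * d)) ` {..<numA F}"
    and "T \<equiv> (\<lambda>d. varlist F ! (2 * d + 1)) ` {..<numB F}"
  shows "vars F \<subseteq> S \<union> T" "S \<inter> T = {}"
proof -
  have dist: "distinct (varlist F)" by (simp add: distinct_scan)
  show "vars F \<subseteq> S \<union> T"
  proof
    fix i assume "i \<in> vars F"
    then have "i \<in> set (varlist F)" by (simp add: set_scan)
    then obtain k where k: "k < length (varlist F)" "varlist F ! k = i"
      unfolding in_set_conv_nth by blast
    show "i \<in> S \<union> T"
    proof (cases "even k")
      case True
      then have "k div 2 < numA F" "2 * (k div 2) = k" using k by (auto simp: numA_def)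
      then show ?thesis using k unfolding S_def by force
    next
      case False
      then have "k div 2 < numB F" "2 * (k div 2) + 1 = k" using k by (auto simp: numB_def elim!: oddE)
      then show ?thesis using k unfolding T_def by force
    qed
  qed
  show "S \<inter> T = {}"
  proof (rule ccontr)
    assume "S \<inter> T \<noteq> {}"
    then obtain d e where de: "d < numA F" "e < numB F" "varlist F ! (2 * d) = varlist F ! (2 * e + 1)"
      unfolding S_def T_def by auto
    then have "2 * d < length (varlist F)" "2 * e + 1 < length (varlist F)"
      unfolding numA_def numB_def by auto
    then have "2 * d = 2 * e + 1" using de(3) nth_eq_iff_index_eq[OF dist] by blast
    then show False by presburger
  qed
qed

lemma emb_pattern_host: "emb (pattern_tree F) (host_tree F) \<longleftrightarrow> (\<exists>x. eval F x)"
proof -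
  let ?S = "(\<lambda>d. varlist F ! (2 * d)) ` {..<numA F}"
  let ?T = "(\<lambda>d. varlist F ! (2 * d + 1)) ` {..<numB F}"
  have "emb (pattern_tree F) (host_tree F) \<longleftrightarrow>
    (\<exists>x y. emb (plain (wideA (override ?S x (\<lambda>_. 0))) F) (host (wideB (override ?T y (\<lambda>_. 0))) F))"
    unfolding pattern_tree_def host_tree_def
    by (subst emb_spine) (simp_all add: emb_path_path emb_universal emb_path_decision leaves_eq)
  also have "\<dots> \<longleftrightarrow> (\<exists>x y. eval F (\<lambda>i. if i \<in> ?S then x i else y i))"
    unfolding emb_split_assignment[OF varlist_split] ..
  also have "\<dots> \<longleftrightarrow> (\<exists>x. eval F x)"
  proof
    assume "\<exists>x. eval F x"
    then obtain x where "eval F x" ..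
    then have "eval F (\<lambda>i. if i \<in> ?S then x i else x i)" by simp
    then show "\<exists>x y. eval F (\<lambda>i. if i \<in> ?S then x i else y i)" by blast
  qed blast
  finally show ?thesis .
qed

section \<open>Heights and sizes of the two trees\<close>

lemma height_path: "height (path d t) = d + height t"
  by (induction d) auto

lemma height_full: "height (full t d) = d + height t"
  by (induction d) auto

lemma height_decision: "(\<And>v. height (h v) = k) \<Longrightarrow> height (decision h l d v) = d + k"
  by (induction d arbitrary: v) auto

lemma height_spine: "height t = height u \<Longrightarrow> height (spine u t d) = d + height u"
  by (induction d) (auto simp: height_full)

lemma height_pattern_host: "height (pattern_tree F) = height (host_tree F)"
  unfolding pattern_tree_def host_tree_def
  by (simp add: height_spine height_path height_plain[of "wideA _"] height_host
      height_decision[where k = "numB F + height (universal F)"] height_decision[where k = "height (universal F)"])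

lemma nodes_path: "nodes (path d t) = d + nodes t"
  by (induction d) auto

lemma nodes_full: "nodes (full t d) < 2 ^ d * (nodes t + 1)"
  by (induction d) (auto simp: algebra_simps)

lemma nodes_decision_le_full: "(\<And>v. nodes (h v) \<le> nodes u) \<Longrightarrow> nodes (decision h l d v) \<le> nodes (full u d)"
  by (induction d arbitrary: v) (auto intro!: add_mono)

lemma nodes_spine: "nodes (spine u t d) < 2 ^ d * (nodes u + 1) + nodes t"
proof (induction d)
  case (Suc d)
  then show ?case using nodes_full[of u d] by (simp add: algebra_simps)
qed simp

lemma nodes_plain_le_universal: "nodes (plain w F) \<le> nodes (universal F)"
  by (induction F) auto

lemma fsize_pos [simp]: "0 < fsize F"
  by (induction F) auto

text \<open>A connective adds five vertices, so the size plus 5 is additive over subformulas; a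
  literal contributes 3 + 5 = 8.\<close>

lemma nodes_universal: "nodes (universal F) + 5 \<le> 8 * fsize F"
  by (induction F) auto

text \<open>For subformulas of sizes a and b, the cross term 2ab of the square pays for the two
  universal gadgets and the connecting vertices, since ab is at least a, b and 1.\<close>

lemma nodes_host: "nodes (host w F) \<le> 13 * (fsize F)\<^sup>2"
proof -
  have prod: "\<exists>m. (a + b)\<^sup>2 = a\<^sup>2 + b\<^sup>2 + 2 * m \<and> 1 \<le> m \<and> a \<le> m \<and> b \<le> m" if "0 < a" "0 < b" for a b :: nat
    by (rule exI[of _ "a * b"]) (use that in \<open>simp add: power2_eq_square algebra_simps Suc_le_eq\<close>)
  show ?thesis
  proof (induction F)
    case (Lit i b)
    then show ?case by simp
  next
    case (And f g)
    obtain m where "(fsize f + fsize g)\<^sup>2 = (fsize f)\<^sup>2 + (fsize g)\<^sup>2 + 2 * m" "1 \<le> m"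
      using prod[of "fsize f" "fsize g"] by auto
    with And show ?case by simp
  next
    case (Or f g)
    obtain m where "(fsize f + fsize g)\<^sup>2 = (fsize f)\<^sup>2 + (fsize g)\<^sup>2 + 2 * m" "1 \<le> m" "fsize f \<le> m" "fsize g \<le> m"
      using prod[of "fsize f" "fsize g"] by auto
    with Or nodes_universal[of f] nodes_universal[of g] show ?case by simp
  qed
qed

lemma fsize_le_nodes_host: "fsize F \<le> nodes (host w F)"
  by (induction F) auto

lemma length_varlist:
  assumes "over_vars n F"
  shows "length (varlist F) \<le> n" "length (varlist F) \<le> fsize F" "0 < length (varlist F)"
proof -
  have "vars F \<subseteq> {..<n}" using assms by (induction F) auto
  then have "card (set (varlist F)) \<le> card {..<n}" by (intro card_mono) (simp_all add: set_scan)
  then show "length (varlist F) \<le> n" by (simp add: distinct_card distinct_scan)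
  show "length (varlist F) \<le> fsize F" using length_scan[of F "[]"] by simp
  have "set (varlist F) \<noteq> {}" unfolding set_scan by (induction F) auto
  then show "0 < length (varlist F)" by auto
qed

lemma two_power_numA:
  assumes "over_vars n F"
  shows "real (2 ^ numA F) \<le> 2 * 2 powr (real n / 2)"
proof -
  have "real (numA F) \<le> 1 + real n / 2" using length_varlist(1)[OF assms] unfolding numA_def by linarith
  then have "2 powr real (numA F) \<le> 2 powr (1 + real n / 2)" by simp
  also have "\<dots> = 2 * 2 powr (real n / 2)" by (simp add: powr_add)
  finally show ?thesis by (simp add: powr_realpow)
qed

lemma nodes_decision_less:
  assumes "\<And>v. nodes (h v) \<le> k"
  shows "nodes (decision h l d v) < 2 ^ d * (k + 1)"
proof (induction d arbitrary: v)
  case 0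
  show ?case using assms[of v] by simp
next
  case (Suc d)
  have "nodes (decision h l d (setbit (l d) 0 v)) < 2 ^ d * (k + 1)"
    "nodes (decision h l d (setbit (l d) 1 (final l d (setbit (l d) 0 v)))) < 2 ^ d * (k + 1)"
    by (rule Suc.IH)+
  then show ?case by simp
qed

lemma numB_le_fsize: "numB F \<le> fsize F"
  using length_scan[of F "[]"] unfolding numB_def by simp

text \<open>The factor 9 is 8 for the gadget plus 1 for the path, whose length \<open>numB F\<close>
  is at most \<open>fsize F\<close>.\<close>

lemma nodes_pattern_tree: "nodes (pattern_tree F) \<le> 9 * fsize F * 2 ^ numA F"
proof -
  have "nodes (path (numB F) (plain (wideA v) F)) \<le> 9 * fsize F - 1" for v
    using nodes_plain_le_universal[of "wideA v" F] nodes_universal[of F] numB_le_fsize[of F]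
    by (simp add: nodes_path)
  from nodes_decision_less[OF this]
  have "nodes (pattern_tree F) \<le> 2 ^ numA F * (9 * fsize F - 1 + 1)"
    unfolding pattern_tree_def by (rule less_imp_le)
  also have "9 * fsize F - 1 + 1 = 9 * fsize F" using fsize_pos[of F] by simp
  finally show ?thesis by (simp add: mult.commute)
qed

text \<open>The spine carries universal gadgets with paths, of size at most 9s each; the exceptional
  leaf carries \<open>2 ^ numB F\<close> host gadgets, charged 14s^2 each including the inner
  vertices. This gives 23 = 9 + 14.\<close>

lemma nodes_host_tree: "nodes (host_tree F) \<le> 23 * (fsize F)\<^sup>2 * 2 ^ numA F"
proof -
  let ?s = "fsize F"
  have s: "?s \<le> ?s\<^sup>2" by (simp add: power2_eq_square Suc_le_eq)
  have 1: "nodes (path (numB F) (universal F)) + 1 \<le> 9 * ?s"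
    using nodes_universal[of F] numB_le_fsize[of F] by (simp add: nodes_path)
  have "nodes (decision (\<lambda>v. host (wideB v) F) (\<lambda>d. varlist F ! (2 * d + 1)) (numB F) (\<lambda>_. 0))
      < 2 ^ numB F * (13 * ?s\<^sup>2 + 1)"
    by (rule nodes_decision_less) (rule nodes_host)
  also have "\<dots> \<le> 2 ^ numA F * (14 * ?s\<^sup>2)"
  proof (rule mult_le_mono)
    show "(2::nat) ^ numB F \<le> 2 ^ numA F"
      by (rule power_increasing) (auto simp: numA_def numB_def)
    show "13 * ?s\<^sup>2 + 1 \<le> 14 * ?s\<^sup>2" using s fsize_pos[of F] by linarith
  qed
  finally have "nodes (host_tree F) \<le> 2 ^ numA F * (nodes (path (numB F) (universal F)) + 1) + 2 ^ numA F * (14 * ?s\<^sup>2)"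
    using nodes_spine[of "path (numB F) (universal F)" "decision (\<lambda>v. host (wideB v) F) (\<lambda>d. varlist F ! (2 * d + 1)) (numB F) (\<lambda>_. 0)" "numA F"]
    unfolding host_tree_def by linarith
  also have "\<dots> \<le> 2 ^ numA F * (9 * ?s\<^sup>2) + 2 ^ numA F * (14 * ?s\<^sup>2)"
    using 1 s by (intro add_mono mult_le_mono) linarith+
  finally show ?thesis by (simp add: algebra_simps)
qed

lemma nodes_spine_ge: "0 < d \<Longrightarrow> nodes (full u d) \<le> 2 * nodes (spine u t d)"
  by (cases d) auto

text \<open>Allows time spent on the pattern to be charged to the host. The first branch off the
  spine is already a complete tree of depth one less, about half of a tree that dominates the
  pattern.\<close>

lemma nodes_pattern_le_host_tree:
  assumes "over_vars n F"
  shows "nodes (pattern_tree F) \<le> 2 * nodes (host_tree F)"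
proof -
  have "nodes (pattern_tree F) \<le> nodes (full (path (numB F) (universal F)) (numA F))"
    unfolding pattern_tree_def
    by (rule nodes_decision_le_full) (simp add: nodes_path nodes_plain_le_universal)
  also have "\<dots> \<le> 2 * nodes (host_tree F)"
    unfolding host_tree_def
    by (rule nodes_spine_ge) (use length_varlist(3)[OF assms] in \<open>simp add: numA_def\<close>)
  finally show ?thesis .
qed

text \<open>Charges the time for reading the input to the host.\<close>

lemma fsize_le_nodes_host_tree: "fsize F \<le> nodes (host_tree F)"
proof -
  have "fsize F \<le> nodes (decision (\<lambda>v. host (wideB v) F) l d v)" for l d v
    by (induction d arbitrary: v) (auto simp: fsize_le_nodes_host intro: le_SucI trans_le_add1)
  moreover have "nodes t \<le> nodes (spine u t d)" for u t d
    by (induction d) auto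
  ultimately show ?thesis unfolding host_tree_def using le_trans by blast
qed

lemma eval_cong: "over_vars n F \<Longrightarrow> (\<And>i. i < n \<Longrightarrow> x i = y i) \<Longrightarrow> eval F x = eval F y"
  by (induction F) auto

lemma satisfiable_iff:
  assumes "over_vars n F"
  shows "satisfiable n F \<longleftrightarrow> (\<exists>x. eval F x)"
proof
  assume "\<exists>x. eval F x"
  then obtain x where "eval F x" ..
  then have "eval F (\<lambda>i. i < n \<and> x i)" using eval_cong[OF assms, of x "\<lambda>i. i < n \<and> x i"] by simp
  then show "satisfiable n F" unfolding satisfiable_def by (intro exI[of _ "\<lambda>i. i < n \<and> x i"]) simp
qed (auto simp: satisfiable_def)

section \<open>Structured programs for the random access machine\<close>

datatype rcom = Ins instr | Seq rcom rcom (infixr ";;" 60) | IfZ nat rcom rcom | While nat rcom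

fun len :: "rcom \<Rightarrow> nat" where
  "len (Ins i) = 1"
| "len (c ;; d) = len c + len d"
| "len (IfZ r c d) = len c + len d + 3"
| "len (While r c) = len c + 3"

text \<open>The machine has only conditional jumps. Register 0 is reserved: it is set to 0 in front of a jump that has to be taken.\<close>

fun compile :: "nat \<Rightarrow> rcom \<Rightarrow> instr list" where
  "compile k (Ins i) = [i]"
| "compile k (c ;; d) = compile k c @ compile (k + len c) d"
| "compile k (IfZ r c d) = Jz r (k + len d + 3) # compile (Suc k) d @
     [Const 0 0, Jz 0 (k + len d + 3 + len c)] @ compile (k + len d + 3) c"
| "compile k (While r c) = Jz r (k + len c + 3) # compile (Suc k) c @ [Const 0 0, Jz 0 k]"

lemma length_compile [simp]: "length (compile k c) = len c"
  by (induction c arbitrary: k) auto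

fun straight :: "instr \<Rightarrow> bool" where
  "straight (Jz a l) = False"
| "straight Halt = False"
| "straight _ = True"

text \<open>Step counts are exact. Cell 0 is reset in \<open>IfF\<close> and \<open>WhileT\<close>
  by the two instructions that form an unconditional jump.\<close>

inductive big :: "rcom \<Rightarrow> (nat \<Rightarrow> nat) \<Rightarrow> nat \<Rightarrow> (nat \<Rightarrow> nat) \<Rightarrow> bool" where
  Ins: "straight i \<Longrightarrow> big (Ins i) m 1 (snd (exec i (0, m)))"
| Seq: "big c m t m' \<Longrightarrow> big d m' t' m'' \<Longrightarrow> big (c ;; d) m (t + t') m''"
| IfT: "m r = 0 \<Longrightarrow> big c m t m' \<Longrightarrow> big (IfZ r c d) m (Suc t) m'"
| IfF: "m r \<noteq> 0 \<Longrightarrow> big d m t m' \<Longrightarrow> big (IfZ r c d) m (t + 3) (m'(0 := 0))"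
| WhileF: "m r = 0 \<Longrightarrow> big (While r c) m 1 m"
| WhileT: "m r \<noteq> 0 \<Longrightarrow> big c m t m' \<Longrightarrow> big (While r c) (m'(0 := 0)) t' m'' \<Longrightarrow>
    big (While r c) m (t + 3 + t') m''"

fun code_at :: "instr list \<Rightarrow> nat \<Rightarrow> instr list \<Rightarrow> bool" where
  "code_at P k [] = True"
| "code_at P k (i # is) = (k < length P \<and> P ! k = i \<and> code_at P (Suc k) is)"

lemma code_at_append: "code_at P k (xs @ ys) \<longleftrightarrow> code_at P k xs \<and> code_at P (k + length xs) ys"
  by (induction xs arbitrary: k) auto

lemma code_at_self: "code_at P 0 P"
proof -
  have "code_at (xs @ ys) (length xs) ys" for xs ys
  proof (induction ys arbitrary: xs)
    case (Cons y ys)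
    from Cons.IH[of "xs @ [y]"] show ?case by simp
  qed simp
  from this[of "[]"] show ?thesis by simp
qed

lemma step_at: "k < length P \<Longrightarrow> P ! k = i \<Longrightarrow> i \<noteq> Halt \<Longrightarrow> step P (k, m) = exec i (k, m)"
  by (simp add: step_def halted_def)

lemma exec_straight: "straight i \<Longrightarrow> exec i (k, m) = (Suc k, snd (exec i (0, m)))"
  by (cases i) auto

lemma funpow_add_apply: "(f ^^ (m + n)) x = (f ^^ n) ((f ^^ m) x)"
  by (metis add.commute comp_apply funpow_add)

lemma funpow_Suc_apply: "(f ^^ Suc n) x = (f ^^ n) (f x)"
  by (simp add: funpow_swap1)

lemma step_jump_back:
  assumes "code_at P k [Const 0 0, Jz 0 l]"
  shows "(step P ^^ 2) (k, m) = (l, m(0 := 0))"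
  using assms by (simp add: numeral_2_eq_2 step_at)

lemma compile_correct:
  assumes "big c m t m'" "code_at P k (compile k c)"
  shows "(step P ^^ t) (k, m) = (k + len c, m')"
  using assms
proof (induction arbitrary: k rule: big.induct)
  case (Ins i m)
  then have "i \<noteq> Halt" by auto
  with Ins have "step P (k, m) = (Suc k, snd (exec i (0, m)))"
    using exec_straight[of i k m] by (simp add: step_at)
  then show ?case by simp
next
  case (Seq c m t m' d t' m'')
  from Seq.prems have "code_at P k (compile k c)" "code_at P (k + len c) (compile (k + len c) d)"
    by (simp_all add: code_at_append)
  from Seq.IH(1)[OF this(1)] Seq.IH(2)[OF this(2)] show ?case by (simp only: funpow_add_apply len.simps add.assoc)
next
  case (IfT m r c t m' d)
  have s: "step P (k, m) = (k + len d + 3, m)" using IfT.prems IfT.hyps by (simp add: step_at)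
  from IfT.prems have "code_at P (Suc (Suc (Suc (k + len d)))) (compile (k + len d + 3) c)"
    by (simp add: code_at_append)
  moreover have "Suc (Suc (Suc (k + len d))) = k + len d + 3" by simp
  ultimately have "code_at P (k + len d + 3) (compile (k + len d + 3) c)" by metis
  from IfT.IH[OF this] show ?case unfolding funpow_Suc_apply s by simp
next
  case (IfF m r d t m' c)
  have s: "step P (k, m) = (Suc k, m)" using IfF.prems IfF.hyps by (simp add: step_at)
  from IfF.prems have c: "code_at P (Suc k) (compile (Suc k) d)"
    "code_at P (Suc k + len d) [Const 0 0, Jz 0 (k + len d + 3 + len c)]"
    by (simp_all add: code_at_append)
  have "t + 3 = Suc (t + 2)" by simp
  then show ?case
    using IfF.IH[OF c(1)] step_jump_back[OF c(2)]
    by (simp only: funpow_Suc_apply funpow_add_apply s) (simp add: fun_eq_iff)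
next
  case (WhileF m r c)
  then show ?case by (simp add: step_at)
next
  case (WhileT m r c t m' t' m'')
  have s: "step P (k, m) = (Suc k, m)" using WhileT.prems WhileT.hyps by (simp add: step_at)
  from WhileT.prems have c: "code_at P (Suc k) (compile (Suc k) c)"
    "code_at P (Suc k + len c) [Const 0 0, Jz 0 k]"
    by (simp_all add: code_at_append)
  have "t + 3 + t' = Suc (t + 2 + t')" by simp
  then show ?case
    using WhileT.IH(1)[OF c(1)] step_jump_back[OF c(2)] WhileT.IH(2)[OF WhileT.prems]
    by (simp only: funpow_Suc_apply funpow_add_apply s)
qed

text \<open>The program counter ends just behind the code, which counts as halted.\<close>

lemma runs_within_compile:
  assumes "big c m t m'"
  shows "runs_within (compile 0 c) m t m'"
  using compile_correct[OF assms code_at_self] by (simp add: runs_within_def halted_def)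

section \<open>Loop-free programs over registers and arrays\<close>

datatype hcom = HSkip | HConst nat nat | HAddi nat nat nat | HSubi nat nat nat
  | HAdd nat nat nat | HSub nat nat nat | HRd nat nat nat | HWr nat nat nat
  | HSeq hcom hcom (infixr "\<triangleright>" 60) | HIf nat hcom hcom

type_synonym hstate = "(nat \<Rightarrow> nat) \<times> (nat \<Rightarrow> nat \<Rightarrow> nat)"

fun hex :: "hcom \<Rightarrow> hstate \<Rightarrow> hstate" where
  "hex HSkip (\<rho>, \<alpha>) = (\<rho>, \<alpha>)"
| "hex (HConst r c) (\<rho>, \<alpha>) = (\<rho>(r := c), \<alpha>)"
| "hex (HAddi r a c) (\<rho>, \<alpha>) = (\<rho>(r := \<rho> a + c), \<alpha>)"
| "hex (HSubi r a c) (\<rho>, \<alpha>) = (\<rho>(r := \<rho> a - c), \<alpha>)"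
| "hex (HAdd r a b) (\<rho>, \<alpha>) = (\<rho>(r := \<rho> a + \<rho> b), \<alpha>)"
| "hex (HSub r a b) (\<rho>, \<alpha>) = (\<rho>(r := \<rho> a - \<rho> b), \<alpha>)"
| "hex (HRd r j a) (\<rho>, \<alpha>) = (\<rho>(r := \<alpha> j (\<rho> a)), \<alpha>)"
| "hex (HWr j a b) (\<rho>, \<alpha>) = (\<rho>, \<alpha>(j := (\<alpha> j)(\<rho> a := \<rho> b)))"
| "hex (c \<triangleright> d) s = hex d (hex c s)"
| "hex (HIf r c d) (\<rho>, \<alpha>) = (if \<rho> r = 0 then hex c (\<rho>, \<alpha>) else hex d (\<rho>, \<alpha>))"

definition reg :: "nat \<Rightarrow> bool" where "reg r \<longleftrightarrow> 3 \<le> r \<and> r < 24"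

fun well_formed :: "hcom \<Rightarrow> bool" where
  "well_formed HSkip = True"
| "well_formed (HConst r c) = reg r"
| "well_formed (HAddi r a c) = (reg r \<and> reg a)"
| "well_formed (HSubi r a c) = (reg r \<and> reg a)"
| "well_formed (HAdd r a b) = (reg r \<and> reg a \<and> reg b)"
| "well_formed (HSub r a b) = (reg r \<and> reg a \<and> reg b)"
| "well_formed (HRd r j a) = (reg r \<and> reg a \<and> j < 16)"
| "well_formed (HWr j a b) = (reg a \<and> reg b \<and> j < 16)"
| "well_formed (c \<triangleright> d) = (well_formed c \<and> well_formed d)"
| "well_formed (HIf r c d) = (reg r \<and> well_formed c \<and> well_formed d)"

text \<open>Four doublings multiply the index by the stride 16.\<close>

definition addr :: "nat \<Rightarrow> nat \<Rightarrow> rcom" where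
  "addr j a = Ins (Add 0 a a) ;; Ins (Add 0 0 0) ;; Ins (Add 0 0 0) ;; Ins (Add 0 0 0) ;;
     Ins (Add 0 0 2) ;; Ins (Const 1 j) ;; Ins (Add 0 0 1)"

fun lower :: "hcom \<Rightarrow> rcom" where
  "lower HSkip = Ins (Const 0 0)"
| "lower (HConst r c) = Ins (Const r c)"
| "lower (HAddi r a c) = Ins (Const 1 c) ;; Ins (Add r a 1)"
| "lower (HSubi r a c) = Ins (Const 1 c) ;; Ins (Sub r a 1)"
| "lower (HAdd r a b) = Ins (Add r a b)"
| "lower (HSub r a b) = Ins (Sub r a b)"
| "lower (HRd r j a) = addr j a ;; Ins (Load r 0)"
| "lower (HWr j a b) = addr j a ;; Ins (Store 0 b)"
| "lower (c \<triangleright> d) = lower c ;; lower d"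
| "lower (HIf r c d) = IfZ r (lower c) (lower d)"

text \<open>Registers 3 to 23 are cells 3 to 23. The 16 unbounded arrays are interleaved from address \<open>B\<close> on, which is kept in
  cell 2; cells 0 and 1 serve for address computations.\<close>

definition rel :: "nat \<Rightarrow> hstate \<Rightarrow> (nat \<Rightarrow> nat) \<Rightarrow> bool" where
  "rel B s m \<longleftrightarrow> 24 \<le> B \<and> m 2 = B \<and> (\<forall>r. reg r \<longrightarrow> m r = fst s r) \<and>
     (\<forall>j i. j < 16 \<longrightarrow> m (B + 16 * i + j) = snd s j i)"

lemma big_Ins: "straight i \<Longrightarrow> m' = snd (exec i (0, m)) \<Longrightarrow> big (Ins i) m 1 m'"
  using big.Ins by simp

lemma big_SeqI: "big c m t m' \<Longrightarrow> big d m' t' m'' \<Longrightarrow> n = t + t' \<Longrightarrow> big (c ;; d) m n m''"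
  using big.Seq by simp

lemma big_addr:
  assumes "a \<noteq> 0"
  shows "big (addr j a) m 7 (m(0 := 16 * m a + m 2 + j, 1 := j))"
  unfolding addr_def
  by (rule big_SeqI big_Ins straight.simps TrueI refl | simp add: fun_eq_iff)+

text \<open>An array access takes seven steps for the address and one for the access; 3 is the
  overhead of a branch. Adding both branches is a crude bound, but only a constant is
  wanted.\<close>

fun cost :: "hcom \<Rightarrow> nat" where
  "cost (c \<triangleright> d) = cost c + cost d"
| "cost (HIf r c d) = cost c + cost d + 3"
| "cost _ = 8"

lemma array_address_inj:
  fixes i j i' j' :: nat
  assumes "16 * i + j = 16 * i' + j'" "j < 16" "j' < 16"
  shows "i = i' \<and> j = j'"
proof -
  have "(16 * i + j) div 16 = (16 * i' + j') div 16" using assms(1) by simp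
  then have "i = i'" using assms(2,3) by simp
  then show ?thesis using assms(1) by simp
qed

lemma lower_correct:
  assumes "well_formed c" "rel B s m"
  shows "\<exists>t m'. big (lower c) m t m' \<and> t \<le> cost c \<and> rel B (hex c s) m'"
  using assms
proof (induction c arbitrary: s m)
  case HSkip
  have "rel B s (m(0 := 0))" using HSkip unfolding rel_def reg_def by auto
  moreover have "big (lower HSkip) m 1 (m(0 := 0))" unfolding lower.simps by (rule big_Ins) auto
  ultimately show ?case by (cases s) fastforce
next
  case (HConst r c)
  have "rel B (hex (HConst r c) s) (m(r := c))"
    using HConst unfolding rel_def by (cases s) (auto simp: reg_def)
  moreover have "big (lower (HConst r c)) m 1 (m(r := c))" unfolding lower.simps by (rule big_Ins) auto
  ultimately show ?case by fastforce
next
  case (HAddi r a c)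
  have "rel B (hex (HAddi r a c) s) (m(1 := c, r := m a + c))"
    using HAddi unfolding rel_def by (cases s) (auto simp: reg_def)
  moreover have "big (lower (HAddi r a c)) m 2 (m(1 := c, r := m a + c))"
    unfolding lower.simps
    by (rule big_SeqI[OF big_Ins[OF _ refl] big_Ins]) (use HAddi in \<open>auto simp: reg_def fun_eq_iff\<close>)
  ultimately show ?case by fastforce
next
  case (HSubi r a c)
  have "rel B (hex (HSubi r a c) s) (m(1 := c, r := m a - c))"
    using HSubi unfolding rel_def by (cases s) (auto simp: reg_def)
  moreover have "big (lower (HSubi r a c)) m 2 (m(1 := c, r := m a - c))"
    unfolding lower.simps
    by (rule big_SeqI[OF big_Ins[OF _ refl] big_Ins]) (use HSubi in \<open>auto simp: reg_def fun_eq_iff\<close>)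
  ultimately show ?case by fastforce
next
  case (HAdd r a b)
  have "rel B (hex (HAdd r a b) s) (m(r := m a + m b))"
    using HAdd unfolding rel_def by (cases s) (auto simp: reg_def)
  moreover have "big (lower (HAdd r a b)) m 1 (m(r := m a + m b))" unfolding lower.simps by (rule big_Ins) auto
  ultimately show ?case by fastforce
next
  case (HSub r a b)
  have "rel B (hex (HSub r a b) s) (m(r := m a - m b))"
    using HSub unfolding rel_def by (cases s) (auto simp: reg_def)
  moreover have "big (lower (HSub r a b)) m 1 (m(r := m a - m b))" unfolding lower.simps by (rule big_Ins) auto
  ultimately show ?case by fastforce
next
  case (HRd r j a)
  obtain \<rho> \<alpha> where s: "s = (\<rho>, \<alpha>)" by (cases s)
  let ?m = "m(0 := 16 * m a + m 2 + j, 1 := j)"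
  have R: "24 \<le> B" "m 2 = B" "\<And>r. reg r \<Longrightarrow> m r = \<rho> r" "\<And>i j. j < 16 \<Longrightarrow> m (B + 16 * i + j) = \<alpha> j i"
    using HRd.prems s unfolding rel_def by auto
  have w: "reg r" "reg a" "j < 16" "a \<noteq> 0" using HRd.prems by (auto simp: reg_def)
  have "?m (?m 0) = \<alpha> j (\<rho> a)"
    using R(1,2) R(3)[OF w(2)] R(4)[OF w(3), of "\<rho> a"] by (simp add: ac_simps)
  then have "big (lower (HRd r j a)) m 8 (?m(r := \<alpha> j (\<rho> a)))"
    unfolding lower.simps by (intro big_SeqI[OF big_addr big_Ins]) (use w in auto)
  moreover have "rel B (hex (HRd r j a) s) (?m(r := \<alpha> j (\<rho> a)))"
    unfolding s rel_def using R w by (auto simp: reg_def)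
  ultimately show ?case by fastforce
next
  case (HWr j a b)
  obtain \<rho> \<alpha> where s: "s = (\<rho>, \<alpha>)" by (cases s)
  let ?m = "m(0 := 16 * m a + m 2 + j, 1 := j)"
  let ?x = "B + 16 * \<rho> a + j"
  have R: "24 \<le> B" "m 2 = B" "\<And>r. reg r \<Longrightarrow> m r = \<rho> r" "\<And>i j. j < 16 \<Longrightarrow> m (B + 16 * i + j) = \<alpha> j i"
    using HWr.prems s unfolding rel_def by auto
  have w: "reg b" "reg a" "j < 16" "a \<noteq> 0" "b \<noteq> 0" "b \<noteq> 1" using HWr.prems by (auto simp: reg_def)
  have "?m 0 = ?x" "?m b = \<rho> b" using R w by auto
  then have "big (lower (HWr j a b)) m 8 (?m(?x := \<rho> b))"
    unfolding lower.simps by (intro big_SeqI[OF big_addr big_Ins]) (use w in auto)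
  moreover have "rel B (hex (HWr j a b) s) (?m(?x := \<rho> b))"
  proof -
    have "\<And>i j'. j' < 16 \<Longrightarrow> (?m(?x := \<rho> b)) (B + 16 * i + j') = ((\<alpha>(j := (\<alpha> j)(\<rho> a := \<rho> b))) j') i"
    proof -
      fix i j' :: nat
      assume that: "j' < 16"
      show "(?m(?x := \<rho> b)) (B + 16 * i + j') = ((\<alpha>(j := (\<alpha> j)(\<rho> a := \<rho> b))) j') i"
    proof (cases "B + 16 * i + j' = ?x")
      case True
      then have "16 * i + j' = 16 * \<rho> a + j" by simp
      from array_address_inj[OF this that w(3)] True show ?thesis by simp
    next
      case False
      then have "\<not> (i = \<rho> a \<and> j' = j)" by auto
      with False R(1) R(4)[OF that, of i] show ?thesis by auto
    qed
    qed
    moreover have "(?m(?x := \<rho> b)) r = \<rho> r" if "reg r" for r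
      using R(1) R(3)[of r] that by (auto simp: reg_def)
    moreover have "(?m(?x := \<rho> b)) 2 = B" using R by auto
    ultimately show ?thesis unfolding s rel_def using R(1) by (simp only: hex.simps fst_conv snd_conv) blast
  qed
  ultimately show ?case by fastforce
next
  case (HSeq c d)
  from HSeq.IH(1)[of s m] HSeq.prems obtain t m' where
    1: "big (lower c) m t m'" "t \<le> cost c" "rel B (hex c s) m'" by auto
  from HSeq.IH(2)[of "hex c s" m'] HSeq.prems 1 obtain t' m'' where
    2: "big (lower d) m' t' m''" "t' \<le> cost d" "rel B (hex d (hex c s)) m''" by auto
  from big.Seq[OF 1(1) 2(1)] 1 2 show ?case by (auto intro!: exI[of _ "t + t'"])
next
  case (HIf r c d)
  obtain \<rho> \<alpha> where s: "s = (\<rho>, \<alpha>)" by (cases s)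
  have r: "m r = \<rho> r" using HIf.prems s by (auto simp: rel_def)
  show ?case
  proof (cases "\<rho> r = 0")
    case True
    from HIf.IH(1)[of s m] HIf.prems obtain t m' where
      1: "big (lower c) m t m'" "t \<le> cost c" "rel B (hex c s) m'" by auto
    from big.IfT[of m r, OF _ 1(1)] 1 True r s show ?thesis
      by (intro exI[of _ "Suc t"] exI[of _ m']) auto
  next
    case False
    from HIf.IH(2)[of s m] HIf.prems obtain t m' where
      1: "big (lower d) m t m'" "t \<le> cost d" "rel B (hex d s) m'" by auto
    have "rel B (hex d s) (m'(0 := 0))" using 1(3) unfolding rel_def reg_def by auto
    then have "rel B (hex (HIf r c d) s) (m'(0 := 0))" using False s by simp
    moreover have "big (lower (HIf r c d)) m (t + 3) (m'(0 := 0))"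
      using big.IfF[of m r, OF _ 1(1)] False r by simp
    moreover have "t + 3 \<le> cost (HIf r c d)" using 1(2) by simp
    ultimately show ?thesis by blast
  qed
qed

section \<open>Counting the iterations of a loop\<close>

lemma while_lower:
  assumes "well_formed c" "reg r" "rel B s m"
    and "\<And>k. k < n \<Longrightarrow> fst ((hex c ^^ k) s) r \<noteq> 0" "fst ((hex c ^^ n) s) r = 0"
  shows "\<exists>t m'. big (While r (lower c)) m t m' \<and> t \<le> n * (cost c + 3) + 1 \<and> rel B ((hex c ^^ n) s) m'"
  using assms(3-)
proof (induction n arbitrary: s m)
  case 0
  have "m r = 0" using 0 assms(2) by (simp add: rel_def)
  from big.WhileF[of m r, OF this] 0 show ?case by fastforce
next
  case (Suc n)
  have "m r \<noteq> 0" using Suc.prems(1) Suc.prems(2)[of 0] assms(2) by (simp add: rel_def)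
  obtain t m' where 1: "big (lower c) m t m'" "t \<le> cost c" "rel B (hex c s) m'"
    using lower_correct[OF assms(1) Suc.prems(1)] by blast
  have rel: "rel B (hex c s) (m'(0 := 0))" using 1(3) unfolding rel_def reg_def by auto
  have nz: "fst ((hex c ^^ k) (hex c s)) r \<noteq> 0" if "k < n" for k
    using Suc.prems(2)[of "Suc k"] that by (simp only: funpow_Suc_apply) simp
  have z: "fst ((hex c ^^ n) (hex c s)) r = 0"
    using Suc.prems(3) by (simp only: funpow_Suc_apply)
  obtain t' m'' where 2: "big (While r (lower c)) (m'(0 := 0)) t' m''" "t' \<le> n * (cost c + 3) + 1"
      "rel B ((hex c ^^ n) (hex c s)) m''"
    using Suc.IH[OF rel nz z] by blast
  from big.WhileT[of m r, OF \<open>m r \<noteq> 0\<close> 1(1) 2(1)] 1(2) 2 show ?case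
    unfolding funpow_Suc_apply by (intro exI[of _ "t + 3 + t'"] exI[of _ m'']) simp
qed

text \<open>A Hoare triple for exactly \<open>n\<close> iterations, including that none of them is
  stopped by the guard. Such triples compose by adding the counts, so a run of the central loop can
  be assembled task by task, following the recursion of the tree.\<close>

definition loops :: "hcom \<Rightarrow> nat \<Rightarrow> (hstate \<Rightarrow> bool) \<Rightarrow> nat \<Rightarrow> (hstate \<Rightarrow> bool) \<Rightarrow> bool" where
  "loops c r P n Q \<longleftrightarrow> (\<forall>s. P s \<longrightarrow> Q ((hex c ^^ n) s) \<and> (\<forall>k<n. fst ((hex c ^^ k) s) r \<noteq> 0))"

lemma loops_trans:
  assumes "loops c r P m Q" "loops c r Q n R"
  shows "loops c r P (m + n) R"
  unfolding loops_def
proof (intro allI impI conjI)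
  fix s assume s: "P s"
  have 1: "Q ((hex c ^^ m) s)" "\<And>k. k < m \<Longrightarrow> fst ((hex c ^^ k) s) r \<noteq> 0"
    using assms(1) s unfolding loops_def by blast+
  have 2: "R ((hex c ^^ n) ((hex c ^^ m) s))"
    "\<And>k. k < n \<Longrightarrow> fst ((hex c ^^ k) ((hex c ^^ m) s)) r \<noteq> 0"
    using assms(2) 1(1) unfolding loops_def by blast+
  show "R ((hex c ^^ (m + n)) s)" unfolding funpow_add_apply by (rule 2)
  fix k assume k: "k < m + n"
  show "fst ((hex c ^^ k) s) r \<noteq> 0"
  proof (cases "k < m")
    case False
    then have "k = m + (k - m)" by simp
    then show ?thesis using 2(2)[of "k - m"] k funpow_add_apply[of m "k - m" "hex c" s] by simp
  qed (rule 1)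
qed

lemma loopsI:
  assumes "\<And>\<rho> \<alpha>. P (\<rho>, \<alpha>) \<Longrightarrow> Q (hex c (\<rho>, \<alpha>)) \<and> \<rho> r \<noteq> 0"
  shows "loops c r P 1 Q"
  unfolding loops_def using assms by (auto simp: split_paired_all)

lemma while_loops:
  assumes "well_formed c" "reg r" "rel B s m" "P s" "loops c r P n Q" "\<And>s. Q s \<Longrightarrow> fst s r = 0"
  shows "\<exists>t m' s'. big (While r (lower c)) m t m' \<and> t \<le> n * (cost c + 3) + 1 \<and> rel B s' m' \<and> Q s'"
proof -
  have Q: "Q ((hex c ^^ n) s)" and nz: "\<And>k. k < n \<Longrightarrow> fst ((hex c ^^ k) s) r \<noteq> 0"
    using assms(4,5) unfolding loops_def by blast+
  from while_lower[OF assms(1-3) nz assms(6)[OF Q]] Q show ?thesis by blast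
qed

text \<open>For the two copying loops, which are written directly in machine instructions;
  \<open>d\<close> is the number of iterations left. The invariant must survive the reset of cell 0
  by the jump back.\<close>

lemma big_while_invariant:
  assumes "\<And>d m. I (Suc d) m \<Longrightarrow> m r \<noteq> 0 \<and> (\<exists>m'. big c m t m' \<and> I d (m'(0 := 0)))"
    and "\<And>m. I 0 m \<Longrightarrow> m r = 0"
  shows "I d m \<Longrightarrow> \<exists>m'. big (While r c) m (d * (t + 3) + 1) m' \<and> I 0 m'"
proof (induction d arbitrary: m)
  case 0
  then have "m r = 0" using assms(2) by blast
  from big.WhileF[of m r, OF this] 0 show ?case by auto
next
  case (Suc d)
  obtain m' where m': "m r \<noteq> 0" "big c m t m'" "I d (m'(0 := 0))" using assms(1)[OF Suc.prems] by blast
  obtain m'' where m'': "big (While r c) (m'(0 := 0)) (d * (t + 3) + 1) m''" "I 0 m''"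
    using Suc.IH[OF m'(3)] by blast
  from big.WhileT[of m r, OF m'(1,2) m''(1)] m''(2) show ?case by (intro exI[of _ m'']) simp
qed

section \<open>A stack machine that writes the trees\<close>

text \<open>
  Arrays: 0 tokens of the formula; 1 to 3 the task stack; 4 output; 5 and 6 the tables of the first and the second half;
  7 the variables in the order of their first occurrence; 8 marks of the variables seen so far.

  Registers: 3 number of tokens; 4 token position; 5 stack height; 6 output length; 7 number of nodes of the current tree;
  8 size of the finished first tree; 9 and 10 number of variables in the two halves; 11 to 13 the current task;
  the others are temporary.
\<close>

definition mov :: "nat \<Rightarrow> nat \<Rightarrow> hcom" where
  "mov r a = HAddi r a 0"

definition emit :: "nat \<Rightarrow> nat \<Rightarrow> hcom" where
  "emit r a = HWr 4 6 a \<triangleright> HAddi 6 6 1 \<triangleright> mov r 7 \<triangleright> HAddi 7 7 1"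

definition push :: "nat \<Rightarrow> nat \<Rightarrow> nat \<Rightarrow> hcom" where
  "push k j q = HWr 1 5 k \<triangleright> HWr 2 5 j \<triangleright> HWr 3 5 q \<triangleright> HAddi 5 5 1"

fun switch :: "nat \<Rightarrow> hcom list \<Rightarrow> hcom" where
  "switch r [] = HSkip"
| "switch r (c # cs) = HIf r c (HSubi r r 1 \<triangleright> switch r cs)"

definition lit_code :: hcom where
  "lit_code = emit 15 14 \<triangleright> HAddi 20 4 1 \<triangleright> HRd 16 0 20 \<triangleright> HAdd 16 16 16 \<triangleright> HAddi 20 20 1 \<triangleright> HRd 19 0 20 \<triangleright>
     HAdd 16 16 19 \<triangleright> HRd 19 5 16 \<triangleright> HRd 20 6 16 \<triangleright> mov 22 11 \<triangleright>
     switch 22 [HIf 19 (emit 15 14) HSkip, emit 15 14, HIf 20 HSkip (emit 15 14)] \<triangleright> HAddi 4 4 3"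

text \<open>The root of \<open>paired s t\<close>, its left child and the leaf below are written at
  once. The part \<open>N1 t\<close> is a path task of length 1, pushed first so that it runs after
  \<open>s\<close>, when the token position has reached the second subformula.\<close>

definition pair_code :: hcom where
  "pair_code = emit 15 14 \<triangleright> emit 16 15 \<triangleright> emit 19 16 \<triangleright> HConst 20 1 \<triangleright> push 18 20 15 \<triangleright> HConst 20 0 \<triangleright> push 11 20 16"

text \<open>Truncated subtraction does the tests: register 19 is 0 for kinds 0 and 1, register 20
  for a conjunction. Only a disjunction of the host traverses its subformulas twice and has to save
  the token position.\<close>

definition node_code :: hcom where
  "node_code = HAddi 4 4 1 \<triangleright> mov 18 11 \<triangleright> HSubi 19 11 1 \<triangleright> HSubi 20 17 1 \<triangleright>
     HIf 19 HSkip (HIf 20 HSkip (HConst 18 1 \<triangleright> HConst 21 3 \<triangleright> push 21 4 14)) \<triangleright> pair_code"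

definition gadget_code :: hcom where
  "gadget_code = emit 14 13 \<triangleright>
     HIf 12 (HRd 17 0 4 \<triangleright> HIf 17 lit_code node_code) (HSubi 12 12 1 \<triangleright> push 11 12 14)"

definition second_code :: hcom where
  "second_code = mov 4 12 \<triangleright> mov 14 13 \<triangleright> HConst 11 1 \<triangleright> HConst 18 2 \<triangleright> pair_code"

definition choose_code :: "nat \<Rightarrow> nat \<Rightarrow> hcom" where
  "choose_code k k' = emit 14 13 \<triangleright> HSubi 12 12 1 \<triangleright> HConst 11 k \<triangleright> HConst 19 k' \<triangleright> HConst 20 1 \<triangleright> HConst 21 0 \<triangleright>
     push 11 12 14 \<triangleright> push 19 12 20 \<triangleright> push 11 12 14 \<triangleright> push 19 12 21"

definition decisionA_code :: hcom where
  "decisionA_code = HIf 12 (HConst 4 0 \<triangleright> HConst 11 0 \<triangleright> push 11 10 13) (choose_code 4 8)"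

definition decisionB_code :: hcom where
  "decisionB_code = HIf 12 (HConst 4 0 \<triangleright> HConst 11 2 \<triangleright> HConst 20 0 \<triangleright> push 11 20 13) (choose_code 6 9)"

definition full_code :: hcom where
  "full_code = HIf 12 (HConst 4 0 \<triangleright> HConst 11 1 \<triangleright> push 11 10 13)
     (emit 14 13 \<triangleright> HSubi 12 12 1 \<triangleright> push 11 12 14 \<triangleright> push 11 12 14)"

definition spine_code :: hcom where
  "spine_code = HIf 12 (HConst 11 6 \<triangleright> push 11 10 13)
     (emit 14 13 \<triangleright> HSubi 12 12 1 \<triangleright> push 11 12 14 \<triangleright> HConst 11 5 \<triangleright> push 11 12 14)"

definition setbit_code :: "nat \<Rightarrow> hcom" where
  "setbit_code a = HRd 14 7 12 \<triangleright> HAdd 14 14 14 \<triangleright> HAdd 15 14 13 \<triangleright> HConst 20 1 \<triangleright> HWr a 15 20 \<triangleright>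
     HSub 19 20 13 \<triangleright> HAdd 15 14 19 \<triangleright> HConst 21 0 \<triangleright> HWr a 15 21"

text \<open>
  A task \<open>(k, j, q)\<close> writes a tree whose root gets the parent \<open>q\<close>. Kinds 0, 1 and 2 write a path of length \<open>j\<close>
  followed by the pattern, universal or host gadget of the formula at the current token; kind 3 returns to token \<open>j\<close> and
  writes the second half of a disjunction; kinds 4, 5, 6 and 7 write the decision trees of depth \<open>j\<close> of the pattern,
  of universal gadgets and of the host, and the spine. Kinds 8 and 9 set variable \<open>j\<close> of the first or second half to
  \<open>q\<close>, and kind 10 starts the second tree.
\<close>

definition task_code :: "hcom list" where
  "task_code = [gadget_code, gadget_code, gadget_code, second_code, decisionA_code, full_code, decisionB_code,
       spine_code, HAdd 12 12 12 \<triangleright> setbit_code 5, HAdd 12 12 12 \<triangleright> HAddi 12 12 1 \<triangleright> setbit_code 6,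
       mov 8 7 \<triangleright> HConst 7 0]"

definition body :: hcom where
  "body = HSubi 5 5 1 \<triangleright> HRd 11 1 5 \<triangleright> HRd 12 2 5 \<triangleright> HRd 13 3 5 \<triangleright> mov 22 11 \<triangleright> switch 22 task_code"

lemmas code_defs = mov_def emit_def push_def lit_code_def pair_code_def node_code_def gadget_code_def second_code_def
  choose_code_def decisionA_code_def decisionB_code_def full_code_def spine_code_def setbit_code_def task_code_def body_def

lemma wf_body: "well_formed body"
  by (simp add: code_defs reg_def)

section \<open>Abstract states of the stack machine and its single steps\<close>

fun stack :: "(nat \<Rightarrow> nat) \<Rightarrow> (nat \<Rightarrow> nat) \<Rightarrow> (nat \<Rightarrow> nat) \<Rightarrow> nat \<Rightarrow> (nat \<times> nat \<times> nat) list" where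
  "stack a b c 0 = []"
| "stack a b c (Suc n) = (a n, b n, c n) # stack a b c n"

lemma stack_update [simp]:
  "n \<le> i \<Longrightarrow> stack (a(i := x)) b c n = stack a b c n"
  "n \<le> i \<Longrightarrow> stack a (b(i := x)) c n = stack a b c n"
  "n \<le> i \<Longrightarrow> stack a b (c(i := x)) n = stack a b c n"
  by (induction n) auto

lemma stack_eq_Cons: "stack a b c n = (k, j, q) # st \<longleftrightarrow>
    (\<exists>m. n = Suc m \<and> a m = k \<and> b m = j \<and> c m = q \<and> stack a b c m = st)"
  by (cases n) auto

fun prefix :: "(nat \<Rightarrow> nat) \<Rightarrow> nat \<Rightarrow> nat list" where
  "prefix f 0 = []"
| "prefix f (Suc n) = prefix f n @ [f n]"

lemma prefix_update [simp]: "n \<le> i \<Longrightarrow> prefix (f(i := x)) n = prefix f n"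
  by (induction n) auto

type_synonym astate = "(nat \<times> nat \<times> nat) list \<times> nat \<times> (nat \<Rightarrow> nat) \<times> (nat \<Rightarrow> nat) \<times> nat list \<times> nat \<times> nat"

locale machine =
  fixes T L :: "nat \<Rightarrow> nat" and ka kb :: nat
begin

fun repr :: "astate \<Rightarrow> hstate \<Rightarrow> bool" where
  "repr (st, p, va, vb, out, c, m) (\<rho>, \<alpha>) \<longleftrightarrow> stack (\<alpha> 1) (\<alpha> 2) (\<alpha> 3) (\<rho> 5) = st \<and> \<rho> 4 = p \<and>
     \<alpha> 5 = va \<and> \<alpha> 6 = vb \<and> prefix (\<alpha> 4) (\<rho> 6) = out \<and> \<rho> 7 = c \<and> \<rho> 8 = m \<and>
     \<alpha> 0 = T \<and> \<alpha> 7 = L \<and> \<rho> 9 = ka \<and> \<rho> 10 = kb"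

definition reach :: "astate \<Rightarrow> nat \<Rightarrow> astate \<Rightarrow> bool" where
  "reach S n S' \<longleftrightarrow> loops body 5 (repr S) n (repr S')"

lemma hex_switch:
  assumes "\<rho> r < length cs"
  shows "hex (switch r cs) (\<rho>, \<alpha>) = hex (cs ! \<rho> r) (\<rho>(r := 0), \<alpha>)"
  using assms
proof (induction cs arbitrary: \<rho>)
  case (Cons c cs)
  show ?case
  proof (cases "\<rho> r")
    case 0
    then have "\<rho>(r := 0) = \<rho>" by (simp add: fun_eq_iff)
    then show ?thesis using 0 by simp
  next
    case (Suc n)
    then have "n < length cs" using Cons.prems by simp
    with Cons.IH[of "\<rho>(r := n)"] have "hex (switch r cs) (\<rho>(r := n), \<alpha>) = hex (cs ! n) (\<rho>(r := 0), \<alpha>)"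
      by (simp only: fun_upd_same fun_upd_upd)
    then show ?thesis using Suc by (simp add: fun_upd_def)
  qed
qed simp

lemmas small_code = mov_def emit_def push_def

text \<open>Settles popping and dispatch once, so that every task reduces to symbolic execution of
  its own code.\<close>

lemma reach_step:
  assumes "\<And>\<rho> \<alpha>. repr (st, p, va, vb, out, c, m) (\<rho>, \<alpha>) \<Longrightarrow> \<rho> 11 = k \<Longrightarrow> \<rho> 12 = j \<Longrightarrow> \<rho> 13 = q \<Longrightarrow> \<rho> 22 = 0 \<Longrightarrow>
      repr S (hex (task_code ! k) (\<rho>, \<alpha>))"
    and "k < 11"
  shows "reach ((k, j, q) # st, p, va, vb, out, c, m) 1 S"
unfolding reach_def
proof (rule loopsI)
  fix \<rho> \<alpha> assume r: "repr ((k, j, q) # st, p, va, vb, out, c, m) (\<rho>, \<alpha>)"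
  then obtain n where n: "\<rho> 5 = Suc n" "\<alpha> 1 n = k" "\<alpha> 2 n = j" "\<alpha> 3 n = q" "stack (\<alpha> 1) (\<alpha> 2) (\<alpha> 3) n = st"
    by (auto simp: stack_eq_Cons)
  let ?\<rho> = "\<rho>(5 := n, 11 := k, 12 := j, 13 := q, 22 := k)"
  have "hex body (\<rho>, \<alpha>) = hex (switch 22 task_code) (?\<rho>, \<alpha>)"
    unfolding body_def by (simp add: n n(2)[unfolded One_nat_def] mov_def del: switch.simps)
  also have "\<dots> = hex (task_code ! k) (?\<rho>(22 := 0), \<alpha>)"
    using assms(2) by (subst hex_switch) (simp_all add: task_code_def)
  finally show "repr S (hex body (\<rho>, \<alpha>)) \<and> \<rho> 5 \<noteq> 0"
    using assms(1)[of "?\<rho>(22 := 0)" \<alpha>] r n by simp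
qed

lemma reach_path:
  assumes "k \<le> 2"
  shows "reach ((k, Suc j, q) # st, p, va, vb, out, c, m) 1 ((k, j, c) # st, p, va, vb, out @ [q], Suc c, m)"
proof (rule reach_step)
  from assms have "task_code ! k = gadget_code"
    by (auto simp: task_code_def le_Suc_eq numeral_2_eq_2)
  then show "repr ((k, j, c) # st, p, va, vb, out @ [q], Suc c, m) (hex (task_code ! k) (\<rho>, \<alpha>))"
    if "repr (st, p, va, vb, out, c, m) (\<rho>, \<alpha>)" "\<rho> 11 = k" "\<rho> 12 = Suc j" "\<rho> 13 = q" for \<rho> \<alpha>
    using that by (simp add: gadget_code_def small_code)
qed (use assms in simp)

fun wide :: "nat \<Rightarrow> (nat \<Rightarrow> nat) \<Rightarrow> (nat \<Rightarrow> nat) \<Rightarrow> nat \<Rightarrow> bool" where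
  "wide k va vb i \<longleftrightarrow> (if k = 0 then va i = 0 else if k = 1 then True else vb i \<noteq> 0)"

lemma reach_lit:
  assumes "k \<le> 2" "T p = 0"
  shows "reach ((k, 0, q) # st, p, va, vb, out, c, m) 1
    (if wide k va vb (2 * T (p + 1) + T (p + 2)) then (st, p + 3, va, vb, out @ [q, c, c], c + 3, m)
     else (st, p + 3, va, vb, out @ [q, c], c + 2, m))" (is "reach _ _ ?S")
proof (rule reach_step)
  from assms have code: "task_code ! k = gadget_code"
    by (auto simp: task_code_def le_Suc_eq numeral_2_eq_2)
  from assms have kd: "k = 0 \<or> k = Suc 0 \<or> k = 2" by linarith
  show "repr ?S (hex (task_code ! k) (\<rho>, \<alpha>))"
    if "repr (st, p, va, vb, out, c, m) (\<rho>, \<alpha>)" "\<rho> 11 = k" "\<rho> 12 = 0" "\<rho> 13 = q" for \<rho> \<alpha>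
    unfolding code using kd that assms(2)
    by (elim disjE) (simp_all add: gadget_code_def lit_code_def small_code mult_2)
qed (use assms in simp)

lemma reach_node:
  assumes "k \<le> 2" "T p \<noteq> 0" "\<not> (k = 2 \<and> T p = 2)" "T p \<le> 2"
  shows "reach ((k, 0, q) # st, p, va, vb, out, c, m) 1
    ((k, 0, c + 2) # (k, 1, c + 1) # st, p + 1, va, vb, out @ [q, c, c + 1, c + 2], c + 4, m)"
proof (rule reach_step)
  from assms have code: "task_code ! k = gadget_code"
    by (auto simp: task_code_def le_Suc_eq numeral_2_eq_2)
  from assms have kd: "k = 0 \<or> k = Suc 0 \<or> k = 2 \<and> T p = Suc 0" by linarith
  show "repr ((k, 0, c + 2) # (k, 1, c + 1) # st, p + 1, va, vb, out @ [q, c, c + 1, c + 2], c + 4, m)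
      (hex (task_code ! k) (\<rho>, \<alpha>))"
    if "repr (st, p, va, vb, out, c, m) (\<rho>, \<alpha>)" "\<rho> 11 = k" "\<rho> 12 = 0" "\<rho> 13 = q" for \<rho> \<alpha>
    unfolding code using kd that assms(2)
    by (elim disjE) (simp_all add: gadget_code_def node_code_def pair_code_def small_code)
qed (use assms in simp)

lemma reach_or:
  assumes "T p = 2"
  shows "reach ((2, 0, q) # st, p, va, vb, out, c, m) 1
    ((2, 0, c + 2) # (1, 1, c + 1) # (3, p + 1, c) # st, p + 1, va, vb, out @ [q, c, c + 1, c + 2], c + 4, m)"
  by (rule reach_step) (use assms in \<open>simp_all add: task_code_def gadget_code_def node_code_def pair_code_def small_code\<close>)

lemma reach_second:
  "reach ((3, j, q) # st, p, va, vb, out, c, m) 1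
    ((1, 0, c + 1) # (2, 1, c) # st, j, va, vb, out @ [q, c, c + 1], c + 3, m)"
  by (rule reach_step) (simp_all add: task_code_def second_code_def pair_code_def small_code)

lemma reach_decisionA_0:
  "reach ((4, 0, q) # st, p, va, vb, out, c, m) 1 ((0, kb, q) # st, 0, va, vb, out, c, m)"
  by (rule reach_step) (simp_all add: task_code_def decisionA_code_def small_code)

lemma reach_decisionA_Suc:
  "reach ((4, Suc d, q) # st, p, va, vb, out, c, m) 1
    ((8, d, 0) # (4, d, c) # (8, d, 1) # (4, d, c) # st, p, va, vb, out @ [q], c + 1, m)"
  by (rule reach_step) (simp_all add: task_code_def decisionA_code_def choose_code_def small_code)

lemma reach_decisionB_0:
  "reach ((6, 0, q) # st, p, va, vb, out, c, m) 1 ((2, 0, q) # st, 0, va, vb, out, c, m)"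
  by (rule reach_step) (simp_all add: task_code_def decisionB_code_def small_code)

lemma reach_decisionB_Suc:
  "reach ((6, Suc d, q) # st, p, va, vb, out, c, m) 1
    ((9, d, 0) # (6, d, c) # (9, d, 1) # (6, d, c) # st, p, va, vb, out @ [q], c + 1, m)"
  by (rule reach_step) (simp_all add: task_code_def decisionB_code_def choose_code_def small_code)

lemma reach_full_0:
  "reach ((5, 0, q) # st, p, va, vb, out, c, m) 1 ((1, kb, q) # st, 0, va, vb, out, c, m)"
  by (rule reach_step) (simp_all add: task_code_def full_code_def small_code)

lemma reach_full_Suc:
  "reach ((5, Suc d, q) # st, p, va, vb, out, c, m) 1
    ((5, d, c) # (5, d, c) # st, p, va, vb, out @ [q], c + 1, m)"
  by (rule reach_step) (simp_all add: task_code_def full_code_def small_code)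

lemma reach_spine_0:
  "reach ((7, 0, q) # st, p, va, vb, out, c, m) 1 ((6, kb, q) # st, p, va, vb, out, c, m)"
  by (rule reach_step) (simp_all add: task_code_def spine_code_def small_code)

lemma reach_spine_Suc:
  "reach ((7, Suc d, q) # st, p, va, vb, out, c, m) 1
    ((5, d, c) # (7, d, c) # st, p, va, vb, out @ [q], c + 1, m)"
  by (rule reach_step) (simp_all add: task_code_def spine_code_def small_code)

lemma reach_setA:
  "reach ((8, d, b) # st, p, va, vb, out, c, m) 1 (st, p, setbit (L (2 * d)) b va, vb, out, c, m)"
  by (rule reach_step) (auto simp: task_code_def setbit_code_def small_code mult_2 setbit_def)

lemma reach_setB:
  "reach ((9, d, b) # st, p, va, vb, out, c, m) 1 (st, p, va, setbit (L (2 * d + 1)) b vb, out, c, m)"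
  by (rule reach_step) (auto simp: task_code_def setbit_code_def small_code mult_2 setbit_def)

lemma reach_switch:
  "reach ((10, d, b) # st, p, va, vb, out, c, m) 1 (st, p, va, vb, out, 0, c)"
  by (rule reach_step) (simp_all add: task_code_def small_code)

section \<open>Tasks that write whole trees\<close>

definition enc_at :: "nat \<Rightarrow> formula \<Rightarrow> bool" where
  "enc_at p F \<longleftrightarrow> (\<forall>i<length (enc F). T (p + i) = enc F ! i)"

lemma enc_at_Lit: "enc_at p (Lit i b) \<Longrightarrow> T p = 0 \<and> T (p + 1) = i \<and> T (p + 2) = of_bool b"
  unfolding enc_at_def
  by (auto dest: spec[of _ 0] spec[of _ 1] spec[of _ 2])

lemma enc_at_split:
  assumes "\<And>i. i < length (t # xs @ ys) \<Longrightarrow> T (p + i) = (t # xs @ ys) ! i"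
  shows "T p = t \<and> (\<forall>i<length xs. T (p + 1 + i) = xs ! i) \<and> (\<forall>i<length ys. T (p + 1 + length xs + i) = ys ! i)"
proof (intro conjI allI impI)
  show "T p = t" using assms[of 0] by simp
  show "T (p + 1 + i) = xs ! i" if "i < length xs" for i
    using assms[of "Suc i"] that by (simp add: nth_append)
  show "T (p + 1 + length xs + i) = ys ! i" if "i < length ys" for i
    using assms[of "Suc (length xs + i)"] that by (simp add: nth_append add.assoc)
qed

lemma enc_at_And:
  "enc_at p (And f g) \<Longrightarrow> T p = 1 \<and> enc_at (p + 1) f \<and> enc_at (p + 1 + length (enc f)) g"
  using enc_at_split[of 1 "enc f" "enc g" p] unfolding enc_at_def by simp

lemma enc_at_Or:
  "enc_at p (Or f g) \<Longrightarrow> T p = 2 \<and> enc_at (p + 1) f \<and> enc_at (p + 1 + length (enc f)) g"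
  using enc_at_split[of 2 "enc f" "enc g" p] unfolding enc_at_def by simp

definition leads :: "astate \<Rightarrow> nat \<Rightarrow> astate \<Rightarrow> bool" where
  "leads S b S' \<longleftrightarrow> (\<exists>n\<le>b. reach S n S')"

lemma leads_trans: "leads S a S' \<Longrightarrow> leads S' b S'' \<Longrightarrow> leads S (a + b) S''"
  unfolding leads_def reach_def using loops_trans add_mono by metis

lemma leads_mono: "leads S a S' \<Longrightarrow> a \<le> b \<Longrightarrow> leads S b S'"
  unfolding leads_def using le_trans by blast

lemma leads_step: "reach S 1 S' \<Longrightarrow> leads S 1 S'"
  unfolding leads_def by blast

text \<open>The quantified data belong to the enclosing task: parent, rest of the stack, output so
  far and next vertex number. The primed data are what the task leaves for its successor.\<close>

definition builds :: "nat \<Rightarrow> nat \<Rightarrow> nat \<Rightarrow> nat \<Rightarrow> (nat \<Rightarrow> nat) \<Rightarrow> (nat \<Rightarrow> nat) \<Rightarrow> nat \<Rightarrow>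
    nat \<Rightarrow> (nat \<Rightarrow> nat) \<Rightarrow> (nat \<Rightarrow> nat) \<Rightarrow> tree \<Rightarrow> bool" where
  "builds k j b p va vb m p' va' vb' t \<longleftrightarrow> (\<forall>q st out c. leads ((k, j, q) # st, p, va, vb, out, c, m) b
     (st, p', va', vb', out @ lay q c t, c + nodes t, m))"

text \<open>Starts after the first three vertices have been written; the additional iteration writes
  the path vertex above \<open>t\<close>.\<close>

lemma pair_run:
  assumes f: "builds k 0 a p va vb m p' va vb s" and g: "builds k' 0 b p' va vb m p'' va vb t" and "k' \<le> 2"
  shows "leads ((k, 0, c + 1) # (k', 1, c) # st, p, va, vb, out @ [q, c, c + 1], c + 3, m) (a + b + 1)
    (st, p'', va, vb, out @ lay q c (paired s t), c + nodes (paired s t), m)"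
proof -
  let ?out = "out @ [q, c, c + 1] @ lay (c + 1) (c + 3) s"
  let ?c = "c + 3 + nodes s"
  have 1: "leads ((k, 0, c + 1) # (k', 1, c) # st, p, va, vb, out @ [q, c, c + 1], c + 3, m) a
     ((k', 1, c) # st, p', va, vb, ?out, ?c, m)"
    using f unfolding builds_def by (metis append_assoc)
  have 2: "leads ((k', 1, c) # st, p', va, vb, ?out, ?c, m) 1
     ((k', 0, ?c) # st, p', va, vb, ?out @ [c], Suc ?c, m)"
    using leads_step[OF reach_path[OF assms(3), of 0 c st p' va vb ?out ?c m]] by (simp only: One_nat_def)
  have 3: "leads ((k', 0, ?c) # st, p', va, vb, ?out @ [c], Suc ?c, m) b
     (st, p'', va, vb, (?out @ [c]) @ lay ?c (Suc ?c) t, Suc ?c + nodes t, m)"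
    using g unfolding builds_def by blast
  from leads_trans[OF leads_trans[OF 1 2] 3] show ?thesis
    by (simp add: numeral_3_eq_3 ac_simps)
qed

lemma builds_node:
  assumes f: "builds k 0 a (p + 1) va vb m p' va vb s" and g: "builds k 0 b p' va vb m p'' va vb t"
    and k: "k \<le> 2" "T p \<noteq> 0" "\<not> (k = 2 \<and> T p = 2)" "T p \<le> 2"
  shows "builds k 0 (a + b + 2) p va vb m p'' va vb (N1 (paired s t))"
  unfolding builds_def
proof (intro allI)
  fix q st out c
  have "leads ((k, 0, q) # st, p, va, vb, out, c, m) 1
    ((k, 0, Suc c + 1) # (k, 1, Suc c) # st, p + 1, va, vb, (out @ [q]) @ [c, Suc c, Suc c + 1], Suc c + 3, m)"
    using leads_step[OF reach_node[OF k, of q st va vb out c m]] by (simp add: eval_nat_numeral)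
  from leads_trans[OF this pair_run[OF f g k(1)]]
  show "leads ((k, 0, q) # st, p, va, vb, out, c, m) (a + b + 2)
     (st, p'', va, vb, out @ lay q c (N1 (paired s t)), c + nodes (N1 (paired s t)), m)"
    by (simp add: ac_simps del: paired.simps)
qed

lemma builds_or:
  assumes f: "builds 2 0 a (p + 1) va vb m p' va vb s" and g: "builds 1 0 b p' va vb m p'' va vb t'"
    and f': "builds 1 0 a' (p + 1) va vb m p' va vb s'" and g': "builds 2 0 b' p' va vb m p'' va vb t"
    and T: "T p = 2"
  shows "builds 2 0 (a + b + a' + b' + 4) p va vb m p'' va vb (N2 (paired s t') (paired s' t))"
  unfolding builds_def
proof (intro allI)
  fix q st out c
  let ?out = "(out @ [q]) @ lay c (Suc c) (paired s t')"
  let ?c = "Suc c + nodes (paired s t')"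
  have 1: "leads ((2, 0, q) # st, p, va, vb, out, c, m) 1
    ((2, 0, Suc c + 1) # (1, 1, Suc c) # (3, p + 1, c) # st, p + 1, va, vb, (out @ [q]) @ [c, Suc c, Suc c + 1], Suc c + 3, m)"
    using leads_step[OF reach_or[OF T, of q st va vb out c m]] by (simp add: eval_nat_numeral)
  have 2: "leads ((3, p + 1, c) # st, p'', va, vb, ?out, ?c, m) 1
    ((1, 0, ?c + 1) # (2, 1, ?c) # st, p + 1, va, vb, ?out @ [c, ?c, ?c + 1], ?c + 3, m)"
    by (rule leads_step[OF reach_second])
  have 3: "leads ((2, 0, q) # st, p, va, vb, out, c, m) (1 + (a + b + 1) + (1 + (a' + b' + 1)))
     (st, p'', va, vb, ?out @ lay c ?c (paired s' t), ?c + nodes (paired s' t), m)"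
    by (rule leads_trans[OF leads_trans[OF 1 pair_run[OF f g]] leads_trans[OF 2 pair_run[OF f' g']]]) auto
  then show "leads ((2, 0, q) # st, p, va, vb, out, c, m) (a + b + a' + b' + 4)
     (st, p'', va, vb, out @ lay q c (N2 (paired s t') (paired s' t)), c + nodes (N2 (paired s t') (paired s' t)), m)"
    by (simp add: ac_simps eval_nat_numeral del: paired.simps)
qed

lemma builds_mono: "builds k j a p va vb m p' va' vb' t \<Longrightarrow> a \<le> b \<Longrightarrow> builds k j b p va vb m p' va' vb' t"
  unfolding builds_def using leads_mono by blast

lemma lit_run:
  assumes "k \<le> 2" "enc_at p (Lit i b)" "w i b \<longleftrightarrow> wide k va vb (2 * i + of_bool b)"
  shows "builds k 0 (nodes (plain w (Lit i b))) p va vb m (p + length (enc (Lit i b))) va vb (plain w (Lit i b))"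
proof -
  note e = enc_at_Lit[OF assms(2)]
  have "leads ((k, 0, q) # st, p, va, vb, out, c, m) 1
     (if w i b then (st, p + 3, va, vb, out @ [q, c, c], c + 3, m)
     else (st, p + 3, va, vb, out @ [q, c], c + 2, m))" for q st out c
    using leads_step[OF reach_lit[of k p q st va vb out c m]] e assms(1,3) by (simp del: wide.simps)
  then have "builds k 0 1 p va vb m (p + length (enc (Lit i b))) va vb (plain w (Lit i b))" unfolding builds_def
    by (cases "w i b") (auto simp: eval_nat_numeral)
  then show ?thesis by (rule builds_mono) (rule Suc_leI[OF nodes_pos, folded One_nat_def])
qed

text \<open>Every gadget task writes at least one vertex, so the number of vertices bounds the
  iterations.\<close>

lemma plain_run:
  assumes "k \<le> 1" "enc_at p F" "\<And>i b. w i b \<longleftrightarrow> wide k va vb (2 * i + of_bool b)"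
  shows "builds k 0 (nodes (plain w F)) p va vb m (p + length (enc F)) va vb (plain w F)"
  using assms(2)
proof (induction F arbitrary: p)
  case (Lit i b)
  show ?case by (rule lit_run) (use Lit assms in auto)
next
  case (And f g)
  note e = enc_at_And[OF And.prems]
  have "builds k 0 (nodes (plain w f) + nodes (plain w g) + 2) p va vb m (p + 1 + length (enc f) + length (enc g)) va vb
      (N1 (paired (plain w f) (plain w g)))"
    by (rule builds_node[OF And.IH(1) And.IH(2)]) (use e assms(1) in auto)
  from builds_mono[OF this, of "nodes (plain w (And f g))"] show ?case by (simp add: ac_simps)
next
  case (Or f g)
  note e = enc_at_Or[OF Or.prems]
  have "builds k 0 (nodes (plain w f) + nodes (plain w g) + 2) p va vb m (p + 1 + length (enc f) + length (enc g)) va vb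
      (N1 (paired (plain w f) (plain w g)))"
    by (rule builds_node[OF Or.IH(1) Or.IH(2)]) (use e assms(1) in auto)
  from builds_mono[OF this, of "nodes (plain w (Or f g))"] show ?case by (simp add: ac_simps)
qed

lemma universal_run:
  assumes "enc_at p F"
  shows "builds 1 0 (nodes (universal F)) p va vb m (p + length (enc F)) va vb (universal F)"
  by (rule plain_run) (use assms in auto)

lemma host_run:
  assumes "enc_at p F"
  shows "builds 2 0 (nodes (host (wideB vb) F)) p va vb m (p + length (enc F)) va vb (host (wideB vb) F)"
  using assms
proof (induction F arbitrary: p)
  case (Lit i b)
  show ?case using lit_run[OF _ Lit, of 2 "wideB vb" va vb m] by (auto simp: wideB_def)
next
  case (And f g)
  note e = enc_at_And[OF And.prems]
  have "builds 2 0 (nodes (host (wideB vb) f) + nodes (host (wideB vb) g) + 2) p va vb m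
      (p + 1 + length (enc f) + length (enc g)) va vb (N1 (paired (host (wideB vb) f) (host (wideB vb) g)))"
    by (rule builds_node[OF And.IH(1) And.IH(2)]) (use e in auto)
  from builds_mono[OF this, of "nodes (host (wideB vb) (And f g))"] show ?case by (simp add: ac_simps)
next
  case (Or f g)
  note e = enc_at_Or[OF Or.prems]
  have "builds 2 0 (nodes (host (wideB vb) f) + nodes (universal g) + nodes (universal f) + nodes (host (wideB vb) g) + 4)
      p va vb m (p + 1 + length (enc f) + length (enc g)) va vb
      (N2 (paired (host (wideB vb) f) (universal g)) (paired (universal f) (host (wideB vb) g)))"
    by (rule builds_or[OF Or.IH(1) universal_run universal_run Or.IH(2)]) (use e in auto)
  from builds_mono[OF this, of "nodes (host (wideB vb) (Or f g))"] show ?case by (simp add: ac_simps)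
qed

lemma path_run:
  assumes "builds k 0 a p va vb m p' va vb t" "k \<le> 2"
  shows "builds k j (j + a) p va vb m p' va vb (path j t)"
proof (induction j)
  case 0
  show ?case using assms by simp
next
  case (Suc j)
  show ?case unfolding builds_def
  proof (intro allI)
    fix q st out c
    have "leads ((k, Suc j, q) # st, p, va, vb, out, c, m) 1 ((k, j, c) # st, p, va, vb, out @ [q], Suc c, m)"
      by (rule leads_step[OF reach_path[OF assms(2)]])
    moreover have "leads ((k, j, c) # st, p, va, vb, out @ [q], Suc c, m) (j + a)
        (st, p', va, vb, (out @ [q]) @ lay c (Suc c) (path j t), Suc c + nodes (path j t), m)"
      using Suc unfolding builds_def by blast
    ultimately show "leads ((k, Suc j, q) # st, p, va, vb, out, c, m) (Suc j + a)
        (st, p', va, vb, out @ lay q c (path (Suc j) t), c + nodes (path (Suc j) t), m)"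
      using leads_trans by fastforce
  qed
qed

lemma chain_N2:
  assumes "builds k j a p va vb m p' va' vb' s" "builds k' j' b p' va' vb' m p'' va'' vb'' t"
  shows "leads ((k, j, c) # (k', j', c) # st, p, va, vb, out @ [q], c + 1, m) (a + b)
    (st, p'', va'', vb'', out @ lay q c (N2 s t), c + nodes (N2 s t), m)"
proof -
  have 1: "leads ((k, j, c) # (k', j', c) # st, p, va, vb, out @ [q], c + 1, m) a
     ((k', j', c) # st, p', va', vb', (out @ [q]) @ lay c (c + 1) s, c + 1 + nodes s, m)"
    using assms(1) unfolding builds_def by blast
  have 2: "leads ((k', j', c) # st, p', va', vb', (out @ [q]) @ lay c (c + 1) s, c + 1 + nodes s, m) b
     (st, p'', va'', vb'', ((out @ [q]) @ lay c (c + 1) s) @ lay c (c + 1 + nodes s) t, c + 1 + nodes s + nodes t, m)"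
    using assms(2) unfolding builds_def by blast
  from leads_trans[OF 1 2] show ?thesis by (simp add: ac_simps)
qed

lemma full_run:
  assumes "builds 1 kb a 0 va vb m e va vb t" "a \<le> nodes t"
  shows "builds 5 d (3 * nodes (full t d)) p va vb m e va vb (full t d)"
proof (induction d arbitrary: p)
  case 0
  have "leads ((5, 0, q) # st, p, va, vb, out, c, m) (1 + a)
     (st, e, va, vb, out @ lay q c t, c + nodes t, m)" for q st out c
    using leads_trans[OF leads_step[OF reach_full_0]] assms(1) unfolding builds_def by blast
  then have "builds 5 0 (1 + a) p va vb m e va vb t" unfolding builds_def by blast
  then have "builds 5 0 (3 * nodes t) p va vb m e va vb t"
    by (rule builds_mono) (use assms(2) nodes_pos[of t] in linarith)
  then show ?case by simp
next
  case (Suc d)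
  have "builds 5 (Suc d) (1 + (3 * nodes (full t d) + 3 * nodes (full t d))) p va vb m e va vb (N2 (full t d) (full t d))"
    unfolding builds_def using leads_trans[OF leads_step[OF reach_full_Suc] chain_N2[OF Suc.IH Suc.IH]] by blast
  from builds_mono[OF this, of "3 * nodes (full t (Suc d))"] show ?case by simp
qed

text \<open>The factor 3 covers one task for an inner vertex and two for setting its variable; at a
  leaf it covers the task that starts the gadget.\<close>

lemma decisionA_run:
  assumes "\<And>v. builds 0 kb (nodes (h v)) 0 v vb m e v vb (h v)"
  shows "builds 4 d (3 * nodes (decision h (\<lambda>d. L (2 * d)) d va)) p va vb m e (final (\<lambda>d. L (2 * d)) d va) vb (decision h (\<lambda>d. L (2 * d)) d va)"
proof (induction d arbitrary: p va)
  case 0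
  have "leads ((4, 0, q) # st, p, va, vb, out, c, m) (1 + nodes (h va))
     (st, e, va, vb, out @ lay q c (h va), c + nodes (h va), m)" for q st out c
    using leads_trans[OF leads_step[OF reach_decisionA_0]] assms unfolding builds_def by blast
  then have "builds 4 0 (1 + nodes (h va)) p va vb m e va vb (h va)" unfolding builds_def by blast
  then have "builds 4 0 (3 * nodes (h va)) p va vb m e va vb (h va)"
    by (rule builds_mono) (use nodes_pos[of "h va"] in linarith)
  then show ?case by simp
next
  case (Suc d)
  let ?l = "\<lambda>d. L (2 * d)"
  let ?va = "setbit (?l d) 0 va"
  let ?vb = "setbit (?l d) 1 (final ?l d ?va)"
  let ?s = "decision h ?l d ?va" and ?t = "decision h ?l d ?vb"
  have "leads ((4, Suc d, q) # st, p, va, vb, out, c, m) (1 + (1 + (3 * nodes ?s + (1 + 3 * nodes ?t))))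
     (st, e, final ?l d ?vb, vb, out @ lay q c (N2 ?s ?t), c + nodes (N2 ?s ?t), m)" for q st out c
  proof (rule leads_trans[OF leads_step[OF reach_decisionA_Suc] leads_trans[OF leads_step[OF reach_setA]]])
    have 1: "leads ((4, d, c) # (8, d, 1) # (4, d, c) # st, p, ?va, vb, out @ [q], c + 1, m) (3 * nodes ?s)
      ((8, d, 1) # (4, d, c) # st, e, final ?l d ?va, vb, (out @ [q]) @ lay c (c + 1) ?s, c + 1 + nodes ?s, m)"
      using Suc.IH unfolding builds_def by blast
    have 2: "leads ((4, d, c) # st, e, ?vb, vb, (out @ [q]) @ lay c (c + 1) ?s, c + 1 + nodes ?s, m) (3 * nodes ?t)
      (st, e, final ?l d ?vb, vb, ((out @ [q]) @ lay c (c + 1) ?s) @ lay c (c + 1 + nodes ?s) ?t, c + 1 + nodes ?s + nodes ?t, m)"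
      using Suc.IH unfolding builds_def by blast
    show "leads ((4, d, c) # (8, d, 1) # (4, d, c) # st, p, ?va, vb, out @ [q], c + 1, m) (3 * nodes ?s + (1 + 3 * nodes ?t))
     (st, e, final ?l d ?vb, vb, out @ lay q c (N2 ?s ?t), c + nodes (N2 ?s ?t), m)"
      using leads_trans[OF 1 leads_trans[OF leads_step[OF reach_setA] 2]] by (simp add: ac_simps)
  qed
  then have "builds 4 (Suc d) (1 + (1 + (3 * nodes ?s + (1 + 3 * nodes ?t)))) p va vb m e (final ?l d ?vb) vb (N2 ?s ?t)"
    unfolding builds_def by blast
  from builds_mono[OF this, of "3 * nodes (N2 ?s ?t)"] show ?case by simp
qed

lemma decisionB_run:
  assumes "\<And>v. builds 2 0 (nodes (h v)) 0 va v m e va v (h v)"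
  shows "builds 6 d (3 * nodes (decision h (\<lambda>d. L (2 * d + 1)) d vb)) p va vb m e va (final (\<lambda>d. L (2 * d + 1)) d vb)
    (decision h (\<lambda>d. L (2 * d + 1)) d vb)"
proof (induction d arbitrary: p vb)
  case 0
  have "leads ((6, 0, q) # st, p, va, vb, out, c, m) (1 + nodes (h vb))
     (st, e, va, vb, out @ lay q c (h vb), c + nodes (h vb), m)" for q st out c
    using leads_trans[OF leads_step[OF reach_decisionB_0]] assms unfolding builds_def by blast
  then have "builds 6 0 (1 + nodes (h vb)) p va vb m e va vb (h vb)" unfolding builds_def by blast
  then have "builds 6 0 (3 * nodes (h vb)) p va vb m e va vb (h vb)"
    by (rule builds_mono) (use nodes_pos[of "h vb"] in linarith)
  then show ?case by simp
next
  case (Suc d)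
  let ?l = "\<lambda>d. L (2 * d + 1)"
  let ?va = "setbit (?l d) 0 vb"
  let ?vb = "setbit (?l d) 1 (final ?l d ?va)"
  let ?s = "decision h ?l d ?va" and ?t = "decision h ?l d ?vb"
  have "leads ((6, Suc d, q) # st, p, va, vb, out, c, m) (1 + (1 + (3 * nodes ?s + (1 + 3 * nodes ?t))))
     (st, e, va, final ?l d ?vb, out @ lay q c (N2 ?s ?t), c + nodes (N2 ?s ?t), m)" for q st out c
  proof (rule leads_trans[OF leads_step[OF reach_decisionB_Suc] leads_trans[OF leads_step[OF reach_setB]]])
    have 1: "leads ((6, d, c) # (9, d, 1) # (6, d, c) # st, p, va, ?va, out @ [q], c + 1, m) (3 * nodes ?s)
      ((9, d, 1) # (6, d, c) # st, e, va, final ?l d ?va, (out @ [q]) @ lay c (c + 1) ?s, c + 1 + nodes ?s, m)"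
      using Suc.IH unfolding builds_def by blast
    have 2: "leads ((6, d, c) # st, e, va, ?vb, (out @ [q]) @ lay c (c + 1) ?s, c + 1 + nodes ?s, m) (3 * nodes ?t)
      (st, e, va, final ?l d ?vb, ((out @ [q]) @ lay c (c + 1) ?s) @ lay c (c + 1 + nodes ?s) ?t, c + 1 + nodes ?s + nodes ?t, m)"
      using Suc.IH unfolding builds_def by blast
    show "leads ((6, d, c) # (9, d, 1) # (6, d, c) # st, p, va, ?va, out @ [q], c + 1, m) (3 * nodes ?s + (1 + 3 * nodes ?t))
     (st, e, va, final ?l d ?vb, out @ lay q c (N2 ?s ?t), c + nodes (N2 ?s ?t), m)"
      using leads_trans[OF 1 leads_trans[OF leads_step[OF reach_setB] 2]] by (simp add: ac_simps)
  qed
  then have "builds 6 (Suc d) (1 + (1 + (3 * nodes ?s + (1 + 3 * nodes ?t)))) p va vb m e va (final ?l d ?vb) (N2 ?s ?t)"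
    unfolding builds_def by blast
  from builds_mono[OF this, of "3 * nodes (N2 ?s ?t)"] show ?case by simp
qed

text \<open>The additional 1 is the task that passes from the end of the spine to the decision
  tree.\<close>

lemma spine_run:
  assumes u: "builds 1 kb (nodes u) 0 va vb m e va vb u" and t: "\<And>p. builds 6 kb (3 * nodes t) p va vb m e va vb' t"
  shows "builds 7 d (3 * nodes (spine u t d) + 1) p va vb m e va vb' (spine u t d)"
proof (induction d arbitrary: p)
  case 0
  have "leads ((7, 0, q) # st, p, va, vb, out, c, m) (1 + 3 * nodes t)
     (st, e, va, vb', out @ lay q c t, c + nodes t, m)" for q st out c
    using leads_trans[OF leads_step[OF reach_spine_0]] t unfolding builds_def by blast
  then show ?case unfolding builds_def by simp
next
  case (Suc d)
  have "builds 7 (Suc d) (1 + (3 * nodes (full u d) + (3 * nodes (spine u t d) + 1))) p va vb m e va vb' (N2 (full u d) (spine u t d))"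
    unfolding builds_def using leads_trans[OF leads_step[OF reach_spine_Suc] chain_N2[OF full_run[OF u order.refl] Suc.IH]] by blast
  from builds_mono[OF this, of "3 * nodes (spine u t (Suc d)) + 1"] show ?case by simp
qed

lemma main_run:
  assumes e: "enc_at 0 F" and k: "ka = numA F" "kb = numB F" and L: "\<And>i. i < length (varlist F) \<Longrightarrow> L i = varlist F ! i"
  shows "\<exists>p va vb. leads ([(4, ka, 0), (10, 0, 0), (7, ka, 0)], p0, \<lambda>_. 0, \<lambda>_. 0, out, 0, m)
    (3 * nodes (pattern_tree F) + 3 * nodes (host_tree F) + 2)
    ([], p, va, vb, out @ lay 0 0 (pattern_tree F) @ lay 0 0 (host_tree F), nodes (host_tree F), nodes (pattern_tree F))"
proof -
  let ?v = "\<lambda>_::nat. 0::nat"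
  let ?lA = "\<lambda>d. L (2 * d)" and ?lB = "\<lambda>d. L (2 * d + 1)"
  let ?hA = "\<lambda>v. path kb (plain (wideA v) F)" and ?hB = "\<lambda>v. host (wideB v) F"
  let ?e = "length (enc F)"
  have A: "builds 0 kb (nodes (?hA v)) 0 v ?v m ?e v ?v (?hA v)" for v
    using path_run[OF plain_run[of 0 0 F "wideA v" v ?v m], of kb] e by (simp add: nodes_path wideA_def)
  \<comment> \<open>For every \<open>va\<close>, because the table of the first half still holds the
    last assignment when the host is written; kinds 1 and 2 do not read it.\<close>
  have B: "builds 2 0 (nodes (?hB v)) 0 va v m ?e va v (?hB v)" for va v m
    using host_run[OF e, of v va m] by simp
  have U: "builds 1 kb (nodes (path kb (universal F))) 0 va ?v m ?e va ?v (path kb (universal F))" for va m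
    using path_run[OF universal_run[OF e, of va ?v m], of kb] by (simp add: nodes_path)
  let ?T1 = "decision ?hA ?lA ka ?v" and ?T2 = "spine (path kb (universal F)) (decision ?hB ?lB kb ?v) ka"
  let ?va = "final ?lA ka ?v" and ?vb = "final ?lB kb ?v"
  have 1: "leads ([(4, ka, 0), (10, 0, 0), (7, ka, 0)], p0, ?v, ?v, out, 0, m) (3 * nodes ?T1)
     ([(10, 0, 0), (7, ka, 0)], ?e, ?va, ?v, out @ lay 0 0 ?T1, 0 + nodes ?T1, m)"
    using decisionA_run[of ?hA ?v m ?e, OF A] unfolding builds_def by blast
  have 2: "leads ([(7, ka, 0)], ?e, ?va, ?v, out @ lay 0 0 ?T1, 0, 0 + nodes ?T1) (3 * nodes ?T2 + 1)
     ([], ?e, ?va, ?vb, (out @ lay 0 0 ?T1) @ lay 0 0 ?T2, 0 + nodes ?T2, 0 + nodes ?T1)"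
    using spine_run[OF U decisionB_run[of ?hB, OF B]] unfolding builds_def by blast
  \<comment> \<open>\<open>L\<close> is known to agree with \<open>varlist F\<close> only below its
    length, so the trees are identified through the indices below their depth.\<close>
  have congL: "final l d v = final l' d v" "decision h l d v = decision h l' d v" if "\<And>i. i < d \<Longrightarrow> l i = l' i" for l l' d v h
    using that by (induction d arbitrary: v) auto
  have lA: "?lA i = varlist F ! (2 * i)" if "i < numA F" for i
    by (rule L) (use that in \<open>simp add: numA_def\<close>)
  have lB: "?lB i = varlist F ! (2 * i + 1)" if "i < numB F" for i
    by (rule L) (use that in \<open>simp add: numB_def\<close>)
  have T: "?T1 = pattern_tree F" "?T2 = host_tree F"
    unfolding pattern_tree_def host_tree_def k
    by (simp_all only: congL(2)[OF lA, of "numA F" "\<lambda>i. i"] congL(2)[OF lB, of "numB F" "\<lambda>i. i"])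
  from leads_trans[OF 1 leads_trans[OF leads_step[OF reach_switch] 2]]
  show ?thesis unfolding T by (intro exI[of _ ?e] exI[of _ ?va] exI[of _ ?vb]) simp
qed

end

section \<open>Reading the input and placing the output\<close>

fun run :: "instr list \<Rightarrow> (nat \<Rightarrow> nat) \<Rightarrow> nat \<Rightarrow> nat" where
  "run [] m = m"
| "run (i # is) m = run is (snd (exec i (0, m)))"

fun block :: "instr list \<Rightarrow> rcom" where
  "block [] = Ins Halt"
| "block [i] = Ins i"
| "block (i # is) = Ins i ;; block is"

lemma big_block:
  assumes "is \<noteq> []" "list_all straight is"
  shows "big (block is) m (length is) (run is m)"
  using assms
proof (induction "is" arbitrary: m rule: block.induct)
  case (2 i)
  then show ?case using big.Ins[of i m] by simp
next
  case (3 i j "is")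
  then show ?case using big.Seq[OF big.Ins] by fastforce
qed simp

lemma big_blockI:
  "is \<noteq> [] \<Longrightarrow> list_all straight is \<Longrightarrow> n = length is \<Longrightarrow> m' = run is m \<Longrightarrow> big (block is) m n m'"
  using big_block by simp

lemma run_append: "run (xs @ ys) m = run ys (run xs m)"
  by (induction xs arbitrary: m) auto

text \<open>Unrolled, since the registers that a loop would use are the cells to be saved. Cell 1 is
  the pointer and cell 2 the stride.\<close>

fun saves :: "nat \<Rightarrow> instr list" where
  "saves 0 = []"
| "saves (Suc k) = saves k @ [Add 1 1 2, Store 1 (3 + k)]"

lemma run_saves:
  assumes "m 1 = b" "m 2 = 16" "3 + k \<le> b"
  shows "run (saves k) m 1 = b + 16 * k \<and> (\<forall>i<k. run (saves k) m (b + 16 * Suc i) = m (3 + i)) \<and>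
    (\<forall>a. a \<noteq> 1 \<and> (\<forall>i<k. a \<noteq> b + 16 * Suc i) \<longrightarrow> run (saves k) m a = m a)"
  using assms(3)
proof (induction k)
  case 0
  then show ?case using assms by simp
next
  case (Suc k)
  let ?m = "run (saves k) m"
  have ih: "?m 1 = b + 16 * k" "\<And>i. i < k \<Longrightarrow> ?m (b + 16 * Suc i) = m (3 + i)"
    "\<And>a. a \<noteq> 1 \<Longrightarrow> (\<And>i. i < k \<Longrightarrow> a \<noteq> b + 16 * Suc i) \<Longrightarrow> ?m a = m a"
    using Suc by auto
  have eq: "run (saves (Suc k)) m = ?m(1 := b + 16 * Suc k, b + 16 * Suc k := m (3 + k))"
  proof -
    have "?m 2 = 16" "?m (3 + k) = m (3 + k)" using ih(3)[of 2] ih(3)[of "3 + k"] assms Suc.prems by auto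
    then show ?thesis using ih(1) Suc.prems by (simp add: run_append numeral_3_eq_3 ac_simps)
  qed
  show ?case unfolding eq using ih Suc.prems by (auto simp: less_Suc_eq)
qed

text \<open>Initially every cell that a fixed instruction can name may hold input. Only the number of variables is not needed, so
  cells 0 and 1 are free to move a first token to address \<open>B\<close>, 32 times the input length, which lies beyond the input;
  the cell that this frees holds the stride 16.\<close>

definition prologue :: rcom where
  "prologue = block ([Const 0 0, Add 0 0 1, Add 1 1 1, Add 1 1 1, Add 1 1 1, Add 1 1 1, Add 1 1 1, Store 1 2, Const 2 16]
      @ saves 21 @ [Const 3 0, Add 3 0 3, Const 4 336, Sub 5 1 4, Const 6 24, Add 7 1 2, Sub 8 5 6, Const 10 1]) ;;
    While 8 (block [Load 9 6, Store 7 9, Add 6 6 10, Add 7 7 2, Sub 8 5 6]) ;;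
    block [Const 2 0, Add 2 2 5]"

lemma length_saves: "length (saves k) = 2 * k"
  by (induction k) auto

lemma straight_saves: "list_all straight (saves k)"
  by (induction k) auto

text \<open>The loop copies all cells from 24 up to \<open>B\<close>, beyond the end of the input.
  As \<open>B\<close> is linear in the input length, this costs only a constant factor.\<close>

lemma prologue_correct:
  assumes "3 \<le> m 1"
  defines "B \<equiv> 32 * m 1"
  shows "\<exists>m'. big prologue m (8 * (B - 24) + 62) m' \<and> m' 2 = B \<and> m' 3 = m 1 \<and>
    (\<forall>k<B - 2. m' (B + 16 * k) = m (k + 2)) \<and> (\<forall>a\<ge>B. (\<forall>k<B - 2. a \<noteq> B + 16 * k) \<longrightarrow> m' a = m a)"
proof -
  have B: "96 \<le> B" using assms by simp
  let ?pre = "[Const 0 0, Add 0 0 1, Add 1 1 1, Add 1 1 1, Add 1 1 1, Add 1 1 1, Add 1 1 1, Store 1 2, Const 2 16]"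
  let ?post = "[Const 3 0, Add 3 0 3, Const 4 336, Sub 5 1 4, Const 6 24, Add 7 1 2, Sub 8 5 6, Const 10 1]"
  define m1 where "m1 = run ?pre m"
  have m1: "m1 = m(0 := m 1, 1 := B, B := m 2, 2 := 16)"
    unfolding m1_def B_def using assms(1) by (auto simp: fun_eq_iff)
  define m2 where "m2 = run (saves 21) m1"
  have "m1 1 = B" "m1 2 = 16" using B unfolding m1 by auto
  from run_saves[OF this, of 21] B have m2: "m2 1 = B + 336"
      "\<And>i. i < 21 \<Longrightarrow> m2 (B + 16 * Suc i) = m1 (3 + i)"
      "\<And>a. a \<noteq> 1 \<Longrightarrow> (\<And>i. i < 21 \<Longrightarrow> a \<noteq> B + 16 * Suc i) \<Longrightarrow> m2 a = m1 a"
    unfolding m2_def by auto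
  have m2_low: "m2 a = m1 a" if "a \<noteq> 1" "a \<le> B" for a
    using m2(3)[of a] that by auto
  define m3 where "m3 = run ?post m2"
  \<comment> \<open>336 = 16 * 21 undoes the advance of cell 1 over the 21 saved cells; 352 = 16 *
    22 is the offset of the slot for cell 24.\<close>
  have m3: "m3 = m2(3 := m 1, 4 := 336, 5 := B, 6 := 24, 7 := B + 352, 8 := B - 24, 10 := 1)"
    unfolding m3_def using m2(1) m2_low[of 0] m2_low[of 2] B by (auto simp: fun_eq_iff m1)
  have big1: "big (block (?pre @ saves 21 @ ?post)) m 59 m3"
    using big_block[of "?pre @ saves 21 @ ?post" m] straight_saves
    unfolding m3_def m2_def m1_def by (simp add: run_append length_saves)
  \<comment> \<open>With \<open>d\<close> cells left, cell 6 points to the next source and cell 7 to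
    its slot. All slots lie at or above \<open>B\<close>, so no source is lost.\<close>
  define I where "I d m' \<longleftrightarrow> d \<le> B - 24 \<and> m' 2 = 16 \<and> m' 3 = m 1 \<and> m' 5 = B \<and> m' 6 = B - d \<and> m' 7 = B + 16 * (B - d - 2) \<and>
      m' 8 = d \<and> m' 10 = 1 \<and> (\<forall>a. 24 \<le> a \<and> a < B \<longrightarrow> m' a = m a) \<and>
      (\<forall>k<B - d - 2. m' (B + 16 * k) = m (k + 2)) \<and>
      (\<forall>a\<ge>B. (\<forall>k<B - d - 2. a \<noteq> B + 16 * k) \<longrightarrow> m' a = m a)" for d m'
  have I1: "I (B - 24) m3"
  proof -
    have "m3 (B + 16 * k) = m (k + 2)" if "k < 22" for k
    proof (cases k)
      case 0
      then show ?thesis using m2_low[of B] B unfolding m3 m1 by (simp add: numeral_2_eq_2)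
    next
      case (Suc i)
      then show ?thesis using m2(2)[of i] B that unfolding m3 m1 by (simp add: eval_nat_numeral)
    qed
    moreover have "m3 a = m a" if "B \<le> a" "\<And>k. k < 22 \<Longrightarrow> a \<noteq> B + 16 * k" for a
    proof -
      have "a \<noteq> B" using that(2)[of 0] by simp
      moreover have "a \<noteq> B + 16 * Suc i" if "i < 21" for i
        using \<open>\<And>k. k < 22 \<Longrightarrow> a \<noteq> B + 16 * k\<close>[of "Suc i"] that by simp
      ultimately show ?thesis using m2(3)[of a] B that(1) unfolding m3 m1 by simp
    qed
    moreover have "m3 a = m a" if "24 \<le> a" "a < B" for a
      using m2_low[of a] that unfolding m3 m1 by simp
    moreover have "m3 2 = 16" using m2_low[of 2] B unfolding m3 m1 by simp
    ultimately show ?thesis unfolding I_def m3 using B by auto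
  qed
  have step: "m' 8 \<noteq> 0 \<and> (\<exists>m''. big (block [Load 9 6, Store 7 9, Add 6 6 10, Add 7 7 2, Sub 8 5 6]) m' 5 m'' \<and> I d (m''(0 := 0)))"
    if i: "I (Suc d) m'" for d m'
  proof
    let ?a = "B - Suc d"
    have i: "Suc d \<le> B - 24" "m' 2 = 16" "m' 3 = m 1" "m' 5 = B" "m' 6 = ?a" "m' 7 = B + 16 * (?a - 2)" "m' 8 = Suc d" "m' 10 = 1"
      "\<And>a. 24 \<le> a \<Longrightarrow> a < B \<Longrightarrow> m' a = m a" "\<And>k. k < ?a - 2 \<Longrightarrow> m' (B + 16 * k) = m (k + 2)"
      "\<And>a. B \<le> a \<Longrightarrow> (\<And>k. k < ?a - 2 \<Longrightarrow> a \<noteq> B + 16 * k) \<Longrightarrow> m' a = m a"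
      using i unfolding I_def by auto
    show "m' 8 \<noteq> 0" using i by simp
    have a: "24 \<le> ?a" "?a < B" "Suc ?a = B - d" "B - d - 2 = Suc (?a - 2)" "?a - 2 + 2 = ?a" using i(1) B by auto
    have dB: "d \<le> B" using i(1) by simp
    define x p where "x = ?a" and "p = B + 16 * (?a - 2)"
    have xp: "m' 6 = x" "m' 7 = p" "24 \<le> x" "24 \<le> p" "m' x = m x" "Suc x = B - d" "p + 16 = B + 16 * (B - d - 2)" "B - Suc x = d"
      using i(5,6) i(9)[of ?a] i(1) a B diff_diff_cancel[OF dB] unfolding x_def p_def by auto
    let ?m = "m'(9 := m x, p := m x, 6 := Suc x, 7 := p + 16, 8 := d)"
    have r: "run [Load 9 6, Store 7 9, Add 6 6 10, Add 7 7 2, Sub 8 5 6] m' = ?m"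
      using i(2,4,8) xp(1-5,8) by simp
    have "big (block [Load 9 6, Store 7 9, Add 6 6 10, Add 7 7 2, Sub 8 5 6]) m' 5 ?m"
      by (rule big_blockI[OF _ _ _ r[symmetric]]) simp_all
    moreover have "I d (?m(0 := 0))"
    proof -
      have "(?m(0 := 0)) (B + 16 * k) = m (k + 2)" if "k < B - d - 2" for k
        using that i(10)[of k] a B by (cases "k = ?a - 2") (auto simp: x_def p_def)
      moreover have "(?m(0 := 0)) x = m x" if "B \<le> x" "\<And>k. k < B - d - 2 \<Longrightarrow> x \<noteq> B + 16 * k" for x
      proof -
        have "m' x = m x" by (rule i(11)) (use that a in auto)
        then show ?thesis using that(1) that(2)[of "?a - 2"] a B by (auto simp: p_def)
      qed
      moreover have "(?m(0 := 0)) x' = m x'" if "24 \<le> x'" "x' < B" for x'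
        using that i(9)[of x'] by (auto simp: p_def)
      ultimately show ?thesis unfolding I_def using i(1,2,3,4,8) xp(4,6,7) by auto
    qed
    ultimately show "\<exists>m''. big (block [Load 9 6, Store 7 9, Add 6 6 10, Add 7 7 2, Sub 8 5 6]) m' 5 m'' \<and> I d (m''(0 := 0))"
      by blast
  qed
  obtain m4 where m4: "big (While 8 (block [Load 9 6, Store 7 9, Add 6 6 10, Add 7 7 2, Sub 8 5 6])) m3 ((B - 24) * (5 + 3) + 1) m4" "I 0 m4"
    using big_while_invariant[of I 8 "block [Load 9 6, Store 7 9, Add 6 6 10, Add 7 7 2, Sub 8 5 6]" 5, OF step _ I1]
    unfolding I_def by auto
  have big3: "big (block [Const 2 0, Add 2 2 5]) m4 2 (m4(2 := B))"
    using big_block[of "[Const 2 0, Add 2 2 5]" m4] m4(2) unfolding I_def by (simp add: numeral_2_eq_2[symmetric])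
  have "big prologue m (59 + ((B - 24) * (5 + 3) + 1) + 2) (m4(2 := B))"
    unfolding prologue_def by (rule big_SeqI[OF big1 big_SeqI[OF m4(1) big3 refl]]) simp
  then have "big prologue m (8 * (B - 24) + 62) (m4(2 := B))" by (simp add: ac_simps)
  moreover have "(m4(2 := B)) 3 = m 1" "(m4(2 := B)) (B + 16 * k) = m (k + 2)" if "k < B - 2" for k
    using m4(2) that B unfolding I_def by auto
  ultimately show ?thesis using m4(2) B unfolding I_def by (intro exI[of _ "m4(2 := B)"]) auto
qed

section \<open>Collecting the variables of the formula\<close>

definition scan_code :: hcom where
  "scan_code = HRd 17 0 4 \<triangleright> HIf 17
     (HAddi 12 4 1 \<triangleright> HRd 13 0 12 \<triangleright> HRd 14 8 13 \<triangleright>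
      HIf 14 (HConst 15 1 \<triangleright> HWr 8 13 15 \<triangleright> HAdd 16 9 10 \<triangleright> HWr 7 16 13 \<triangleright> HAddi 16 10 1 \<triangleright> mov 10 9 \<triangleright> mov 9 16) HSkip \<triangleright>
      HAddi 4 4 3)
     (HAddi 4 4 1) \<triangleright> HSub 11 3 4"

lemma wf_scan_code: "well_formed scan_code"
  by (simp add: scan_code_def mov_def reg_def)

fun scan_repr :: "(nat \<Rightarrow> nat) \<Rightarrow> nat \<Rightarrow> nat \<Rightarrow> nat list \<Rightarrow> hstate \<Rightarrow> bool" where
  "scan_repr T n p xs (\<rho>, \<alpha>) \<longleftrightarrow> \<rho> 3 = n \<and> \<rho> 4 = p \<and> \<rho> 11 = n - p \<and> \<rho> 9 = Suc (length xs) div 2 \<and> \<rho> 10 = length xs div 2 \<and>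
     \<alpha> 0 = T \<and> (\<forall>i<length xs. \<alpha> 7 i = xs ! i) \<and> (\<forall>i. \<alpha> 8 i = of_bool (i \<in> set xs)) \<and>
     \<alpha> 5 = (\<lambda>_. 0) \<and> \<alpha> 6 = (\<lambda>_. 0)"

lemma halves_sum: "Suc n div 2 + n div 2 = n" for n :: nat
  by presburger

text \<open>The marks are indexed by the variable itself, so a lookup takes constant time whatever
  \<open>n\<close> is. With a new variable the old upper half count becomes the lower one and the
  old lower count plus 1 the upper one; this is why registers 9 and 10 trade places. Their sum is
  the next free index.\<close>

lemma scan_lit:
  assumes "T p = 0" "p < n"
  shows "loops scan_code 11 (scan_repr T n p xs) 1 (scan_repr T n (p + 3) (scan (Lit (T (p + 1)) b) xs))"
proof (rule loopsI)
  fix \<rho> \<alpha> assume r: "scan_repr T n p xs (\<rho>, \<alpha>)"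
  show "scan_repr T n (p + 3) (scan (Lit (T (p + 1)) b) xs) (hex scan_code (\<rho>, \<alpha>)) \<and> \<rho> 11 \<noteq> 0"
  proof (cases "T (p + 1) \<in> set xs")
    case True
    then show ?thesis using r assms by (simp add: scan_code_def mov_def)
  next
    case False
    then show ?thesis using r assms
      by (auto simp add: scan_code_def mov_def halves_sum nth_append less_Suc_eq)
  qed
qed

lemma scan_op:
  assumes "T p \<noteq> 0" "p < n"
  shows "loops scan_code 11 (scan_repr T n p xs) 1 (scan_repr T n (p + 1) xs)"
  by (rule loopsI) (use assms in \<open>simp add: scan_code_def mov_def\<close>)

lemma scan_run:
  assumes "machine.enc_at T p F" "p + length (enc F) \<le> n"
  shows "\<exists>k\<le>length (enc F). loops scan_code 11 (scan_repr T n p xs) k (scan_repr T n (p + length (enc F)) (scan F xs))"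
  using assms
proof (induction F arbitrary: p xs)
  case (Lit i b)
  note e = machine.enc_at_Lit[OF Lit(1)]
  have "loops scan_code 11 (scan_repr T n p xs) 1 (scan_repr T n (p + 3) (scan (Lit i b) xs))"
  proof -
    have T: "T p = 0" "T (p + 1) = i" and p: "p < n" using e Lit(2) by auto
    show ?thesis using scan_lit[of T p n xs b, OF T(1) p] unfolding T(2) .
  qed
  then show ?case by (intro exI[of _ 1]) (simp add: eval_nat_numeral)
next
  case (And f g)
  note e = machine.enc_at_And[OF And.prems(1)]
  obtain k where k: "k \<le> length (enc f)"
    "loops scan_code 11 (scan_repr T n (p + 1) xs) k (scan_repr T n (p + 1 + length (enc f)) (scan f xs))"
    using And.IH(1)[of "p + 1"] e And.prems(2) by auto
  obtain l where l: "l \<le> length (enc g)"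
    "loops scan_code 11 (scan_repr T n (p + 1 + length (enc f)) (scan f xs)) l
       (scan_repr T n (p + 1 + length (enc f) + length (enc g)) (scan g (scan f xs)))"
    using And.IH(2)[of "p + 1 + length (enc f)"] e And.prems(2) by auto
  have "loops scan_code 11 (scan_repr T n p xs) 1 (scan_repr T n (p + 1) xs)"
    by (rule scan_op) (use e And.prems(2) in auto)
  from loops_trans[OF this loops_trans[OF k(2) l(2)]] k l show ?case
    by (intro exI[of _ "1 + (k + l)"]) (simp add: ac_simps)
next
  case (Or f g)
  note e = machine.enc_at_Or[OF Or.prems(1)]
  obtain k where k: "k \<le> length (enc f)"
    "loops scan_code 11 (scan_repr T n (p + 1) xs) k (scan_repr T n (p + 1 + length (enc f)) (scan f xs))"
    using Or.IH(1)[of "p + 1"] e Or.prems(2) by auto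
  obtain l where l: "l \<le> length (enc g)"
    "loops scan_code 11 (scan_repr T n (p + 1 + length (enc f)) (scan f xs)) l
       (scan_repr T n (p + 1 + length (enc f) + length (enc g)) (scan g (scan f xs)))"
    using Or.IH(2)[of "p + 1 + length (enc f)"] e Or.prems(2) by auto
  have "loops scan_code 11 (scan_repr T n p xs) 1 (scan_repr T n (p + 1) xs)"
    by (rule scan_op) (use e Or.prems(2) in auto)
  from loops_trans[OF this loops_trans[OF k(2) l(2)]] k l show ?case
    by (intro exI[of _ "1 + (k + l)"]) (simp add: ac_simps)
qed

text \<open>The output has to replace the registers and the beginning of the arrays. Its first 24 values are therefore repeated
  behind its end, the others are copied in ascending order, which overwrites only values that are already copied, and
  the registers are loaded last.\<close>

fun stash :: "nat \<Rightarrow> hcom" where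
  "stash 0 = HSkip"
| "stash (Suc k) = stash k \<triangleright> HConst 11 k \<triangleright> HRd 12 4 11 \<triangleright> HAddi 13 6 k \<triangleright> HWr 4 13 12"

lemma wf_stash: "well_formed (stash k)"
  by (induction k) (simp_all add: reg_def)

lemma hex_stash:
  "fst (hex (stash k) (\<rho>, \<alpha>)) 6 = \<rho> 6 \<and>
   (\<forall>i<\<rho> 6. snd (hex (stash k) (\<rho>, \<alpha>)) 4 i = \<alpha> 4 i \<and> (i < k \<longrightarrow> snd (hex (stash k) (\<rho>, \<alpha>)) 4 (\<rho> 6 + i) = \<alpha> 4 i))"
proof (induction k)
  case 0
  show ?case by simp
next
  case (Suc k)
  obtain \<rho>' \<alpha>' where s: "hex (stash k) (\<rho>, \<alpha>) = (\<rho>', \<alpha>')" by fastforce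
  from Suc.IH show ?case unfolding stash.simps hex.simps s by (auto simp: less_Suc_eq)
qed

definition finish :: hcom where
  "finish = HConst 11 0 \<triangleright> HWr 4 11 8 \<triangleright> HConst 11 1 \<triangleright> HWr 4 11 7 \<triangleright> stash 24"

text \<open>Runs downwards through the registers, because cell 0 is the pointer and cell 1 the
  stride; these two are filled last, in \<open>epilogue\<close>.\<close>

fun loads :: "nat \<Rightarrow> instr list" where
  "loads 0 = [Sub 0 0 1]"
| "loads (Suc k) = Load (k + 2) 0 # Sub 0 0 1 # loads k"

lemma length_loads: "length (loads k) = 2 * k + 1"
  by (induction k) auto

lemma straight_loads: "list_all straight (loads k)"
  by (induction k) auto

lemma run_loads:
  assumes "m 0 = b + 16 * (k + 1)" "m 1 = 16" "k + 2 \<le> b"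
  shows "run (loads k) m 0 = b \<and> run (loads k) m 1 = 16 \<and> (\<forall>r<k. run (loads k) m (r + 2) = m (b + 16 * (r + 2))) \<and>
    (\<forall>a\<ge>k + 2. run (loads k) m a = m a)"
  using assms
proof (induction k arbitrary: m)
  case 0
  then show ?case by simp
next
  case (Suc k)
  define m' where "m' = m(k + 2 := m (b + 16 * (k + 2)), 0 := b + 16 * (k + 1))"
  have eq: "run (loads (Suc k)) m = run (loads k) m'"
    using Suc.prems by (simp add: m'_def algebra_simps)
  have m': "m' 0 = b + 16 * (k + 1)" "m' 1 = 16" "k + 2 \<le> b" "\<And>a. k + 3 \<le> a \<Longrightarrow> m' a = m a"
      "m' (k + 2) = m (b + 16 * (k + 2))"
    using Suc.prems by (simp_all add: m'_def)
  from Suc.IH[OF m'(1-3)] have 1: "run (loads k) m' 0 = b" "run (loads k) m' 1 = 16"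
    "\<And>r. r < k \<Longrightarrow> run (loads k) m' (r + 2) = m' (b + 16 * (r + 2))"
    "\<And>a. k + 2 \<le> a \<Longrightarrow> run (loads k) m' a = m' a"
    by blast+
  have "run (loads k) m' (r + 2) = m (b + 16 * (r + 2))" if "r < Suc k" for r
  proof (cases "r = k")
    case True
    then show ?thesis using 1(4)[of "r + 2"] m'(5) by simp
  next
    case False
    then show ?thesis using 1(3)[of r] m'(4)[of "b + 16 * (r + 2)"] Suc.prems(3) that by simp
  qed
  moreover have "run (loads k) m' a = m a" if "Suc k + 2 \<le> a" for a
    using 1(4)[of a] m'(4)[of a] that by simp
  ultimately show ?case unfolding eq using 1(1,2) by blast
qed

definition epilogue :: rcom where
  "epilogue = block [Const 9 24, Const 10 388, Add 10 10 2, Const 11 16, Const 12 1, Sub 8 6 9] ;;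
     While 8 (block [Load 13 10, Store 9 13, Add 9 9 12, Add 10 10 11, Sub 8 6 9]) ;;
     block ([Add 0 6 6, Add 0 0 0, Add 0 0 0, Add 0 0 0, Add 0 0 2, Const 1 372, Add 0 0 1, Const 1 16] @ loads 22 @
       [Add 1 0 1, Load 1 1, Load 0 0])"

text \<open>388 = 16 * 24 + 4 is the offset of output value 24 in array 4; 372 = 16 * 23 + 4 leads
  from \<open>B + 16 * M\<close> to the last repeated value.\<close>

lemma epilogue_correct:
  assumes "24 \<le> B" "m 2 = B" "m 6 = M"
    and out: "\<And>i. i < M \<Longrightarrow> m (B + 16 * i + 4) = out i"
    and stash: "\<And>i. i < M \<Longrightarrow> i < 24 \<Longrightarrow> m (B + 16 * (M + i) + 4) = out i"
  shows "\<exists>m'. big epilogue m (8 * (M - 24) + 63) m' \<and> (\<forall>i<M. m' i = out i)"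
proof -
  define m1 where "m1 = m(9 := 24, 10 := B + 388, 11 := 16, 12 := 1, 8 := M - 24)"
  have big1: "big (block [Const 9 24, Const 10 388, Add 10 10 2, Const 11 16, Const 12 1, Sub 8 6 9]) m 6 m1"
    by (rule big_blockI) (use assms(1-3) in \<open>simp_all add: m1_def add.commute\<close>)
  \<comment> \<open>Slots from \<open>x\<close> on are still to be copied and slots from
    \<open>M\<close> on hold the repeated values; the cells that the copying has filled lie below
    both.\<close>
  define I where "I d m' \<longleftrightarrow> m' 2 = B \<and> m' 6 = M \<and> (\<exists>x. 24 \<le> x \<and> x + d = max 24 M \<and> m' 9 = x \<and> m' 10 = B + 16 * x + 4 \<and> m' 8 = M - x \<and>
      (\<forall>k. 24 \<le> k \<and> k < x \<and> k < M \<longrightarrow> m' k = out k) \<and> (\<forall>k. x \<le> k \<or> M \<le> k \<longrightarrow> m' (B + 16 * k + 4) = m (B + 16 * k + 4))) \<and>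
      m' 11 = 16 \<and> m' 12 = 1" for d m'
  have I1: "I (M - 24) m1"
    unfolding I_def using assms(1-3) by (auto simp: m1_def intro!: exI[of _ 24])
  have step: "m' 8 \<noteq> 0 \<and> (\<exists>m''. big (block [Load 13 10, Store 9 13, Add 9 9 12, Add 10 10 11, Sub 8 6 9]) m' 5 m'' \<and> I d (m''(0 := 0)))"
    if "I (Suc d) m'" for d m'
  proof -
    from that obtain x where x: "m' 2 = B" "m' 6 = M" "24 \<le> x" "x + Suc d = max 24 M" "m' 9 = x" "m' 10 = B + 16 * x + 4" "m' 8 = M - x"
      "\<And>k. 24 \<le> k \<Longrightarrow> k < x \<Longrightarrow> k < M \<Longrightarrow> m' k = out k"
      "\<And>k. x \<le> k \<or> M \<le> k \<Longrightarrow> m' (B + 16 * k + 4) = m (B + 16 * k + 4)" "m' 11 = 16" "m' 12 = 1"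
      unfolding I_def by blast
    have xM: "x < M" using x(3,4) by auto
    define p where "p = B + 16 * x + 4"
    have p: "m' 10 = p" "m' p = out x" "p + 16 = B + 16 * Suc x + 4" "24 \<le> p"
      using x(6) x(9)[of x] out[OF xM] assms(1) unfolding p_def by auto
    let ?m = "m'(13 := out x, x := out x, 9 := Suc x, 10 := p + 16, 8 := M - Suc x)"
    have r: "run [Load 13 10, Store 9 13, Add 9 9 12, Add 10 10 11, Sub 8 6 9] m' = ?m"
      using x(2,3,5,10,11) p(1,2) by simp
    have "big (block [Load 13 10, Store 9 13, Add 9 9 12, Add 10 10 11, Sub 8 6 9]) m' 5 ?m"
      by (rule big_blockI[OF _ _ _ r[symmetric]]) simp_all
    moreover have "I d (?m(0 := 0))"
    proof -
      define n where "n = ?m(0 := 0)"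
      have "n k = out k" if "24 \<le> k" "k < Suc x" "k < M" for k
        using that x(8)[of k] unfolding n_def by (cases "k = x") auto
      moreover have "n (B + 16 * k + 4) = m (B + 16 * k + 4)" if "Suc x \<le> k \<or> M \<le> k" for k
        using that x(9)[of k] xM assms(1) unfolding n_def by auto
      moreover have "n 2 = B" "n 6 = M" "n 11 = 16" "n 12 = 1" "n 9 = Suc x" "n 10 = B + 16 * Suc x + 4" "n 8 = M - Suc x"
        using x(1,2,3,10,11) p(3) unfolding n_def by auto
      moreover have "24 \<le> Suc x" "Suc x + d = max 24 M" using x(3,4) by auto
      ultimately show ?thesis unfolding I_def n_def[symmetric] by blast
    qed
    ultimately show ?thesis using x(7) xM by auto
  qed
  obtain m2 where m2: "big (While 8 (block [Load 13 10, Store 9 13, Add 9 9 12, Add 10 10 11, Sub 8 6 9])) m1 ((M - 24) * (5 + 3) + 1) m2" "I 0 m2"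
  proof -
    have "\<exists>m2. big (While 8 (block [Load 13 10, Store 9 13, Add 9 9 12, Add 10 10 11, Sub 8 6 9])) m1 ((M - 24) * (5 + 3) + 1) m2 \<and> I 0 m2"
    proof (rule big_while_invariant[where I = I])
      show "m' 8 = 0" if "I 0 m'" for m' using that unfolding I_def by auto
    qed (use step I1 in blast)+
    then show thesis using that by blast
  qed
  let ?pre = "[Add 0 6 6, Add 0 0 0, Add 0 0 0, Add 0 0 0, Add 0 0 2, Const 1 372, Add 0 0 1, Const 1 16]"
  define b where "b = B + 16 * M + 4"
  define m3 where "m3 = m2(0 := b + 16 * (22 + 1), 1 := 16)"
  from m2(2) have M2: "m2 2 = B" "m2 6 = M" "\<And>k. 24 \<le> k \<Longrightarrow> k < M \<Longrightarrow> m2 k = out k"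
    "\<And>k. M \<le> k \<Longrightarrow> m2 (B + 16 * k + 4) = m (B + 16 * k + 4)"
    unfolding I_def by auto
  have r3: "run ?pre m2 = m3" using M2(1,2) by (simp add: m3_def b_def fun_eq_iff)
  define m4 where "m4 = run (loads 22) m3"
  have st: "m3 (b + 16 * r) = out r" if "r < 24" "r < M" for r
    using M2(4)[of "M + r"] stash[of r] that assms(1) unfolding m3_def b_def by (simp add: algebra_simps)
  from run_loads[of m3 b 22] assms(1) have m4: "m4 0 = b" "m4 1 = 16" "\<And>r. r < 22 \<Longrightarrow> m4 (r + 2) = m3 (b + 16 * (r + 2))"
    "\<And>a. 24 \<le> a \<Longrightarrow> m4 a = m3 a"
    unfolding m4_def b_def m3_def by auto
  \<comment> \<open>At the end cells 0 and 1 hold the addresses of their own final values and load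
    through themselves.\<close>
  let ?m5 = "m4(1 := m3 (b + 16), 0 := m3 b)"
  have r5: "run [Add 1 0 1, Load 1 1, Load 0 0] m4 = ?m5"
    using m4(1,2) m4(4)[of b] m4(4)[of "b + 16"] assms(1) by (simp add: b_def)
  have big3: "big (block (?pre @ loads 22 @ [Add 1 0 1, Load 1 1, Load 0 0])) m2 56 ?m5"
    using big_block[of "?pre @ loads 22 @ [Add 1 0 1, Load 1 1, Load 0 0]" m2] straight_loads
    unfolding run_append r3 m4_def[symmetric] r5 by (simp add: length_loads)
  have "big epilogue m (6 + ((M - 24) * (5 + 3) + 1) + 56) ?m5"
    unfolding epilogue_def by (rule big_SeqI[OF big1 big_SeqI[OF m2(1) big3 refl]]) simp
  then have "big epilogue m (8 * (M - 24) + 63) ?m5" by (simp add: ac_simps)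
  moreover have "?m5 i = out i" if "i < M" for i
  proof -
    have "i = 0 \<or> i = 1 \<or> (\<exists>r. i = r + 2 \<and> r < 22) \<or> 24 \<le> i" by presburger
    then consider "i = 0" | "i = 1" | r where "i = r + 2" "r < 22" | "24 \<le> i" by blast
    then show ?thesis
    proof cases
      case 1 then show ?thesis using st[of 0] that by simp
    next
      case 2 then show ?thesis using st[of 1] that by simp
    next
      case 3 then show ?thesis using m4(3)[of r] st[of i] that by simp
    next
      case 4
      then show ?thesis using m4(4)[of i] M2(3)[of i] that by (simp add: m3_def)
    qed
  qed
  ultimately show ?thesis by blast
qed

section \<open>The complete program and its running time\<close>

definition init :: hcom where
  "init = HConst 4 0 \<triangleright> HConst 9 0 \<triangleright> HConst 10 0 \<triangleright> HSub 11 3 4"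

text \<open>The output starts at index 2: the two sizes that precede the trees are known only at the
  end and are inserted by \<open>finish\<close>.\<close>

definition setup_tasks :: hcom where
  "setup_tasks = HConst 5 0 \<triangleright> HConst 13 0 \<triangleright> HConst 11 7 \<triangleright> push 11 9 13 \<triangleright> HConst 11 10 \<triangleright> push 11 13 13 \<triangleright>
     HConst 11 4 \<triangleright> push 11 9 13 \<triangleright> HConst 6 2 \<triangleright> HConst 7 0 \<triangleright> HConst 8 0"

definition program :: rcom where
  "program = prologue ;; lower init ;; While 11 (lower scan_code) ;; lower setup_tasks ;; While 5 (lower body) ;;
     lower finish ;; epilogue"

lemma length_prefix: "length (prefix f n) = n"
  by (induction n) auto

lemma nth_prefix: "i < n \<Longrightarrow> prefix f n ! i = f i"
  by (induction n) (auto simp: nth_append length_prefix less_Suc_eq)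

lemma length_enc: "3 \<le> length (enc F)" "length (enc F) \<le> 4 * fsize F - 1"
proof -
  show "3 \<le> length (enc F)" by (induction F) auto
  have "length (enc F) + 1 \<le> 4 * fsize F" by (induction F) auto
  then show "length (enc F) \<le> 4 * fsize F - 1" by simp
qed

lemma stack_eq_Nil: "stack a b c n = [] \<longleftrightarrow> n = 0"
  by (cases n) auto

lemma program_correct:
  assumes "over_vars n F"
  defines "n1 \<equiv> nodes (pattern_tree F)" and "n2 \<equiv> nodes (host_tree F)"
  shows "\<exists>t m'. big program (input n F) t m' \<and>
    t \<le> (1250 + cost init + 4 * (cost scan_code + 3) + cost setup_tasks + 11 * (cost body + 3) + cost finish) * n2 \<and>
    m' 0 = n1 \<and> m' 1 = n2 \<and> (\<forall>v<n1. m' (2 + v) = lay 0 0 (pattern_tree F) ! v) \<and>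
    (\<forall>v<n2. m' (2 + n1 + v) = lay 0 0 (host_tree F) ! v)"
proof -
  let ?m = "input n F"
  let ?len = "length (enc F)"
  have m1: "?m 1 = ?len" by (simp add: input_def)
  define B where "B = 32 * ?len"
  have B: "96 \<le> B" "?len + 2 \<le> B" using length_enc(1)[of F] unfolding B_def by auto
  obtain ma where ma: "big prologue ?m (8 * (B - 24) + 62) ma" "ma 2 = B" "ma 3 = ?len"
      "\<And>k. k < B - 2 \<Longrightarrow> ma (B + 16 * k) = ?m (k + 2)"
      "\<And>a. B \<le> a \<Longrightarrow> (\<And>k. k < B - 2 \<Longrightarrow> a \<noteq> B + 16 * k) \<Longrightarrow> ma a = ?m a"
    using prologue_correct[of ?m] length_enc(1)[of F] unfolding m1 B_def by metis
  define \<alpha> where "\<alpha> = (\<lambda>j i. ma (B + 16 * i + j))"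
  define T where "T = \<alpha> 0"
  have rela: "rel B (ma, \<alpha>) ma" using ma(2) B unfolding rel_def \<alpha>_def by simp
  have T: "machine.enc_at T 0 F"
    unfolding machine.enc_at_def T_def \<alpha>_def using ma(4) B(2) by (auto simp: input_def)
  \<comment> \<open>The other arrays lie beyond the input and are not touched by the copying, so
    tables and marks start at 0 without being cleared.\<close>
  have zero: "\<alpha> j i = 0" if "0 < j" "j < 16" for i j
  proof -
    have "ma (B + 16 * i + j) = ?m (B + 16 * i + j)"
      using array_address_inj[of _ 0 i j] that by (intro ma(5)) force+
    also have "\<dots> = 0"
    proof -
      have "\<not> B + 16 * i + j - 2 < ?len" "B + 16 * i + j \<noteq> 0" "B + 16 * i + j \<noteq> 1" using B by linarith+
      then show ?thesis unfolding input_def by (simp only: if_False)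
    qed
    finally show ?thesis by (simp add: \<alpha>_def)
  qed
  obtain tb mb where mb: "big (lower init) ma tb mb" "tb \<le> cost init" "rel B (hex init (ma, \<alpha>)) mb"
    using lower_correct[OF _ rela, of init] by (auto simp: init_def reg_def)
  have Sb: "scan_repr T ?len 0 [] (hex init (ma, \<alpha>))"
    using ma(3) zero[of 5] zero[of 6] zero[of 8] by (simp add: init_def T_def fun_eq_iff)
  obtain k where k: "k \<le> ?len" "loops scan_code 11 (scan_repr T ?len 0 []) k (scan_repr T ?len ?len (varlist F))"
    using scan_run[OF T, of ?len "[]"] by auto
  obtain tc mc sc where mc: "big (While 11 (lower scan_code)) mb tc mc" "tc \<le> k * (cost scan_code + 3) + 1"
      "rel B sc mc" "scan_repr T ?len ?len (varlist F) sc"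
    using while_loops[OF wf_scan_code _ mb(3) Sb k(2)] by (fastforce simp: reg_def)
  obtain td md where md: "big (lower setup_tasks) mc td md" "td \<le> cost setup_tasks" "rel B (hex setup_tasks sc) md"
    using lower_correct[OF _ mc(3), of setup_tasks] by (auto simp: setup_tasks_def push_def reg_def)
  define L where "L = snd sc 7"
  \<comment> \<open>\<open>x\<close> and \<open>y\<close> are whatever the two slots reserved for
    the sizes contain.\<close>
  obtain x y p where Sd: "machine.repr T L (numA F) (numB F)
      ([(4, numA F, 0), (10, 0, 0), (7, numA F, 0)], p, \<lambda>_. 0, \<lambda>_. 0, [x, y], 0, 0) (hex setup_tasks sc)"
    using mc(4) by (cases sc) (simp add: setup_tasks_def push_def machine.repr.simps L_def numA_def numB_def eval_nat_numeral)
  have L: "L i = varlist F ! i" if "i < length (varlist F)" for i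
    using mc(4) that by (cases sc) (simp add: L_def)
  let ?out = "[x, y] @ lay 0 0 (pattern_tree F) @ lay 0 0 (host_tree F)"
  obtain l p' va vb where l: "l \<le> 3 * n1 + 3 * n2 + 2"
    "loops body 5 (machine.repr T L (numA F) (numB F)
      ([(4, numA F, 0), (10, 0, 0), (7, numA F, 0)], p, \<lambda>_. 0, \<lambda>_. 0, [x, y], 0, 0)) l
      (machine.repr T L (numA F) (numB F) ([], p', va, vb, ?out, n2, n1))"
    using machine.main_run[OF T refl refl L, of p "[x, y]" 0]
    unfolding machine.leads_def machine.reach_def n1_def n2_def by blast
  have wf: "reg 5" "\<And>s. machine.repr T L (numA F) (numB F) ([], p', va, vb, ?out, n2, n1) s \<Longrightarrow> fst s 5 = 0"
    by (auto simp: reg_def machine.repr.simps split_paired_all stack_eq_Nil)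
  obtain te me se where me: "big (While 5 (lower body)) md te me" "te \<le> l * (cost body + 3) + 1"
      "rel B se me" "machine.repr T L (numA F) (numB F) ([], p', va, vb, ?out, n2, n1) se"
    using while_loops[OF wf_body wf(1) md(3) Sd l(2) wf(2)] by blast
  obtain tf mf where mf: "big (lower finish) me tf mf" "tf \<le> cost finish" "rel B (hex finish se) mf"
    using lower_correct[OF _ me(3), of finish] by (auto simp: finish_def wf_stash reg_def)
  define M where "M = 2 + n1 + n2"
  define out where "out i = (if i = 0 then n1 else if i = 1 then n2 else (lay 0 0 (pattern_tree F) @ lay 0 0 (host_tree F)) ! (i - 2))" for i
  obtain \<rho> \<beta> where se: "se = (\<rho>, \<beta>)" by fastforce
  have pre: "prefix (\<beta> 4) (\<rho> 6) = ?out" and r: "\<rho> 7 = n2" "\<rho> 8 = n1"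
    using me(4) unfolding se machine.repr.simps by auto
  have M: "\<rho> 6 = M" using arg_cong[OF pre, of length] by (simp add: length_prefix M_def n1_def n2_def)
  define \<beta>' where "\<beta>' = \<beta>(4 := (\<beta> 4)(0 := n1, 1 := n2))"
  define \<rho>' where "\<rho>' = \<rho>(11 := 1)"
  have fin: "hex finish se = hex (stash 24) (\<rho>', \<beta>')"
    unfolding finish_def se \<rho>'_def \<beta>'_def using r by simp
  have \<beta>': "\<beta>' 4 i = out i" if "i < M" for i
  proof -
    have "\<beta> 4 i = ?out ! i" using nth_prefix[of i M "\<beta> 4"] that M pre by simp
    then show ?thesis by (auto simp: \<beta>'_def out_def nth_Cons' numeral_2_eq_2)
  qed
  have st: "fst (hex finish se) 6 = M" "\<And>i. i < M \<Longrightarrow> snd (hex finish se) 4 i = out i"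
    "\<And>i. i < M \<Longrightarrow> i < 24 \<Longrightarrow> snd (hex finish se) 4 (M + i) = out i"
    using hex_stash[of 24 \<rho>' \<beta>'] \<beta>' M unfolding fin by (auto simp: \<rho>'_def)
  obtain mg where mg: "big epilogue mf (8 * (M - 24) + 63) mg" "\<And>i. i < M \<Longrightarrow> mg i = out i"
  proof -
    have rl: "24 \<le> B" "mf 2 = B" "\<And>r. reg r \<Longrightarrow> mf r = fst (hex finish se) r"
      "\<And>i. mf (B + 16 * i + 4) = snd (hex finish se) 4 i"
      using mf(3) unfolding rel_def by simp_all
    have "mf 6 = M" using rl(3)[of 6] st(1) by (simp add: reg_def)
    then have "\<exists>m'. big epilogue mf (8 * (M - 24) + 63) m' \<and> (\<forall>i<M. m' i = out i)"
      using epilogue_correct[of B mf M out, OF rl(1,2)] st(2,3) unfolding rl(4) by blast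
    then show thesis using that by blast
  qed
  let ?t = "8 * (B - 24) + 62 + (tb + (tc + (td + (te + (tf + (8 * (M - 24) + 63))))))"
  have "big program ?m ?t mg"
    unfolding program_def
    by (rule big.Seq[OF ma(1) big.Seq[OF mb(1) big.Seq[OF mc(1) big.Seq[OF md(1) big.Seq[OF me(1) big.Seq[OF mf(1) mg(1)]]]]]])
  \<comment> \<open>1250 exceeds 1024 + 40 for the copying loops plus 62 + 63 + 2 for fixed
    overhead. The factor 4 bounds the tokens, and 11 comes from \<open>3 * n1 + 3 * n2 + 2\<close>
    with \<open>n1 \<le> 2 * n2\<close>.\<close>
  moreover have "?t \<le> (1250 + cost init + 4 * (cost scan_code + 3) + cost setup_tasks + 11 * (cost body + 3) + cost finish) * n2"
  proof -
    have N: "1 \<le> n2" "n1 \<le> 2 * n2" using nodes_pattern_le_host_tree[OF assms(1)] nodes_pos[of "host_tree F"] unfolding n1_def n2_def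
      by linarith+
    have len: "?len \<le> 4 * n2" using length_enc(2)[of F] fsize_le_nodes_host_tree[of F] unfolding n2_def by linarith
    have "k * (cost scan_code + 3) \<le> 4 * n2 * (cost scan_code + 3)" using k len by (intro mult_right_mono) auto
    moreover have "l * (cost body + 3) \<le> 11 * n2 * (cost body + 3)" using l(1) N by (intro mult_right_mono) auto
    moreover have "cost init \<le> cost init * n2" "cost setup_tasks \<le> cost setup_tasks * n2" "cost finish \<le> cost finish * n2"
      using N(1) by auto
    moreover have "8 * (B - 24) \<le> 1024 * n2" using len unfolding B_def by simp
    moreover have "8 * (M - 24) \<le> 40 * n2" using N unfolding M_def by simp
    moreover have "(1250 + cost init + 4 * (cost scan_code + 3) + cost setup_tasks + 11 * (cost body + 3) + cost finish) * n2 =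
      1250 * n2 + cost init * n2 + 4 * n2 * (cost scan_code + 3) + cost setup_tasks * n2 + 11 * n2 * (cost body + 3) + cost finish * n2"
      by (simp add: algebra_simps)
    ultimately show ?thesis using mb(2) mc(2) md(2) me(2) mf(2) N(1) by linarith
  qed
  moreover have "mg 0 = n1" "mg 1 = n2" using mg(2)[of 0] mg(2)[of 1] by (simp_all add: M_def out_def)
  moreover have "mg (2 + v) = lay 0 0 (pattern_tree F) ! v" if "v < n1" for v
    using mg(2)[of "2 + v"] that by (simp add: M_def out_def nth_append n1_def)
  moreover have "mg (2 + n1 + v) = lay 0 0 (host_tree F) ! v" if "v < n2" for v
    using mg(2)[of "2 + n1 + v"] that by (simp add: M_def out_def nth_append n1_def)
  ultimately show ?thesis by blast
qed

theorem theorem2: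
  shows "\<exists>(P::instr list) (C::real). C > 0 \<and>
    (\<forall>n F. over_vars n F \<longrightarrow>
      (\<exists>t m'. runs_within P (input n F) t m' \<and>
         binary_tree (out_m1 m') (out_p1 m') \<and>
         binary_tree (out_m2 m') (out_p2 m') \<and>
         real (out_m1 m') \<le> C * 2 powr (real n / 2) * real (fsize F) \<and>
         real (out_m2 m') \<le> C * 2 powr (real n / 2) * real (fsize F) ^ 2 \<and>
         real t \<le> C * real (out_m2 m') \<and>
         (contained (out_m1 m') (out_p1 m') (out_m2 m') (out_p2 m') \<longleftrightarrow> satisfiable n F)))"
proof -
  define K where "K = 1250 + cost init + 4 * (cost scan_code + 3) + cost setup_tasks + 11 * (cost body + 3) + cost finish"
  show ?thesis
  proof (intro exI[of _ "compile 0 program"] exI[of _ "real K"] conjI allI impI)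
    show "0 < real K" by (simp add: K_def)
    fix n F assume F: "over_vars n F"
    let ?n1 = "nodes (pattern_tree F)" and ?n2 = "nodes (host_tree F)"
    obtain t m where m: "big program (input n F) t m" "t \<le> K * ?n2" "m 0 = ?n1" "m 1 = ?n2"
        "\<And>v. v < ?n1 \<Longrightarrow> m (2 + v) = lay 0 0 (pattern_tree F) ! v"
        "\<And>v. v < ?n2 \<Longrightarrow> m (2 + ?n1 + v) = lay 0 0 (host_tree F) ! v"
      using program_correct[OF F] unfolding K_def by blast
    have o: "out_m1 m = ?n1" "out_m2 m = ?n2" by (simp_all add: out_m1_def out_m2_def m(3,4)[unfolded One_nat_def])
    have l1: "laid (out_p1 m) 0 0 (pattern_tree F)"
      by (rule laid_lay) (use m(5) in \<open>simp add: out_p1_def\<close>)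
    have l2: "laid (out_p2 m) 0 0 (host_tree F)"
      by (rule laid_lay) (use m(6) in \<open>simp add: out_p2_def m(3)\<close>)
    \<comment> \<open>46 = 2 * 23: the constant of \<open>nodes_host_tree\<close> times the factor 2
      lost in rounding the half.\<close>
    have K: "46 \<le> real K" by (simp add: K_def)
    have p: "real (2 ^ numA F) \<le> 2 * 2 powr (real n / 2)" by (rule two_power_numA[OF F])
    have "real ?n1 \<le> real (9 * fsize F * 2 ^ numA F)"
      using nodes_pattern_tree[of F] by (rule of_nat_mono)
    also have "\<dots> = 9 * real (fsize F) * real (2 ^ numA F)" by simp
    also have "\<dots> \<le> 9 * real (fsize F) * (2 * 2 powr (real n / 2))" using p by (intro mult_left_mono) auto
    also have "\<dots> = 18 * (2 powr (real n / 2) * real (fsize F))" by simp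
    also have "\<dots> \<le> real K * (2 powr (real n / 2) * real (fsize F))" using K by (intro mult_right_mono) auto
    finally have b1: "real ?n1 \<le> real K * 2 powr (real n / 2) * real (fsize F)" by (simp add: mult.assoc)
    have "real ?n2 \<le> real (23 * (fsize F)\<^sup>2 * 2 ^ numA F)"
      using nodes_host_tree[of F] by (rule of_nat_mono)
    also have "\<dots> = 23 * real (fsize F) ^ 2 * real (2 ^ numA F)" by simp
    also have "\<dots> \<le> 23 * real (fsize F) ^ 2 * (2 * 2 powr (real n / 2))" using p by (intro mult_left_mono) auto
    also have "\<dots> = 46 * (2 powr (real n / 2) * real (fsize F) ^ 2)" by simp
    also have "\<dots> \<le> real K * (2 powr (real n / 2) * real (fsize F) ^ 2)" using K by (intro mult_right_mono) auto
    finally have b2: "real ?n2 \<le> real K * 2 powr (real n / 2) * real (fsize F) ^ 2" by (simp add: mult.assoc)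
    have "real t \<le> real (K * ?n2)" using m(2) by (rule of_nat_mono)
    then have b3: "real t \<le> real K * real ?n2" by simp
    have "contained ?n1 (out_p1 m) ?n2 (out_p2 m) \<longleftrightarrow> satisfiable n F"
      by (simp add: contained_iff_emb[OF l1 l2 height_pattern_host] emb_pattern_host satisfiable_iff[OF F])
    with b1 b2 b3 show "\<exists>t m'. runs_within (compile 0 program) (input n F) t m' \<and>
         binary_tree (out_m1 m') (out_p1 m') \<and>
         binary_tree (out_m2 m') (out_p2 m') \<and>
         real (out_m1 m') \<le> real K * 2 powr (real n / 2) * real (fsize F) \<and>
         real (out_m2 m') \<le> real K * 2 powr (real n / 2) * real (fsize F) ^ 2 \<and>
         real t \<le> real K * real (out_m2 m') \<and>
         (contained (out_m1 m') (out_p1 m') (out_m2 m') (out_p2 m') \<longleftrightarrow> satisfiable n F)"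
      using runs_within_compile[OF m(1)] laid_binary_tree[OF l1] laid_binary_tree[OF l2]
      by (intro exI[of _ t] exI[of _ m]) (simp only: o)
  qed
qed

end
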